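(* Let $E$ be a Dedekind complete vector lattice that admits a (necessarily unique) Hausdorff uo-Lebesgue topology $\widehat\tau_E$. Suppose that $\mathcal{A}$ is a (not necessarily unital) associative subalgebra of $\mathrm{Orth}(E)$. Then the closure $\overline{\mathcal{A}}^{\widehat\tau_{\mathcal{L}_{\mathrm{ob}}(E)}}$ in $\mathcal{L}_{\mathrm{ob}}(E)$ and the adherence $a_{\mathrm{S}\widehat\tau_E}(\mathcal{A})$ in $\mathcal{L}_{\mathrm{ob}}(E)$ are equal, and are subalgebras of $\mathrm{Orth}(E)$. When $\mathcal{A}$ is a vector lattice subalgebra of $\mathrm{Orth}(E)$ (i.e. a subalgebra that is also a vector sublattice), then so is $\overline{\mathcal{A}}^{\widehat\tau_{\mathcal{L}_{\mathrm{ob}}(E)}}=a_{\mathrm{S}\widehat\tau_E}(\mathcal{A})$.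
   Context: All vector lattices are real and Archimedean. $\mathcal{L}_{\mathrm{ob}}(E)$ is the space of order bounded linear operators on $E$, a Dedekind complete vector lattice in the operator order when $E$ is Dedekind complete; $\mathrm{Orth}(E)$ is the vector lattice algebra of orthomorphisms on $E$, i.e. of order bounded linear operators $T:E\to E$ with $T(B)\subseteq B$ for every band $B$ of $E$. In a vector lattice $G$, a net $(x_\alpha)_{\alpha\in A}$ is order convergent to $x$ ($x_\alpha\xrightarrow{\mathrm{o}}x$) if there is a net $(y_\beta)_{\beta\in B}$ in $G$ with $y_\beta\downarrow 0$ such that for every $\beta_0\in B$ there is $\alpha_0\in A$ with $|x-x_\alpha|\le y_{\beta_0}$ for all $\alpha\ge\alpha_0$; it is unbounded order convergent to $x$ ($x_\alpha\xrightarrow{\mathrm{uo}}x$) if $|x_\alpha-x|\wedge y\xrightarrow{\mathrm{o}}0$ in $G$ for all $y\in G^+$. A uo-Lebesgue topology on $G$ is a locally solid linear topology $\tau$ on $G$ such that $x_\alpha\xrightarrow{\mathrm{uo}}0$ implies $x_\alpha\xrightarrow{\tau}0$ for every net; $G$ admits at most one Hausdorff one, denoted $\widehat\tau_G$. For Dedekind complete $E$ admitting a Hausdorff uo-Lebesgue topology, $\mathcal{L}_{\mathrm{ob}}(E)$ also admits one. For $\mathcal{S}\subseteq\mathcal{L}_{\mathrm{ob}}(E)$, $a_{\mathrm{S}\widehat\tau_E}(\mathcal{S})$ is the set of all $T\in\mathcal{L}_{\mathrm{ob}}(E)$ for which there is a net $(T_\alpha)$ in $\mathcal{S}$ with $T_\alpha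 x\xrightarrow{\widehat\tau_E}Tx$ for all $x\in E$. *)

theory Defs
  imports "HOL-Analysis.Analysis" "HOL-Library.Lattice_Algebras"
begin

section \<open>Vector lattices\<close>

text \<open>
  The Archimedean property is not imposed on \<open>vector_lattice\<close>; it is automatic for Dedekind
  complete vector lattices, and hence also for their lattices of order bounded operators.
\<close>

class vector_lattice = ordered_real_vector + lattice_ab_group_add_abs

class dedekind_complete_vector_lattice = vector_lattice + conditionally_complete_lattice

instance real :: dedekind_complete_vector_lattice ..

definition solid :: "'a::vector_lattice set \<Rightarrow> bool" where
  "solid S \<longleftrightarrow> (\<forall>x y. y \<in> S \<and> \<bar>x\<bar> \<le> \<bar>y\<bar> \<longrightarrow> x \<in> S)"

definition is_supremum :: "'a::order set \<Rightarrow> 'a \<Rightarrow> bool" where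
  "is_supremum S s \<longleftrightarrow> (\<forall>x\<in>S. x \<le> s) \<and> (\<forall>u. (\<forall>x\<in>S. x \<le> u) \<longrightarrow> s \<le> u)"

definition is_infimum :: "'a::order set \<Rightarrow> 'a \<Rightarrow> bool" where
  "is_infimum S s \<longleftrightarrow> (\<forall>x\<in>S. s \<le> x) \<and> (\<forall>u. (\<forall>x\<in>S. u \<le> x) \<longrightarrow> u \<le> s)"

definition band :: "'a::vector_lattice set \<Rightarrow> bool" where
  "band B \<longleftrightarrow> subspace B \<and> solid B \<and> (\<forall>S s. S \<subseteq> B \<and> is_supremum S s \<longrightarrow> s \<in> B)"

definition sublattice :: "'a::lattice set \<Rightarrow> bool" where
  "sublattice S \<longleftrightarrow> (\<forall>x\<in>S. \<forall>y\<in>S. sup x y \<in> S \<and> inf x y \<in> S)"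


section \<open>Nets and unbounded order convergence\<close>

text \<open>
  A net in \<open>'a\<close> is a function \<open>x :: 'i \<Rightarrow> 'a\<close> together with a directed set \<open>(A, le)\<close> in \<open>'i\<close>.
\<close>

definition directed_set :: "'i set \<Rightarrow> ('i \<Rightarrow> 'i \<Rightarrow> bool) \<Rightarrow> bool" where
  "directed_set A le \<longleftrightarrow> A \<noteq> {} \<and>
     (\<forall>a\<in>A. le a a) \<and>
     (\<forall>a\<in>A. \<forall>b\<in>A. \<forall>c\<in>A. le a b \<and> le b c \<longrightarrow> le a c) \<and>
     (\<forall>a\<in>A. \<forall>b\<in>A. \<exists>c\<in>A. le a c \<and> le b c)"

definition net_filter :: "'i set \<Rightarrow> ('i \<Rightarrow> 'i \<Rightarrow> bool) \<Rightarrow> 'i filter" where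
  "net_filter A le = (INF a\<in>A. principal {b \<in> A. le a b})"

lemma eventually_net_filter:
  assumes "directed_set A le"
  shows "eventually P (net_filter A le) \<longleftrightarrow> (\<exists>a\<in>A. \<forall>b\<in>A. le a b \<longrightarrow> P b)"
proof -
  have "eventually P (net_filter A le) \<longleftrightarrow>
      (\<exists>a\<in>A. eventually P (principal {b \<in> A. le a b}))"
    unfolding net_filter_def
  proof (rule eventually_INF_base)
    show "A \<noteq> {}"
      using assms by (simp add: directed_set_def)
  next
    fix a b assume ab: "a \<in> A" "b \<in> A"
    then obtain c where c: "c \<in> A" "le a c" "le b c"
      using assms unfolding directed_set_def by meson
    then have "{d \<in> A. le c d} \<subseteq> {d \<in> A. le a d} \<inter> {d \<in> A. le b d}"
      using assms ab unfolding directed_set_def by blast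
    with c show "\<exists>x\<in>A. principal {b \<in> A. le x b}
        \<le> inf (principal {b \<in> A. le a b}) (principal {d \<in> A. le b d})"
      by auto
  qed
  then show ?thesis
    by (auto simp: eventually_principal)
qed

definition decreases_to_0 ::
  "'b set \<Rightarrow> ('b \<Rightarrow> 'b \<Rightarrow> bool) \<Rightarrow> ('b \<Rightarrow> 'a::vector_lattice) \<Rightarrow> bool" where
  "decreases_to_0 B le y \<longleftrightarrow>
     (\<forall>b\<in>B. \<forall>c\<in>B. le b c \<longrightarrow> y c \<le> y b) \<and> is_infimum (y ` B) 0"

text \<open>
  HOL cannot quantify over index types inside a definition. For the dominating net in \<open>'a\<close> the
  index type \<open>'a\<close> suffices (index a decreasing net by its range), and for a net in \<open>'a\<close> that
  matters only through its tails the index type \<open>'a \<times> 'a set\<close> suffices. The lemmas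
  \<open>order_convergentI\<close>, \<open>uo_lebesgue_any_index\<close> and \<open>strong_adherence_any_index\<close> show that
  nothing is lost by fixing these index types.
\<close>

definition order_convergent ::
  "'i set \<Rightarrow> ('i \<Rightarrow> 'i \<Rightarrow> bool) \<Rightarrow> ('i \<Rightarrow> 'a::vector_lattice) \<Rightarrow> 'a \<Rightarrow> bool" where
  "order_convergent A le x l \<longleftrightarrow>
     (\<exists>(B :: 'a set) leB y. directed_set B leB \<and> decreases_to_0 B leB y \<and>
        (\<forall>b0\<in>B. \<exists>a0\<in>A. \<forall>a\<in>A. le a0 a \<longrightarrow> \<bar>l - x a\<bar> \<le> y b0))"

definition uo_convergent ::
  "'i set \<Rightarrow> ('i \<Rightarrow> 'i \<Rightarrow> bool) \<Rightarrow> ('i \<Rightarrow> 'a::vector_lattice) \<Rightarrow> 'a \<Rightarrow> bool" where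
  "uo_convergent A le x l \<longleftrightarrow>
     (\<forall>y\<ge>0. order_convergent A le (\<lambda>a. inf \<bar>x a - l\<bar> y) 0)"

lemma order_convergentI:
  fixes y :: "'b \<Rightarrow> 'a::vector_lattice"
  assumes "directed_set B leB" "decreases_to_0 B leB y"
    and dom: "\<And>b. b \<in> B \<Longrightarrow> \<exists>a0\<in>A. \<forall>a\<in>A. le a0 a \<longrightarrow> \<bar>l - x a\<bar> \<le> y b"
  shows "order_convergent A le x l"
proof -
  have "directed_set (y ` B) (\<lambda>p q. q \<le> p)"
    unfolding directed_set_def
  proof (intro conjI ballI impI)
    show "y ` B \<noteq> {}"
      using assms(1) by (simp add: directed_set_def)
  next
    fix p q assume "p \<in> y ` B" "q \<in> y ` B"
    then obtain b c where bc: "b \<in> B" "c \<in> B" "p = y b" "q = y c"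
      by blast
    then obtain d where "d \<in> B" "leB b d" "leB c d"
      using assms(1) unfolding directed_set_def by meson
    with bc show "\<exists>r\<in>y ` B. r \<le> p \<and> r \<le> q"
      using assms(2) unfolding decreases_to_0_def by blast
  qed auto
  moreover have "decreases_to_0 (y ` B) (\<lambda>p q. q \<le> p) (\<lambda>p. p)"
    using assms(2) unfolding decreases_to_0_def by auto
  ultimately show ?thesis
    unfolding order_convergent_def using dom by blast
qed

lemma net_reindex:
  fixes x :: "'i \<Rightarrow> 'a"
  assumes "directed_set A le"
  obtains A' :: "('a \<times> 'a set) set" and le' where
    "directed_set A' le'" "fst ` A' \<subseteq> x ` A"
    "\<And>P. (\<exists>a\<in>A'. \<forall>b\<in>A'. le' a b \<longrightarrow> P (fst b)) \<longleftrightarrow> (\<exists>a\<in>A. \<forall>b\<in>A. le a b \<longrightarrow> P (x b))"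
proof -
  define tl where "tl a = x ` {b \<in> A. le a b}" for a
  define A' where "A' = {(p, U). \<exists>a\<in>A. U = tl a \<and> p \<in> U}"
  define le' :: "'a \<times> 'a set \<Rightarrow> 'a \<times> 'a set \<Rightarrow> bool" where "le' r s \<longleftrightarrow> snd s \<subseteq> snd r" for r s
  have mem: "x a \<in> tl a" if "a \<in> A" for a
    using assms that by (simp add: directed_set_def tl_def)
  then have refl: "(x a, tl a) \<in> A'" if "a \<in> A" for a
    using that by (auto simp: A'_def)
  have anti: "tl b \<subseteq> tl a" if "a \<in> A" "b \<in> A" "le a b" for a b
    using assms that unfolding directed_set_def tl_def by blast
  show ?thesis
  proof
    show "directed_set A' le'"
      unfolding directed_set_def
    proof (intro conjI ballI impI)
      show "A' \<noteq> {}"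
        using assms refl unfolding directed_set_def by blast
    next
      fix r s assume "r \<in> A'" "s \<in> A'"
      then obtain a b where ab: "a \<in> A" "b \<in> A" "snd r = tl a" "snd s = tl b"
        unfolding A'_def by auto
      then obtain c where "c \<in> A" "le a c" "le b c"
        using assms unfolding directed_set_def by meson
      with ab anti show "\<exists>t\<in>A'. le' r t \<and> le' s t"
        by (intro bexI[of _ "(x c, tl c)"]) (auto simp: le'_def refl)
    qed (auto simp: le'_def)
    show "fst ` A' \<subseteq> x ` A"
      unfolding A'_def tl_def by auto
    fix P
    show "(\<exists>a\<in>A'. \<forall>b\<in>A'. le' a b \<longrightarrow> P (fst b)) \<longleftrightarrow> (\<exists>a\<in>A. \<forall>b\<in>A. le a b \<longrightarrow> P (x b))"
    proof
      assume "\<exists>a\<in>A'. \<forall>b\<in>A'. le' a b \<longrightarrow> P (fst b)"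
      then obtain a where a: "a \<in> A" "\<And>b. b \<in> A' \<Longrightarrow> snd b \<subseteq> tl a \<Longrightarrow> P (fst b)"
        unfolding A'_def le'_def by auto
      then have "P (x b)" if "b \<in> A" "le a b" for b
        using a(2)[of "(x b, tl b)"] anti[of a b] refl[of b] that a(1) by simp
      with a show "\<exists>a\<in>A. \<forall>b\<in>A. le a b \<longrightarrow> P (x b)"
        by blast
    next
      assume "\<exists>a\<in>A. \<forall>b\<in>A. le a b \<longrightarrow> P (x b)"
      then obtain a where a: "a \<in> A" "\<And>p. p \<in> tl a \<Longrightarrow> P p"
        unfolding tl_def by auto
      have "P (fst b)" if "b \<in> A'" "le' (x a, tl a) b" for b
        using a that unfolding A'_def le'_def by auto
      with a refl show "\<exists>a\<in>A'. \<forall>b\<in>A'. le' a b \<longrightarrow> P (fst b)"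
        by blast
    qed
  qed
qed


section \<open>Unbounded order Lebesgue topologies\<close>

definition linear_topology :: "'a::real_vector topology \<Rightarrow> bool" where
  "linear_topology \<tau> \<longleftrightarrow> topspace \<tau> = UNIV \<and>
     continuous_map (prod_topology \<tau> \<tau>) \<tau> (\<lambda>(x, y). x + y) \<and>
     continuous_map (prod_topology euclideanreal \<tau>) \<tau> (\<lambda>(r, x). r *\<^sub>R x)"

definition locally_solid :: "'a::vector_lattice topology \<Rightarrow> bool" where
  "locally_solid \<tau> \<longleftrightarrow>
     (\<forall>U. openin \<tau> U \<and> 0 \<in> U \<longrightarrow>
        (\<exists>V W. solid V \<and> V \<subseteq> U \<and> openin \<tau> W \<and> 0 \<in> W \<and> W \<subseteq> V))"

definition uo_lebesgue :: "'a::vector_lattice topology \<Rightarrow> bool" where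
  "uo_lebesgue \<tau> \<longleftrightarrow> linear_topology \<tau> \<and> locally_solid \<tau> \<and>
     (\<forall>(A :: ('a \<times> 'a set) set) le x. directed_set A le \<and> uo_convergent A le x 0 \<longrightarrow>
        limitin \<tau> x 0 (net_filter A le))"

definition hausdorff_uo_lebesgue :: "'a::vector_lattice topology \<Rightarrow> bool" where
  "hausdorff_uo_lebesgue \<tau> \<longleftrightarrow> uo_lebesgue \<tau> \<and> Hausdorff_space \<tau>"

text \<open>
  The Hausdorff uo-Lebesgue topology of a vector lattice; meaningful only if there is one, in
  which case it is unique.
\<close>

definition uo_topology :: "'a::vector_lattice topology" where
  "uo_topology = (THE \<tau>. hausdorff_uo_lebesgue \<tau>)"

lemma uo_lebesgue_any_index:
  fixes x :: "'i \<Rightarrow> 'a::vector_lattice"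
  assumes "uo_lebesgue \<tau>" and A: "directed_set A le" and uo: "uo_convergent A le x 0"
  shows "limitin \<tau> x 0 (net_filter A le)"
proof -
  obtain A' :: "('a \<times> 'a set) set" and le' where A': "directed_set A' le'"
    and "fst ` A' \<subseteq> x ` A" and ev: "\<And>P. (\<exists>a\<in>A'. \<forall>b\<in>A'. le' a b \<longrightarrow> P (fst b)) \<longleftrightarrow>
      (\<exists>a\<in>A. \<forall>b\<in>A. le a b \<longrightarrow> P (x b))"
    by (rule net_reindex[OF A, of x]) (rule that)
  have "uo_convergent A' le' fst 0"
    using uo unfolding uo_convergent_def order_convergent_def
      ev[of "\<lambda>p. \<bar>0 - inf \<bar>p - 0\<bar> y\<bar> \<le> z" for y z] .
  then have "limitin \<tau> fst 0 (net_filter A' le')"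
    using assms(1) A' unfolding uo_lebesgue_def by blast
  then show ?thesis
    unfolding limitin_def eventually_net_filter[OF A] eventually_net_filter[OF A']
      ev[of "\<lambda>p. p \<in> U" for U] .
qed


section \<open>Order bounded operators\<close>

definition order_bounded :: "('a::vector_lattice \<Rightarrow> 'a) \<Rightarrow> bool" where
  "order_bounded T \<longleftrightarrow> (\<forall>a b. \<exists>c d. T ` {a..b} \<subseteq> {c..d})"

lemma order_boundedE:
  assumes "order_bounded T"
  obtains c d where "\<And>x. a \<le> x \<Longrightarrow> x \<le> b \<Longrightarrow> c \<le> T x \<and> T x \<le> d"
proof -
  obtain c d where "T ` {a..b} \<subseteq> {c..d}"
    using assms unfolding order_bounded_def by blast
  then show thesis
    by (intro that[of c d]) (auto simp: image_subset_iff)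
qed

lemma order_boundedI:
  assumes "\<And>a b. \<exists>c d. \<forall>x. a \<le> x \<and> x \<le> b \<longrightarrow> c \<le> T x \<and> T x \<le> d"
  shows "order_bounded T"
  using assms by (simp add: order_bounded_def image_subset_iff Ball_def)

lemma order_bounded_add:
  assumes "order_bounded S" "order_bounded T"
  shows "order_bounded (\<lambda>x. S x + T x)"
proof (rule order_boundedI)
  fix a b
  obtain c d where "\<And>x. a \<le> x \<Longrightarrow> x \<le> b \<Longrightarrow> c \<le> S x \<and> S x \<le> d"
    using order_boundedE[OF assms(1)] by blast
  moreover obtain c' d' where "\<And>x. a \<le> x \<Longrightarrow> x \<le> b \<Longrightarrow> c' \<le> T x \<and> T x \<le> d'"
    using order_boundedE[OF assms(2)] by blast
  ultimately show "\<exists>c d. \<forall>x. a \<le> x \<and> x \<le> b \<longrightarrow> c \<le> S x + T x \<and> S x + T x \<le> d"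
    by (intro exI[of _ "c + c'"] exI[of _ "d + d'"]) (auto intro: add_mono)
qed

lemma order_bounded_uminus:
  assumes "order_bounded T"
  shows "order_bounded (\<lambda>x. - T x)"
proof (rule order_boundedI)
  fix a b
  obtain c d where "\<And>x. a \<le> x \<Longrightarrow> x \<le> b \<Longrightarrow> c \<le> T x \<and> T x \<le> d"
    using order_boundedE[OF assms] by blast
  then show "\<exists>c d. \<forall>x. a \<le> x \<and> x \<le> b \<longrightarrow> c \<le> - T x \<and> - T x \<le> d"
    by (intro exI[of _ "- d"] exI[of _ "- c"]) auto
qed

lemma order_bounded_scaleR:
  assumes "order_bounded T"
  shows "order_bounded (\<lambda>x. r *\<^sub>R T x)"
proof -
  have nonneg: "order_bounded (\<lambda>x. s *\<^sub>R T x)" if "0 \<le> s" for s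
  proof (rule order_boundedI)
    fix a b
    obtain c d where "\<And>x. a \<le> x \<Longrightarrow> x \<le> b \<Longrightarrow> c \<le> T x \<and> T x \<le> d"
      using order_boundedE[OF assms] by blast
    then show "\<exists>c d. \<forall>x. a \<le> x \<and> x \<le> b \<longrightarrow> c \<le> s *\<^sub>R T x \<and> s *\<^sub>R T x \<le> d"
      using that by (intro exI[of _ "s *\<^sub>R c"] exI[of _ "s *\<^sub>R d"]) (auto intro: scaleR_left_mono)
  qed
  show ?thesis
  proof (cases "0 \<le> r")
    case False
    then show ?thesis
      using order_bounded_uminus[OF nonneg[of "- r"]] by simp
  qed (rule nonneg)
qed

lemma order_bounded_compose:
  assumes "order_bounded S" "order_bounded T"
  shows "order_bounded (\<lambda>x. S (T x))"
proof (rule order_boundedI)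
  fix a b
  obtain c d where "\<And>x. a \<le> x \<Longrightarrow> x \<le> b \<Longrightarrow> c \<le> T x \<and> T x \<le> d"
    using order_boundedE[OF assms(2)] by blast
  moreover obtain c' d' where "\<And>x. c \<le> x \<Longrightarrow> x \<le> d \<Longrightarrow> c' \<le> S x \<and> S x \<le> d'"
    using order_boundedE[OF assms(1)] by blast
  ultimately show "\<exists>c d. \<forall>x. a \<le> x \<and> x \<le> b \<longrightarrow> c \<le> S (T x) \<and> S (T x) \<le> d"
    by blast
qed

text \<open>\<open>'a lob\<close> is the space of order bounded linear operators on \<open>'a\<close>.\<close>

typedef (overloaded) ('a::vector_lattice) lob = "{T :: 'a \<Rightarrow> 'a. linear T \<and> order_bounded T}"
  morphisms lob_apply Lob
proof
  have "order_bounded (\<lambda>x::'a. 0::'a)"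
    by (rule order_boundedI) auto
  then show "(\<lambda>x. 0) \<in> {T :: 'a \<Rightarrow> 'a. linear T \<and> order_bounded T}"
    by (simp add: linear_iff)
qed

setup_lifting type_definition_lob

text \<open>Multiplication of operators is composition; the order is the operator order.\<close>

instantiation lob :: (vector_lattice) real_algebra
begin

lift_definition zero_lob :: "'a lob" is "\<lambda>x. 0"
  by (auto simp: linear_iff intro: order_boundedI)

lift_definition plus_lob :: "'a lob \<Rightarrow> 'a lob \<Rightarrow> 'a lob" is "\<lambda>S T x. S x + T x"
  by (simp add: order_bounded_add linear_compose_add)

lift_definition uminus_lob :: "'a lob \<Rightarrow> 'a lob" is "\<lambda>T x. - T x"
  by (simp add: order_bounded_uminus linear_compose_neg)

lift_definition minus_lob :: "'a lob \<Rightarrow> 'a lob \<Rightarrow> 'a lob" is "\<lambda>S T x. S x - T x"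
  using order_bounded_add[OF _ order_bounded_uminus] by (auto intro: linear_compose_sub)

lift_definition scaleR_lob :: "real \<Rightarrow> 'a lob \<Rightarrow> 'a lob" is "\<lambda>r T x. r *\<^sub>R T x"
  by (simp add: order_bounded_scaleR linear_compose_scale_right)

lift_definition times_lob :: "'a lob \<Rightarrow> 'a lob \<Rightarrow> 'a lob" is "\<lambda>S T x. S (T x)"
  using linear_compose by (fastforce simp: o_def order_bounded_compose)

instance
  by (standard; transfer; auto simp: algebra_simps linear_add linear_scale)

end

instantiation lob :: (vector_lattice) ordered_real_vector
begin

lift_definition less_eq_lob :: "'a lob \<Rightarrow> 'a lob \<Rightarrow> bool" is "\<lambda>S T. \<forall>x\<ge>0. S x \<le> T x" .

definition less_lob :: "'a lob \<Rightarrow> 'a lob \<Rightarrow> bool" where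
  "less_lob S T \<longleftrightarrow> S \<le> T \<and> \<not> T \<le> S"

instance
proof
  fix S T :: "'a lob"
  assume "S \<le> T" "T \<le> S"
  then show "S = T"
  proof transfer
    fix S T :: "'a \<Rightarrow> 'a"
    assume lin: "linear S \<and> order_bounded S" "linear T \<and> order_bounded T"
      and "\<forall>x\<ge>0. S x \<le> T x" "\<forall>x\<ge>0. T x \<le> S x"
    then have pos: "S x = T x" if "0 \<le> x" for x
      using that by (simp add: order.antisym)
    show "S = T"
    proof
      fix x :: 'a
      have x: "x = pprt x - pprt (- x)"
        using prts[of x] by (simp add: pprt_neg)
      have "S (pprt x - pprt (- x)) = T (pprt x - pprt (- x))"
        using lin by (simp only: linear_diff pos zero_le_pprt)
      then show "S x = T x"
        using x by simp
    qed
  qed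
next
  fix S T :: "'a lob"
  show "S < T \<longleftrightarrow> S \<le> T \<and> \<not> T \<le> S"
    by (fact less_lob_def)
qed (transfer; blast intro: order_trans add_left_mono scaleR_left_mono scaleR_right_mono order_refl)+

end


subsection \<open>The lattice structure (Riesz--Kantorovich)\<close>

definition cone_pos :: "('a::dedekind_complete_vector_lattice \<Rightarrow> 'a) \<Rightarrow> 'a \<Rightarrow> 'a" where
  "cone_pos T x = Sup (T ` {0..x})"

definition pos_fun :: "('a::dedekind_complete_vector_lattice \<Rightarrow> 'a) \<Rightarrow> 'a \<Rightarrow> 'a" where
  "pos_fun T x = cone_pos T (pprt x) - cone_pos T (pprt (- x))"

context
  fixes T :: "'a::dedekind_complete_vector_lattice \<Rightarrow> 'a"
  assumes lin: "linear T" and ob: "order_bounded T"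
begin

lemma cone_pos_upper: "T z \<le> cone_pos T x" if "0 \<le> z" "z \<le> x"
proof -
  have "bdd_above (T ` {0..x})"
    using order_boundedE[OF ob, of 0 x] by (meson atLeastAtMost_iff bdd_aboveI2)
  then show ?thesis
    unfolding cone_pos_def using that by (intro cSup_upper) auto
qed

lemma cone_pos_least: "cone_pos T x \<le> u" if "0 \<le> x" "\<And>z. 0 \<le> z \<Longrightarrow> z \<le> x \<Longrightarrow> T z \<le> u"
  unfolding cone_pos_def using that by (intro cSup_least) auto

lemma cone_pos_nonneg: "0 \<le> cone_pos T x" if "0 \<le> x"
  using cone_pos_upper[of 0 x] that linear_0[OF lin] by simp

lemma cone_pos_add:
  assumes "0 \<le> x" "0 \<le> y"
  shows "cone_pos T (x + y) = cone_pos T x + cone_pos T y"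
proof (rule order.antisym)
  show "cone_pos T (x + y) \<le> cone_pos T x + cone_pos T y"
  proof (rule cone_pos_least)
    fix z assume z: "0 \<le> z" "z \<le> x + y"
    have "z - y \<le> inf z x"
      using z assms by (simp add: algebra_simps)
    then have "z - inf z x \<le> y"
      by (simp only: diff_le_eq add.commute)
    moreover have "0 \<le> z - inf z x"
      by (simp only: diff_ge_0_iff_ge inf_le1)
    ultimately have "T (inf z x) + T (z - inf z x) \<le> cone_pos T x + cone_pos T y"
      using z assms by (intro add_mono cone_pos_upper) auto
    moreover have "T z = T (inf z x) + T (z - inf z x)"
      by (simp only: linear_diff[OF lin]) simp
    ultimately show "T z \<le> cone_pos T x + cone_pos T y"
      by simp
  qed (use assms in simp)
  have "cone_pos T x \<le> cone_pos T (x + y) - cone_pos T y"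
  proof (rule cone_pos_least)
    fix u assume u: "0 \<le> u" "u \<le> x"
    have "cone_pos T y \<le> cone_pos T (x + y) - T u"
    proof (rule cone_pos_least)
      fix v assume "0 \<le> v" "v \<le> y"
      then have "T (v + u) \<le> cone_pos T (x + y)"
        using u by (intro cone_pos_upper) (auto simp: add.commute intro: add_mono)
      then show "T v \<le> cone_pos T (x + y) - T u"
        by (simp add: linear_add[OF lin] le_diff_eq)
    qed fact
    then show "T u \<le> cone_pos T (x + y) - cone_pos T y"
      by (simp add: le_diff_eq add.commute)
  qed fact
  then show "cone_pos T x + cone_pos T y \<le> cone_pos T (x + y)"
    by (simp add: le_diff_eq)
qed

lemma cone_pos_scale:
  assumes "0 < r" "0 \<le> x"
  shows "cone_pos T (r *\<^sub>R x) = r *\<^sub>R cone_pos T x"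
proof -
  have le: "cone_pos T (s *\<^sub>R y) \<le> s *\<^sub>R cone_pos T y" if s: "0 < s" "0 \<le> y" for s y
  proof (rule cone_pos_least)
    fix z assume z: "0 \<le> z" "z \<le> s *\<^sub>R y"
    have "inverse s *\<^sub>R z \<le> inverse s *\<^sub>R (s *\<^sub>R y)"
      using z s by (intro scaleR_left_mono) auto
    then have "inverse s *\<^sub>R z \<le> y"
      using s by simp
    then have "T (inverse s *\<^sub>R z) \<le> cone_pos T y"
      using z s by (intro cone_pos_upper) (auto intro: scaleR_nonneg_nonneg)
    then have "s *\<^sub>R T (inverse s *\<^sub>R z) \<le> s *\<^sub>R cone_pos T y"
      using s by (intro scaleR_left_mono) auto
    then show "T z \<le> s *\<^sub>R cone_pos T y"
      using s by (simp add: linear_scale[OF lin])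
  qed (use s in \<open>auto intro: scaleR_nonneg_nonneg\<close>)
  have "cone_pos T (inverse r *\<^sub>R (r *\<^sub>R x)) \<le> inverse r *\<^sub>R cone_pos T (r *\<^sub>R x)"
    using assms by (intro le) (auto intro: scaleR_nonneg_nonneg)
  then have "r *\<^sub>R cone_pos T x \<le> r *\<^sub>R (inverse r *\<^sub>R cone_pos T (r *\<^sub>R x))"
    using assms by (intro scaleR_left_mono) auto
  then show ?thesis
    using le[OF assms] assms by (auto intro: order.antisym)
qed

lemma pos_fun_diff:
  assumes "0 \<le> u" "0 \<le> v"
  shows "pos_fun T (u - v) = cone_pos T u - cone_pos T v"
proof -
  have "u - v = pprt (u - v) - pprt (- (u - v))"
    using prts[of "u - v"] by (simp add: pprt_neg del: minus_diff_eq)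
  then have "u + pprt (- (u - v)) = v + pprt (u - v)"
    by (simp add: algebra_simps)
  then have "cone_pos T (u + pprt (- (u - v))) = cone_pos T (v + pprt (u - v))"
    by (rule arg_cong)
  then have "cone_pos T u + cone_pos T (pprt (- (u - v))) = cone_pos T v + cone_pos T (pprt (u - v))"
    by (simp only: cone_pos_add assms zero_le_pprt)
  then show ?thesis
    unfolding pos_fun_def by (simp add: algebra_simps)
qed

lemma pos_fun_cone: "pos_fun T x = cone_pos T x" if "0 \<le> x"
proof -
  have "cone_pos T 0 = 0"
    using cone_pos_add[of 0 0] by simp
  then show ?thesis
    using pos_fun_diff[of x 0] that by simp
qed

lemma linear_pos_fun: "linear (pos_fun T)"
proof (rule linearI)
  have dec: "x = pprt x - pprt (- x)" for x :: 'a
    using prts[of x] by (simp add: pprt_neg)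
  fix x y :: 'a
  have "x + y = (pprt x - pprt (- x)) + (pprt y - pprt (- y))"
    using dec[of x] dec[of y] by simp
  also have "\<dots> = (pprt x + pprt y) - (pprt (- x) + pprt (- y))"
    by (simp add: algebra_simps)
  finally have "pos_fun T (x + y) = pos_fun T ((pprt x + pprt y) - (pprt (- x) + pprt (- y)))"
    by (rule arg_cong)
  also have "\<dots> = cone_pos T (pprt x + pprt y) - cone_pos T (pprt (- x) + pprt (- y))"
    by (intro pos_fun_diff add_nonneg_nonneg zero_le_pprt)
  finally show "pos_fun T (x + y) = pos_fun T x + pos_fun T y"
    by (simp add: cone_pos_add pos_fun_def[of T x] pos_fun_def[of T y] algebra_simps)
next
  have dec: "x = pprt x - pprt (- x)" for x :: 'a
    using prts[of x] by (simp add: pprt_neg)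
  have pos: "pos_fun T (r *\<^sub>R x) = r *\<^sub>R pos_fun T x" if "0 < r" for r x
  proof -
    have "r *\<^sub>R x = r *\<^sub>R pprt x - r *\<^sub>R pprt (- x)"
      using dec[of x] by (metis scaleR_right_diff_distrib)
    then have "pos_fun T (r *\<^sub>R x) = pos_fun T (r *\<^sub>R pprt x - r *\<^sub>R pprt (- x))"
      by (rule arg_cong)
    also have "\<dots> = cone_pos T (r *\<^sub>R pprt x) - cone_pos T (r *\<^sub>R pprt (- x))"
      using that by (intro pos_fun_diff scaleR_nonneg_nonneg zero_le_pprt) auto
    finally show ?thesis
      using that by (simp add: cone_pos_scale pos_fun_def[of T x] scaleR_right_diff_distrib)
  qed
  have neg: "pos_fun T (- x) = - pos_fun T x" for x
    by (simp add: pos_fun_def)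
  fix r :: real and x :: 'a
  consider "r = 0" | "0 < r" | "0 < - r" by linarith
  then show "pos_fun T (r *\<^sub>R x) = r *\<^sub>R pos_fun T x"
  proof cases
    case 1
    then show ?thesis by (simp add: pos_fun_def)
  next
    case 2
    then show ?thesis by (rule pos)
  next
    case 3
    then show ?thesis using pos[of "- r" x] neg[of "r *\<^sub>R x"] by simp
  qed
qed

lemma order_bounded_pos_fun: "order_bounded (pos_fun T)"
proof (rule order_boundedI)
  fix a b
  have mono: "pos_fun T x \<le> pos_fun T y" if "x \<le> y" for x y
  proof -
    have "0 \<le> pos_fun T (y - x)"
      using that by (simp add: pos_fun_cone cone_pos_nonneg)
    then show ?thesis
      by (simp add: linear_diff[OF linear_pos_fun])
  qed
  then show "\<exists>c d. \<forall>x. a \<le> x \<and> x \<le> b \<longrightarrow> c \<le> pos_fun T x \<and> pos_fun T x \<le> d"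
    by blast
qed

end

lift_definition lob_pos :: "'a::dedekind_complete_vector_lattice lob \<Rightarrow> 'a lob" is pos_fun
  by (simp add: linear_pos_fun order_bounded_pos_fun)

lemma lob_pos_ge: "T \<le> lob_pos T" "0 \<le> lob_pos T"
  by (transfer; simp add: pos_fun_cone cone_pos_upper cone_pos_nonneg)+

lemma lob_pos_least:
  assumes "T \<le> S" "0 \<le> S"
  shows "lob_pos T \<le> S"
  using assms
proof transfer
  fix T S :: "'a \<Rightarrow> 'a"
  assume T: "linear T \<and> order_bounded T" and S: "linear S \<and> order_bounded S"
    and le: "\<forall>x\<ge>0. T x \<le> S x" "\<forall>x\<ge>0. 0 \<le> S x"
  have "T z \<le> S x" if "0 \<le> z" "z \<le> x" for z x
  proof -
    have "0 \<le> S (x - z)"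
      using le that by simp
    then have "S z \<le> S x"
      using S by (simp add: linear_diff)
    then show ?thesis
      using le that order_trans by blast
  qed
  then show "\<forall>x\<ge>0. pos_fun T x \<le> S x"
    using T by (simp add: pos_fun_cone cone_pos_least)
qed

instantiation lob :: (dedekind_complete_vector_lattice) vector_lattice
begin

definition sup_lob :: "'a lob \<Rightarrow> 'a lob \<Rightarrow> 'a lob" where
  "sup_lob S T = T + lob_pos (S - T)"

definition inf_lob :: "'a lob \<Rightarrow> 'a lob \<Rightarrow> 'a lob" where
  "inf_lob S T = - (sup (- S) (- T))"

definition abs_lob :: "'a lob \<Rightarrow> 'a lob" where
  "abs_lob T = sup T (- T)"

instance
proof
  have ub: "S \<le> sup S T" "T \<le> sup S T" for S T :: "'a lob"
    using lob_pos_ge(1)[of "S - T"] lob_pos_ge(2)[of "S - T"]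
    unfolding sup_lob_def by (auto simp: diff_le_eq add.commute)
  have least: "sup S T \<le> U" if "S \<le> U" "T \<le> U" for S T U :: "'a lob"
    using lob_pos_least[of "S - T" "U - T"] that
    unfolding sup_lob_def by (simp add: le_diff_eq add.commute)
  fix S T U :: "'a lob"
  show "S \<le> sup S T" "T \<le> sup S T"
    by (fact ub)+
  show "T \<le> S \<Longrightarrow> U \<le> S \<Longrightarrow> sup T U \<le> S"
    by (rule least)
  show "inf S T \<le> S" "inf S T \<le> T"
    unfolding inf_lob_def using ub(1)[of "- S" "- T"] ub(2)[of "- T" "- S"]
    by (simp_all only: minus_le_iff)
  show "S \<le> T \<Longrightarrow> S \<le> U \<Longrightarrow> S \<le> inf T U"
    unfolding inf_lob_def using least[of "- T" "- S" "- U"] by (simp add: le_minus_iff)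
  show "\<bar>S\<bar> = sup S (- S)"
    by (rule abs_lob_def)
qed

end


section \<open>Orthomorphisms, subalgebras and adherences\<close>

definition Orth :: "'a::vector_lattice lob set" where
  "Orth = {T. \<forall>B. band B \<longrightarrow> lob_apply T ` B \<subseteq> B}"

text \<open>Not necessarily unital.\<close>

definition subalgebra :: "'a::real_algebra set \<Rightarrow> bool" where
  "subalgebra A \<longleftrightarrow> subspace A \<and> (\<forall>S\<in>A. \<forall>T\<in>A. S * T \<in> A)"

definition strong_adherence ::
  "'a::vector_lattice topology \<Rightarrow> 'a lob set \<Rightarrow> 'a lob set" where
  "strong_adherence \<tau> \<S> = {T. \<exists>(A :: ('a lob \<times> 'a lob set) set) le N.
     directed_set A le \<and> N ` A \<subseteq> \<S> \<and>
     (\<forall>x. limitin \<tau> (\<lambda>a. lob_apply (N a) x) (lob_apply T x) (net_filter A le))}"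

lemma strong_adherence_any_index:
  fixes N :: "'i \<Rightarrow> 'a::vector_lattice lob"
  assumes A: "directed_set A le" and "N ` A \<subseteq> \<S>"
    and lim: "\<And>x. limitin \<tau> (\<lambda>a. lob_apply (N a) x) (lob_apply T x) (net_filter A le)"
  shows "T \<in> strong_adherence \<tau> \<S>"
proof -
  obtain A' :: "('a lob \<times> 'a lob set) set" and le' where
    A': "directed_set A' le'" "fst ` A' \<subseteq> N ` A"
    and ev: "\<And>P. (\<exists>a\<in>A'. \<forall>b\<in>A'. le' a b \<longrightarrow> P (fst b)) \<longleftrightarrow>
      (\<exists>a\<in>A. \<forall>b\<in>A. le a b \<longrightarrow> P (N b))"
    by (rule net_reindex[OF A, of N]) (rule that)
  have "limitin \<tau> (\<lambda>a. lob_apply (fst a) x) (lob_apply T x) (net_filter A' le')" for x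
    using lim[of x] unfolding limitin_def eventually_net_filter[OF A]
      eventually_net_filter[OF A'(1)] ev[of "\<lambda>S. lob_apply S x \<in> U" for U] .
  then show ?thesis
    unfolding strong_adherence_def using A' assms(2) by blast
qed

end

theory Submission
  imports Defs
begin

text \<open>
  Every topology below is described by a base of solid neighbourhoods of zero that can be halved,
  separates points and meets every downward directed set with infimum zero (the locale
  \<open>lebesgue_base\<close>). Such a base \<open>\<U>\<close> generates a Hausdorff locally solid linear topology. The
  sets \<open>{x. \<bar>x\<bar> \<and> y \<in> U}\<close> with \<open>y \<ge> 0\<close> and \<open>U \<in> \<U>\<close> form another one (\<open>unbounded\<close>), whose
  topology is moreover uo-Lebesgue.

  Uniqueness of the Hausdorff uo-Lebesgue topology is what makes \<open>uo_topology\<close> usable, and it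
  carries more than its statement: the theorem \<open>comparison\<close> says that in a Dedekind complete
  vector lattice a uo-Lebesgue base is coarser than every Lebesgue base. Were this false, one could
  pick positive elements that are small for the finer base and large for the coarser one, and a
  countable subfamily of the finer base shows that, up to an error which is small for the coarser
  base, a sequence of them is uo-null, hence small for it as well. Applied to an unbounded base it
  also says that the uo-Lebesgue topology \<open>\<tau>\<close> of \<open>E\<close> is its own unbounding.

  On the order bounded operators, the sets of \<open>T\<close> with \<open>\<bar>T\<bar>x \<in> U\<close>, for \<open>x \<ge> 0\<close> and \<open>U\<close> a solid
  neighbourhood of zero in \<open>E\<close>, form a Lebesgue base (\<open>lebesgue_base_abs_strong\<close>), since directed
  suprema of operators are pointwise. By uniqueness the topology generated by its unbounding, whose
  basic sets are \<open>{T. (\<bar>T\<bar> \<and> S)x \<in> U}\<close>, is the uo-Lebesgue topology of the operators.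

  For a set \<open>A\<close> of orthomorphisms the closure in this topology and the strong adherence are both
  equal to \<open>pointwise_closure \<U> A\<close>, where each \<open>x \<ge> 0\<close> is allowed its own approximating element
  of \<open>A\<close>. One element serves finitely many \<open>x\<close> at once because \<open>\<bar>T\<bar>x = \<bar>Tx\<bar>\<close> for an
  orthomorphism \<open>T\<close> (\<open>abs_apply_Orth\<close>); this gives the strong adherence, and it also bounds
  \<open>(\<bar>T\<bar> \<and> S)x\<close> by \<open>\<bar>Tx\<bar>\<close>. In the other direction, \<open>Rx \<and> kx \<le> 2(R \<and> kI)x\<close> for positive
  orthomorphisms (\<open>inf_apply_Orth_le\<close>), so smallness of \<open>(R \<and> kI)x\<close> makes \<open>Rx \<and> kx\<close> small; as
  \<open>Rx\<close> lies in the band generated by \<open>x\<close>, this makes \<open>Rx \<and> y\<close> small for every \<open>y \<ge> 0\<close>, and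
  \<open>\<tau>\<close> is unbounded. That limits of orthomorphisms are orthomorphisms is seen by testing against
  elements disjoint from a band.

  Finally, the closure is a sublattice when \<open>A\<close> is one, because the lattice operations satisfy
  \<open>\<bar>a \<or> b - c \<or> d\<bar> \<le> \<bar>a - c\<bar> + \<bar>b - d\<bar>\<close>. It is closed under products because
  \<open>MN - ST = (M - S)T + M(N - T)\<close> and, as orthomorphisms commute (\<open>Orth_commute\<close>),
  \<open>M(N - T)x = (N - T)Mx\<close>: choosing \<open>M\<close> first and then \<open>N\<close> makes both terms small at \<open>x\<close>.
\<close>

section \<open>Vector lattice preliminaries\<close>

lemma inf_add_le:
  fixes a b c :: "'a::vector_lattice"
  assumes "0 \<le> a" "0 \<le> b" "0 \<le> c"
  shows "inf (a + b) c \<le> inf a c + inf b c"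
proof -
  have "inf (a + b) c \<le> c + b" "inf (a + b) c \<le> a + c"
    using assms by (meson add_increasing add_increasing2 inf.coboundedI2 order_refl)+
  moreover have "inf (a + b) c \<le> c + c"
    using assms by (meson add_increasing inf.coboundedI2 order_refl)
  ultimately show ?thesis
    by (simp add: add_inf_distrib_left add_inf_distrib_right)
qed

lemma inf_abs_add_le:
  fixes a b c :: "'a::vector_lattice"
  assumes "0 \<le> c"
  shows "inf \<bar>a + b\<bar> c \<le> inf \<bar>a\<bar> c + inf \<bar>b\<bar> c"
proof -
  have "inf \<bar>a + b\<bar> c \<le> inf (\<bar>a\<bar> + \<bar>b\<bar>) c"
    by (meson abs_triangle_ineq inf_mono order_refl)
  also have "\<dots> \<le> inf \<bar>a\<bar> c + inf \<bar>b\<bar> c"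
    by (rule inf_add_le) (use assms in auto)
  finally show ?thesis .
qed

lemma abs_scaleR_lattice:
  fixes x :: "'a::vector_lattice"
  shows "\<bar>r *\<^sub>R x\<bar> = \<bar>r\<bar> *\<^sub>R \<bar>x\<bar>"
proof -
  have le: "\<bar>s *\<^sub>R y\<bar> \<le> s *\<^sub>R \<bar>y\<bar>" if "0 \<le> s" for s and y :: 'a
  proof (rule abs_leI)
    show "s *\<^sub>R y \<le> s *\<^sub>R \<bar>y\<bar>"
      using that by (intro scaleR_left_mono abs_ge_self) auto
    have "s *\<^sub>R (- y) \<le> s *\<^sub>R \<bar>y\<bar>"
      using that by (intro scaleR_left_mono abs_ge_minus_self) auto
    then show "- (s *\<^sub>R y) \<le> s *\<^sub>R \<bar>y\<bar>"
      by simp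
  qed
  have eq: "\<bar>s *\<^sub>R y\<bar> = s *\<^sub>R \<bar>y\<bar>" if "0 < s" for s and y :: 'a
  proof (rule order.antisym)
    have "s *\<^sub>R \<bar>inverse s *\<^sub>R (s *\<^sub>R y)\<bar> \<le> s *\<^sub>R (inverse s *\<^sub>R \<bar>s *\<^sub>R y\<bar>)"
      using that by (intro scaleR_left_mono le) auto
    then show "s *\<^sub>R \<bar>y\<bar> \<le> \<bar>s *\<^sub>R y\<bar>"
      using that by simp
  qed (use that le in simp)
  show ?thesis
    using eq[of r x] eq[of "- r" x] by (cases "r = 0"; cases "0 < r") auto
qed

lemma pprt_minus_pprt: "pprt x - pprt (- x) = (x::'a::vector_lattice)"
  using prts[of x] by (simp add: pprt_neg)

lemma abs_eq_pprt_add: "\<bar>x\<bar> = pprt x + pprt (- x)" for x :: "'a::vector_lattice"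
  by (simp add: abs_prts pprt_neg)

lemma pprt_le_abs: "pprt x \<le> \<bar>x\<bar>" for x :: "'a::vector_lattice"
  by (simp add: abs_eq_pprt_add)

lemma pprt_leI: "x \<le> y \<Longrightarrow> 0 \<le> y \<Longrightarrow> pprt x \<le> y" for x y :: "'a::vector_lattice"
  by (simp add: pprt_def)

lemma pprt_ge: "x \<le> pprt x" for x :: "'a::vector_lattice"
  by (simp add: pprt_def)

lemma inf_pprt_pprt_uminus: "inf (pprt x) (pprt (- x)) = 0" for x :: "'a::vector_lattice"
proof -
  have "inf (pprt x) (pprt (- x)) = inf (x + pprt (- x)) (0 + pprt (- x))"
    using pprt_minus_pprt[of x] by (simp add: diff_eq_eq)
  also have "\<dots> = inf x 0 + pprt (- x)"
    by (simp only: add_inf_distrib_right)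
  also have "\<dots> = 0"
    by (simp only: pprt_neg nprt_def add.right_inverse)
  finally show ?thesis .
qed


subsection \<open>Disjointness\<close>

definition lat_disjoint :: "'a::vector_lattice \<Rightarrow> 'a \<Rightarrow> bool" where
  "lat_disjoint x y \<longleftrightarrow> inf \<bar>x\<bar> \<bar>y\<bar> = 0"

lemma lat_disjoint_sym: "lat_disjoint x y \<Longrightarrow> lat_disjoint y x"
  by (simp add: lat_disjoint_def inf_commute)

lemma lat_disjoint_0 [simp]: "lat_disjoint 0 y" "lat_disjoint y 0"
  by (simp_all add: lat_disjoint_def inf_absorb1 inf_absorb2)

lemma lat_disjoint_self: "lat_disjoint x x \<Longrightarrow> x = 0"
  by (simp add: lat_disjoint_def)

lemma lat_disjoint_mono:
  assumes "lat_disjoint x y" "\<bar>u\<bar> \<le> \<bar>x\<bar>" "\<bar>v\<bar> \<le> \<bar>y\<bar>"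
  shows "lat_disjoint u v"
proof -
  have "inf \<bar>u\<bar> \<bar>v\<bar> \<le> 0"
    using assms inf_mono unfolding lat_disjoint_def by metis
  then show ?thesis
    by (simp add: lat_disjoint_def order.antisym)
qed

lemma lat_disjoint_add:
  assumes "lat_disjoint x z" "lat_disjoint y z"
  shows "lat_disjoint (x + y) z"
  using inf_abs_add_le[of "\<bar>z\<bar>" x y] assms by (simp add: lat_disjoint_def order.antisym)

lemma lat_disjoint_uminus [simp]: "lat_disjoint (- x) z = lat_disjoint x z" "lat_disjoint x (- z) = lat_disjoint x z"
  by (simp_all add: lat_disjoint_def)

lemma lat_disjoint_scaleR:
  assumes "lat_disjoint x z"
  shows "lat_disjoint (r *\<^sub>R x) z"
proof -
  have nat: "lat_disjoint (real n *\<^sub>R x) z" for n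
    by (induction n) (auto simp: scaleR_left_distrib assms intro: lat_disjoint_add)
  obtain n where "\<bar>r\<bar> \<le> real n"
    using real_arch_simple by blast
  then have "\<bar>r *\<^sub>R x\<bar> \<le> \<bar>real n *\<^sub>R x\<bar>"
    by (simp add: abs_scaleR_lattice scaleR_right_mono)
  then show ?thesis
    using lat_disjoint_mono[OF nat[of n]] by blast
qed

lemma lat_disjoint_nonneg: "0 \<le> x \<Longrightarrow> 0 \<le> y \<Longrightarrow> lat_disjoint x y \<longleftrightarrow> inf x y = 0"
  by (simp add: lat_disjoint_def)

text \<open>
  Both inequalities are the subadditivity of truncation at \<open>w\<close>, applied to \<open>a + b\<close> and to
  \<open>a = (a + b) - b\<close>.
\<close>

lemma inf_abs_add_disj:
  assumes "lat_disjoint b w" "0 \<le> w"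
  shows "inf \<bar>a + b\<bar> w = inf \<bar>a\<bar> w"
proof -
  have *: "inf \<bar>c + d\<bar> w \<le> inf \<bar>c\<bar> w" if "lat_disjoint d w" for c d
    using inf_abs_add_le[of w c d] that assms(2) by (simp add: lat_disjoint_def)
  show ?thesis
    using *[of b a] *[of "- b" "a + b"] assms(1) by (intro order.antisym) auto
qed


subsection \<open>Suprema and infima in Dedekind complete vector lattices\<close>

lemma is_supremum_cSup:
  fixes S :: "'a::conditionally_complete_lattice set"
  shows "S \<noteq> {} \<Longrightarrow> bdd_above S \<Longrightarrow> is_supremum S (Sup S)"
  by (auto simp: is_supremum_def intro: cSup_upper cSup_least)

text \<open>
  Dedekind completeness gives the Archimedean property: subtracting \<open>x\<close> from the supremum of the
  multiples of \<open>x\<close> still leaves an upper bound of them.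
\<close>

lemma archimedean_le_0:
  fixes x y :: "'a::dedekind_complete_vector_lattice"
  assumes "\<And>n::nat. real (Suc n) *\<^sub>R x \<le> y"
  shows "x \<le> 0"
proof -
  let ?S = "range (\<lambda>n. real (Suc n) *\<^sub>R x)"
  have sup: "is_supremum ?S (Sup ?S)"
    using assms by (intro is_supremum_cSup bdd_aboveI2[where M = y]) simp_all
  have "real (Suc n) *\<^sub>R x \<le> Sup ?S - x" for n
  proof -
    have "real (Suc (Suc n)) *\<^sub>R x \<le> Sup ?S"
      using sup unfolding is_supremum_def by blast
    moreover have "real (Suc (Suc n)) *\<^sub>R x = real (Suc n) *\<^sub>R x + x"
      by (simp add: algebra_simps scaleR_2)
    ultimately show ?thesis
      by (simp only: le_diff_eq)
  qed
  then have "Sup ?S \<le> Sup ?S - x"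
    using sup unfolding is_supremum_def by blast
  then show ?thesis
    by (simp add: le_diff_eq)
qed

lemma archimedean_inverse_le_0:
  fixes x y :: "'a::dedekind_complete_vector_lattice"
  assumes "\<And>n::nat. x \<le> inverse (real (Suc n)) *\<^sub>R y"
  shows "x \<le> 0"
proof (rule archimedean_le_0)
  fix n
  have "real (Suc n) *\<^sub>R x \<le> real (Suc n) *\<^sub>R (inverse (real (Suc n)) *\<^sub>R y)"
    by (intro scaleR_left_mono assms) simp
  then show "real (Suc n) *\<^sub>R x \<le> y"
    by simp
qed

definition down_directed :: "'a::order set \<Rightarrow> bool" where
  "down_directed D \<longleftrightarrow> D \<noteq> {} \<and> (\<forall>a\<in>D. \<forall>b\<in>D. \<exists>c\<in>D. c \<le> a \<and> c \<le> b)"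

lemma is_infimum_inf_const:
  fixes D :: "'a::vector_lattice set"
  assumes "is_infimum D 0" "0 \<le> y"
  shows "is_infimum ((\<lambda>d. inf d y) ` D) 0"
  unfolding is_infimum_def
proof (intro conjI allI impI)
  show "\<forall>x\<in>(\<lambda>d. inf d y) ` D. 0 \<le> x"
    using assms by (auto simp: is_infimum_def)
  show "u \<le> 0" if "\<forall>x\<in>(\<lambda>d. inf d y) ` D. u \<le> x" for u
    using assms that by (auto simp: is_infimum_def)
qed

lemma down_directed_image:
  assumes "down_directed D" "\<And>a b. a \<le> b \<Longrightarrow> f a \<le> f b"
  shows "down_directed (f ` D)"
  using assms unfolding down_directed_def by (auto; meson)

lemma scaled_down:
  fixes x :: "'a::dedekind_complete_vector_lattice"
  assumes "0 \<le> x"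
  shows "down_directed (range (\<lambda>n. inverse (real (Suc n)) *\<^sub>R x))"
    and "is_infimum (range (\<lambda>n. inverse (real (Suc n)) *\<^sub>R x)) 0"
proof -
  have mono: "inverse (real (Suc n)) *\<^sub>R x \<le> inverse (real (Suc m)) *\<^sub>R x" if "m \<le> n" for m n
    using assms that by (intro scaleR_right_mono) (auto simp: field_simps)
  show "down_directed (range (\<lambda>n. inverse (real (Suc n)) *\<^sub>R x))"
    unfolding down_directed_def
  proof (intro conjI ballI)
    fix a b
    assume "a \<in> range (\<lambda>n. inverse (real (Suc n)) *\<^sub>R x)" "b \<in> range (\<lambda>n. inverse (real (Suc n)) *\<^sub>R x)"
    then obtain m n where "a = inverse (real (Suc m)) *\<^sub>R x" "b = inverse (real (Suc n)) *\<^sub>R x"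
      by blast
    then show "\<exists>c\<in>range (\<lambda>n. inverse (real (Suc n)) *\<^sub>R x). c \<le> a \<and> c \<le> b"
      using mono[of m "max m n"] mono[of n "max m n"]
      by (intro bexI[of _ "inverse (real (Suc (max m n))) *\<^sub>R x"]) (auto simp del: of_nat_Suc)
  qed simp
  show "is_infimum (range (\<lambda>n. inverse (real (Suc n)) *\<^sub>R x)) 0"
    unfolding is_infimum_def
  proof (intro conjI allI impI)
    fix u assume "\<forall>z\<in>range (\<lambda>n. inverse (real (Suc n)) *\<^sub>R x). u \<le> z"
    then show "u \<le> 0"
      by (intro archimedean_inverse_le_0[of u x]) auto
  qed (use assms in \<open>auto intro!: scaleR_nonneg_nonneg\<close>)
qed


section \<open>Lebesgue bases and the topologies they generate\<close>

text \<open>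
  The last assumption is the Lebesgue property with decreasing nets replaced by their ranges, so
  that no index type occurs in it. It also makes every basic set absorbing, because \<open>x/n \<down> 0\<close>.
\<close>

locale lebesgue_base =
  fixes \<U> :: "'a::dedekind_complete_vector_lattice set set"
  assumes nonempty: "\<U> \<noteq> {}"
    and solid: "U \<in> \<U> \<Longrightarrow> solid U"
    and refine: "U \<in> \<U> \<Longrightarrow> V \<in> \<U> \<Longrightarrow> \<exists>W\<in>\<U>. W \<subseteq> U \<inter> V"
    and halve: "U \<in> \<U> \<Longrightarrow> \<exists>V\<in>\<U>. \<forall>x\<in>V. \<forall>y\<in>V. x + y \<in> U"
    and separated: "(\<And>U. U \<in> \<U> \<Longrightarrow> x \<in> U) \<Longrightarrow> x = 0"
    and lebesgue: "U \<in> \<U> \<Longrightarrow> down_directed D \<Longrightarrow> is_infimum D 0 \<Longrightarrow> \<exists>d\<in>D. d \<in> U"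
begin

lemma solidD: "U \<in> \<U> \<Longrightarrow> y \<in> U \<Longrightarrow> \<bar>x\<bar> \<le> \<bar>y\<bar> \<Longrightarrow> x \<in> U"
  using solid unfolding solid_def by blast

lemma zero_mem: "U \<in> \<U> \<Longrightarrow> 0 \<in> U"
  using lebesgue[of U "{0}"] by (auto simp: down_directed_def is_infimum_def)

lemma uminus_mem: "U \<in> \<U> \<Longrightarrow> - x \<in> U \<longleftrightarrow> x \<in> U"
  using solidD[of U x "- x"] solidD[of U "- x" x] by auto

lemma abs_mem: "U \<in> \<U> \<Longrightarrow> \<bar>x\<bar> \<in> U \<longleftrightarrow> x \<in> U"
  using solidD[of U x "\<bar>x\<bar>"] solidD[of U "\<bar>x\<bar>" x] by auto

lemma scale:
  assumes "U \<in> \<U>"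
  obtains V where "V \<in> \<U>" "\<And>x s. x \<in> V \<Longrightarrow> \<bar>s\<bar> \<le> r \<Longrightarrow> s *\<^sub>R x \<in> U"
proof -
  have pow: "\<exists>V\<in>\<U>. \<forall>x\<in>V. (2 ^ n) *\<^sub>R x \<in> U" for n
  proof (induction n)
    case (Suc n)
    then obtain V where V: "V \<in> \<U>" "\<forall>x\<in>V. (2 ^ n) *\<^sub>R x \<in> U"
      by blast
    then obtain W where W: "W \<in> \<U>" "\<forall>x\<in>W. \<forall>y\<in>W. x + y \<in> V"
      using halve by blast
    have "(2 ^ Suc n) *\<^sub>R x \<in> U" if "x \<in> W" for x
    proof -
      have "(2 ^ n) *\<^sub>R (x + x) \<in> U"
        using V W that by blast
      then show ?thesis
        by (simp add: scaleR_2[symmetric] mult.commute)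
    qed
    then show ?case
      using W by blast
  qed (use assms in auto)
  obtain n where n: "r < 2 ^ n"
    using real_arch_pow[of 2 r] by auto
  obtain V where V: "V \<in> \<U>" "\<forall>x\<in>V. (2 ^ n) *\<^sub>R x \<in> U"
    using pow[of n] by blast
  show thesis
  proof (rule that[OF V(1)])
    fix x s assume "x \<in> V" "\<bar>s\<bar> \<le> r"
    then have "\<bar>s *\<^sub>R x\<bar> \<le> \<bar>(2 ^ n) *\<^sub>R x\<bar>"
      using n by (auto simp: abs_scaleR_lattice intro!: scaleR_right_mono)
    then show "s *\<^sub>R x \<in> U"
      using V \<open>x \<in> V\<close> solidD[OF assms] by blast
  qed
qed

lemma absorb:
  assumes "U \<in> \<U>"
  obtains e where "0 < e" "\<And>r. \<bar>r\<bar> \<le> e \<Longrightarrow> r *\<^sub>R x \<in> U"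
proof -
  obtain n where n: "inverse (real (Suc n)) *\<^sub>R \<bar>x\<bar> \<in> U"
    using lebesgue[OF assms scaled_down, of "\<bar>x\<bar>"] by auto
  show thesis
  proof (rule that)
    show "0 < inverse (real (Suc n))"
      by simp
    show "r *\<^sub>R x \<in> U" if "\<bar>r\<bar> \<le> inverse (real (Suc n))" for r
    proof (rule solidD[OF assms n])
      show "\<bar>r *\<^sub>R x\<bar> \<le> \<bar>inverse (real (Suc n)) *\<^sub>R \<bar>x\<bar>\<bar>"
        using that by (simp add: abs_scaleR_lattice scaleR_right_mono del: of_nat_Suc)
    qed
  qed
qed

lemma order_convergent_mem:
  assumes "order_convergent A le x 0" "U \<in> \<U>"
  shows "\<exists>a0\<in>A. \<forall>a\<in>A. le a0 a \<longrightarrow> x a \<in> U"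
proof -
  obtain B :: "'a set" and leB y where B: "directed_set B leB" "decreases_to_0 B leB y"
    and dom: "\<forall>b0\<in>B. \<exists>a0\<in>A. \<forall>a\<in>A. le a0 a \<longrightarrow> \<bar>0 - x a\<bar> \<le> y b0"
    using assms(1) unfolding order_convergent_def by blast
  have "down_directed (y ` B)"
    unfolding down_directed_def
  proof (intro conjI ballI)
    show "y ` B \<noteq> {}"
      using B(1) by (simp add: directed_set_def)
    fix p q assume "p \<in> y ` B" "q \<in> y ` B"
    then obtain b c where bc: "b \<in> B" "c \<in> B" "p = y b" "q = y c"
      by blast
    then obtain d where "d \<in> B" "leB b d" "leB c d"
      using B(1) unfolding directed_set_def by meson
    with bc show "\<exists>r\<in>y ` B. r \<le> p \<and> r \<le> q"
      using B(2) unfolding decreases_to_0_def by blast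
  qed
  moreover have "is_infimum (y ` B) 0"
    using B(2) by (simp add: decreases_to_0_def)
  ultimately obtain b where b: "b \<in> B" "y b \<in> U"
    using lebesgue[OF assms(2)] by blast
  then obtain a0 where a0: "a0 \<in> A" "\<forall>a\<in>A. le a0 a \<longrightarrow> \<bar>0 - x a\<bar> \<le> y b"
    using dom by blast
  have "x a \<in> U" if "a \<in> A" "le a0 a" for a
  proof -
    have "\<bar>x a\<bar> \<le> y b"
      using a0 that by simp
    then show ?thesis
      by (rule solidD[OF assms(2) b(2) order_trans[OF _ abs_ge_self]])
  qed
  with a0 show ?thesis
    by blast
qed

end

definition base_topology :: "'a::vector_lattice set set \<Rightarrow> 'a topology" where
  "base_topology \<U> = topology (\<lambda>S. \<forall>x\<in>S. \<exists>U\<in>\<U>. \<forall>y. y - x \<in> U \<longrightarrow> y \<in> S)"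

context lebesgue_base
begin

lemma openin_base_topology:
  "openin (base_topology \<U>) S \<longleftrightarrow> (\<forall>x\<in>S. \<exists>U\<in>\<U>. \<forall>y. y - x \<in> U \<longrightarrow> y \<in> S)"
proof -
  have "istopology (\<lambda>S. \<forall>x\<in>S. \<exists>U\<in>\<U>. \<forall>y. y - x \<in> U \<longrightarrow> y \<in> S)"
    unfolding istopology_def
  proof (intro conjI allI impI ballI)
    fix S T x assume S: "\<forall>x\<in>S. \<exists>U\<in>\<U>. \<forall>y. y - x \<in> U \<longrightarrow> y \<in> S"
      and T: "\<forall>x\<in>T. \<exists>U\<in>\<U>. \<forall>y. y - x \<in> U \<longrightarrow> y \<in> T" and x: "x \<in> S \<inter> T"
    obtain U where "U \<in> \<U>" "\<forall>y. y - x \<in> U \<longrightarrow> y \<in> S"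
      using S x by blast
    moreover obtain V where "V \<in> \<U>" "\<forall>y. y - x \<in> V \<longrightarrow> y \<in> T"
      using T x by blast
    ultimately show "\<exists>W\<in>\<U>. \<forall>y. y - x \<in> W \<longrightarrow> y \<in> S \<inter> T"
      using refine[of U V] by blast
  next
    fix \<S> x assume "\<forall>S\<in>\<S>. \<forall>x\<in>S. \<exists>U\<in>\<U>. \<forall>y. y - x \<in> U \<longrightarrow> y \<in> S" and x: "x \<in> \<Union> \<S>"
    then show "\<exists>U\<in>\<U>. \<forall>y. y - x \<in> U \<longrightarrow> y \<in> \<Union> \<S>"
      by (meson Union_iff)
  qed
  then show ?thesis
    unfolding base_topology_def by (simp add: topology_inverse')
qed

lemma topspace_base_topology [simp]: "topspace (base_topology \<U>) = UNIV"
proof -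
  have "openin (base_topology \<U>) UNIV"
    using nonempty by (auto simp: openin_base_topology)
  then show ?thesis
    using openin_subset by fast
qed

text \<open>
  Basic sets need not be open. The interior of a translated basic set consists of the points that
  have a whole translated basic set around them inside it; halving shows that this is open.
\<close>

lemma open_nbhd:
  assumes "U \<in> \<U>"
  obtains W where "openin (base_topology \<U>) W" "x \<in> W" "\<And>y. y \<in> W \<Longrightarrow> y - x \<in> U"
proof -
  define W where "W = {y. \<exists>V\<in>\<U>. \<forall>z. z - y \<in> V \<longrightarrow> z - x \<in> U}"
  have "openin (base_topology \<U>) W"
    unfolding openin_base_topology
  proof
    fix y assume "y \<in> W"
    then obtain V where V: "V \<in> \<U>" "\<forall>z. z - y \<in> V \<longrightarrow> z - x \<in> U"
      unfolding W_def by blast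
    obtain V' where V': "V' \<in> \<U>" "\<forall>a\<in>V'. \<forall>b\<in>V'. a + b \<in> V"
      using halve[OF V(1)] by blast
    have "z \<in> W" if "z - y \<in> V'" for z
    proof -
      have "z' - x \<in> U" if "z' - z \<in> V'" for z'
        using V(2) V'(2)[rule_format, OF \<open>z' - z \<in> V'\<close> \<open>z - y \<in> V'\<close>] by simp
      then show ?thesis
        unfolding W_def using V' by blast
    qed
    then show "\<exists>U\<in>\<U>. \<forall>z. z - y \<in> U \<longrightarrow> z \<in> W"
      using V' by blast
  qed
  moreover have "x \<in> W"
    unfolding W_def using assms by blast
  moreover have "y - x \<in> U" if "y \<in> W" for y
  proof -
    from that obtain V where "V \<in> \<U>" "\<forall>z. z - y \<in> V \<longrightarrow> z - x \<in> U"
      unfolding W_def by blast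
    then show ?thesis
      using zero_mem[of V] by (metis diff_self)
  qed
  ultimately show thesis
    by (rule that)
qed

lemma limitin_base_topology:
  "limitin (base_topology \<U>) f l F \<longleftrightarrow> (\<forall>U\<in>\<U>. \<forall>\<^sub>F a in F. f a - l \<in> U)"
proof
  assume lim: "limitin (base_topology \<U>) f l F"
  show "\<forall>U\<in>\<U>. \<forall>\<^sub>F a in F. f a - l \<in> U"
  proof
    fix U assume "U \<in> \<U>"
    then obtain W where W: "openin (base_topology \<U>) W" "l \<in> W" "\<And>y. y \<in> W \<Longrightarrow> y - l \<in> U"
      using open_nbhd by blast
    then have "\<forall>\<^sub>F a in F. f a \<in> W"
      using lim unfolding limitin_def by blast
    then show "\<forall>\<^sub>F a in F. f a - l \<in> U"
      by (rule eventually_mono) (rule W(3))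
  qed
next
  assume ev: "\<forall>U\<in>\<U>. \<forall>\<^sub>F a in F. f a - l \<in> U"
  show "limitin (base_topology \<U>) f l F"
    unfolding limitin_def
  proof (intro conjI allI impI)
    fix W assume "openin (base_topology \<U>) W \<and> l \<in> W"
    then obtain U where U: "U \<in> \<U>" "\<forall>y. y - l \<in> U \<longrightarrow> y \<in> W"
      unfolding openin_base_topology by blast
    show "\<forall>\<^sub>F a in F. f a \<in> W"
      by (rule eventually_mono[OF ev[rule_format, OF U(1)]]) (use U(2) in blast)
  qed simp
qed

lemma in_closure_base_topology:
  "x \<in> base_topology \<U> closure_of S \<longleftrightarrow> (\<forall>U\<in>\<U>. \<exists>a\<in>S. a - x \<in> U)"
proof
  assume x: "x \<in> base_topology \<U> closure_of S"
  show "\<forall>U\<in>\<U>. \<exists>a\<in>S. a - x \<in> U"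
  proof
    fix U assume "U \<in> \<U>"
    then obtain W where "openin (base_topology \<U>) W" "x \<in> W" "\<And>y. y \<in> W \<Longrightarrow> y - x \<in> U"
      using open_nbhd by blast
    then show "\<exists>a\<in>S. a - x \<in> U"
      using x unfolding in_closure_of by blast
  qed
next
  assume *: "\<forall>U\<in>\<U>. \<exists>a\<in>S. a - x \<in> U"
  show "x \<in> base_topology \<U> closure_of S"
    unfolding in_closure_of
  proof (intro conjI allI impI)
    fix W assume "x \<in> W \<and> openin (base_topology \<U>) W"
    then obtain U where "U \<in> \<U>" "\<forall>y. y - x \<in> U \<longrightarrow> y \<in> W"
      unfolding openin_base_topology by blast
    then show "\<exists>y. y \<in> S \<and> y \<in> W"
      using * by blast
  qed simp
qed

lemma continuous_add_base_topology:
  "continuous_map (prod_topology (base_topology \<U>) (base_topology \<U>)) (base_topology \<U>)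
     (\<lambda>(x, y). x + y)"
  unfolding continuous_map_def
proof (intro conjI allI impI)
  fix S assume S: "openin (base_topology \<U>) S"
  show "openin (prod_topology (base_topology \<U>) (base_topology \<U>))
    {p \<in> topspace (prod_topology (base_topology \<U>) (base_topology \<U>)). (case p of (x, y) \<Rightarrow> x + y) \<in> S}"
    unfolding openin_prod_topology_alt
  proof (intro allI impI)
    fix x y
    assume "(x, y) \<in> {p \<in> topspace (prod_topology (base_topology \<U>) (base_topology \<U>)).
      (case p of (x, y) \<Rightarrow> x + y) \<in> S}"
    then obtain U where U: "U \<in> \<U>" "\<forall>z. z - (x + y) \<in> U \<longrightarrow> z \<in> S"
      using S unfolding openin_base_topology by auto
    obtain V where V: "V \<in> \<U>" "\<forall>a\<in>V. \<forall>b\<in>V. a + b \<in> U"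
      using halve[OF U(1)] by blast
    obtain W1 where W1: "openin (base_topology \<U>) W1" "x \<in> W1" "\<And>z. z \<in> W1 \<Longrightarrow> z - x \<in> V"
      using open_nbhd[OF V(1)] by blast
    obtain W2 where W2: "openin (base_topology \<U>) W2" "y \<in> W2" "\<And>z. z \<in> W2 \<Longrightarrow> z - y \<in> V"
      using open_nbhd[OF V(1)] by blast
    have "a + b \<in> S" if "a \<in> W1" "b \<in> W2" for a b
    proof -
      have "(a - x) + (b - y) \<in> U"
        using V W1 W2 that by blast
      then show ?thesis
        using U by (simp add: algebra_simps)
    qed
    then have "W1 \<times> W2 \<subseteq> {p \<in> topspace (prod_topology (base_topology \<U>) (base_topology \<U>)).
        (case p of (x, y) \<Rightarrow> x + y) \<in> S}"
      by auto
    then show "\<exists>W1 W2. openin (base_topology \<U>) W1 \<and> openin (base_topology \<U>) W2 \<and>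
        x \<in> W1 \<and> y \<in> W2 \<and>
        W1 \<times> W2 \<subseteq> {p \<in> topspace (prod_topology (base_topology \<U>) (base_topology \<U>)).
          (case p of (x, y) \<Rightarrow> x + y) \<in> S}"
      using W1 W2 by blast
  qed
qed simp

lemma continuous_scaleR_base_topology:
  "continuous_map (prod_topology euclideanreal (base_topology \<U>)) (base_topology \<U>)
     (\<lambda>(r, x). r *\<^sub>R x)"
  unfolding continuous_map_def
proof (intro conjI allI impI)
  fix S assume S: "openin (base_topology \<U>) S"
  show "openin (prod_topology euclideanreal (base_topology \<U>))
    {p \<in> topspace (prod_topology euclideanreal (base_topology \<U>)). (case p of (r, x) \<Rightarrow> r *\<^sub>R x) \<in> S}"
    unfolding openin_prod_topology_alt
  proof (intro allI impI)
    fix r x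
    assume "(r, x) \<in> {p \<in> topspace (prod_topology euclideanreal (base_topology \<U>)).
      (case p of (r, x) \<Rightarrow> r *\<^sub>R x) \<in> S}"
    then obtain U where U: "U \<in> \<U>" "\<forall>z. z - r *\<^sub>R x \<in> U \<longrightarrow> z \<in> S"
      using S unfolding openin_base_topology by auto
    obtain V where V: "V \<in> \<U>" "\<forall>a\<in>V. \<forall>b\<in>V. a + b \<in> U"
      using halve[OF U(1)] by blast
    obtain V' where V': "V' \<in> \<U>" "\<And>z s. z \<in> V' \<Longrightarrow> \<bar>s\<bar> \<le> \<bar>r\<bar> + 1 \<Longrightarrow> s *\<^sub>R z \<in> V"
      using scale[OF V(1)] by blast
    obtain e where e: "0 < e" "\<And>s. \<bar>s\<bar> \<le> e \<Longrightarrow> s *\<^sub>R x \<in> V"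
      using absorb[OF V(1)] by blast
    obtain W where W: "openin (base_topology \<U>) W" "x \<in> W" "\<And>z. z \<in> W \<Longrightarrow> z - x \<in> V'"
      using open_nbhd[OF V'(1)] by blast
    let ?B = "ball r (min e 1)"
    have "s *\<^sub>R z \<in> S" if s: "s \<in> ?B" and z: "z \<in> W" for s z
    proof -
      have "\<bar>s - r\<bar> \<le> e" "\<bar>s\<bar> \<le> \<bar>r\<bar> + 1"
        using s by (auto simp: dist_real_def)
      then have "s *\<^sub>R (z - x) + (s - r) *\<^sub>R x \<in> U"
        using V(2) V'(2)[OF W(3)[OF z]] e(2) by blast
      then show ?thesis
        using U by (simp add: algebra_simps)
    qed
    then have "?B \<times> W \<subseteq> {p \<in> topspace (prod_topology euclideanreal (base_topology \<U>)).
        (case p of (r, x) \<Rightarrow> r *\<^sub>R x) \<in> S}"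
      by auto
    moreover have "openin euclideanreal ?B" "r \<in> ?B"
      using e by auto
    ultimately show "\<exists>B W. openin euclideanreal B \<and> openin (base_topology \<U>) W \<and>
        r \<in> B \<and> x \<in> W \<and>
        B \<times> W \<subseteq> {p \<in> topspace (prod_topology euclideanreal (base_topology \<U>)).
          (case p of (r, x) \<Rightarrow> r *\<^sub>R x) \<in> S}"
      using W by blast
  qed
qed simp

lemma linear_topology_base_topology: "linear_topology (base_topology \<U>)"
  unfolding linear_topology_def
  using continuous_add_base_topology continuous_scaleR_base_topology by simp

lemma Hausdorff_base_topology: "Hausdorff_space (base_topology \<U>)"
  unfolding Hausdorff_space_def
proof (intro allI impI)
  fix x y assume "x \<in> topspace (base_topology \<U>) \<and> y \<in> topspace (base_topology \<U>) \<and> x \<noteq> y"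
  then obtain U where U: "U \<in> \<U>" "x - y \<notin> U"
    using separated[of "x - y"] by auto
  obtain V where V: "V \<in> \<U>" "\<forall>a\<in>V. \<forall>b\<in>V. a + b \<in> U"
    using halve[OF U(1)] by blast
  obtain W1 where W1: "openin (base_topology \<U>) W1" "x \<in> W1" "\<And>z. z \<in> W1 \<Longrightarrow> z - x \<in> V"
    using open_nbhd[OF V(1)] by blast
  obtain W2 where W2: "openin (base_topology \<U>) W2" "y \<in> W2" "\<And>z. z \<in> W2 \<Longrightarrow> z - y \<in> V"
    using open_nbhd[OF V(1)] by blast
  have "False" if "z \<in> W1" "z \<in> W2" for z
  proof -
    have "- (z - x) \<in> V" "z - y \<in> V"
      using uminus_mem[OF V(1), of "z - x"] W1 W2 that by auto
    then have "- (z - x) + (z - y) \<in> U"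
      using V by blast
    then show False
      using U by simp
  qed
  then show "\<exists>W1 W2. openin (base_topology \<U>) W1 \<and> openin (base_topology \<U>) W2 \<and>
      x \<in> W1 \<and> y \<in> W2 \<and> disjnt W1 W2"
    using W1 W2 unfolding disjnt_def by blast
qed

lemma locally_solid_base_topology: "locally_solid (base_topology \<U>)"
  unfolding locally_solid_def
proof (intro allI impI)
  fix S assume "openin (base_topology \<U>) S \<and> 0 \<in> S"
  then obtain U where U: "U \<in> \<U>" "\<forall>y. y - 0 \<in> U \<longrightarrow> y \<in> S"
    unfolding openin_base_topology by blast
  obtain W where "openin (base_topology \<U>) W" "0 \<in> W" "\<And>y. y \<in> W \<Longrightarrow> y - 0 \<in> U"
    using open_nbhd[OF U(1)] by blast
  then show "\<exists>V W. solid V \<and> V \<subseteq> S \<and> openin (base_topology \<U>) W \<and> 0 \<in> W \<and> W \<subseteq> V"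
    using U solid by (intro exI[of _ U] exI[of _ W]) auto
qed

end


subsection \<open>Unbounding a base\<close>

definition unbounded :: "'a::vector_lattice set set \<Rightarrow> 'a set set" where
  "unbounded \<U> = {{x. inf \<bar>x\<bar> y \<in> U} |U y. U \<in> \<U> \<and> 0 \<le> y}"

lemma unboundedI: "U \<in> \<U> \<Longrightarrow> 0 \<le> y \<Longrightarrow> {x. inf \<bar>x\<bar> y \<in> U} \<in> unbounded \<U>"
  unfolding unbounded_def by blast

lemma unboundedE:
  assumes "W \<in> unbounded \<U>"
  obtains U y where "U \<in> \<U>" "0 \<le> y" "W = {x. inf \<bar>x\<bar> y \<in> U}"
  using assms unfolding unbounded_def by blast

context lebesgue_base
begin

lemma nonneg_mem_mono: "U \<in> \<U> \<Longrightarrow> y \<in> U \<Longrightarrow> 0 \<le> x \<Longrightarrow> x \<le> y \<Longrightarrow> x \<in> U"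
  using solidD[of U y x] order_trans[of 0 x y] by simp

text \<open>
  Truncation by \<open>y\<close> is subadditive on positive elements, so it preserves halving; separation
  survives because an element can be truncated at its own absolute value.
\<close>

lemma lebesgue_base_unbounded: "lebesgue_base (unbounded \<U>)"
proof
  show "unbounded \<U> \<noteq> {}"
    using nonempty unboundedI[of _ \<U> 0] by blast
next
  fix W assume "W \<in> unbounded \<U>"
  then obtain U y where W: "U \<in> \<U>" "0 \<le> y" "W = {x. inf \<bar>x\<bar> y \<in> U}"
    by (rule unboundedE)
  show "solid W"
    unfolding solid_def
  proof (intro allI impI)
    fix u v assume "v \<in> W \<and> \<bar>u\<bar> \<le> \<bar>v\<bar>"
    then show "u \<in> W"
      using W nonneg_mem_mono[of U "inf \<bar>v\<bar> y" "inf \<bar>u\<bar> y"] by (simp add: le_infI1)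
  qed
  obtain V where V: "V \<in> \<U>" "\<forall>x\<in>V. \<forall>y\<in>V. x + y \<in> U"
    using halve[OF W(1)] by blast
  have "u + v \<in> W" if "inf \<bar>u\<bar> y \<in> V" "inf \<bar>v\<bar> y \<in> V" for u v
  proof -
    have "inf \<bar>u\<bar> y + inf \<bar>v\<bar> y \<in> U"
      using that V by blast
    then show ?thesis
      using nonneg_mem_mono[OF W(1) _ _ inf_abs_add_le[OF W(2)]] W(2,3) by simp
  qed
  then show "\<exists>V\<in>unbounded \<U>. \<forall>x\<in>V. \<forall>y\<in>V. x + y \<in> W"
    by (intro bexI[OF _ unboundedI[OF V(1) W(2)]]) auto
  fix D assume D: "down_directed D" "is_infimum D (0::'a)"
  have "down_directed ((\<lambda>d. inf d y) ` D)"
    by (rule down_directed_image[OF D(1)]) (simp add: le_infI1)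
  then obtain d where d: "d \<in> D" "inf d y \<in> U"
    using lebesgue[OF W(1) _ is_infimum_inf_const[OF D(2) W(2)]] by blast
  moreover have "0 \<le> d"
    using d D(2) by (simp add: is_infimum_def)
  ultimately show "\<exists>d\<in>D. d \<in> W"
    using W(3) by auto
next
  fix W1 W2 assume "W1 \<in> unbounded \<U>"
  then obtain U1 y1 where W1: "U1 \<in> \<U>" "0 \<le> y1" "W1 = {x. inf \<bar>x\<bar> y1 \<in> U1}"
    by (rule unboundedE)
  assume "W2 \<in> unbounded \<U>"
  then obtain U2 y2 where W2: "U2 \<in> \<U>" "0 \<le> y2" "W2 = {x. inf \<bar>x\<bar> y2 \<in> U2}"
    by (rule unboundedE)
  obtain U where U: "U \<in> \<U>" "U \<subseteq> U1 \<inter> U2"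
    using refine[OF W1(1) W2(1)] by blast
  have "x \<in> W1 \<inter> W2" if "inf \<bar>x\<bar> (y1 + y2) \<in> U" for x
  proof -
    have "inf \<bar>x\<bar> y1 \<le> inf \<bar>x\<bar> (y1 + y2)" "inf \<bar>x\<bar> y2 \<le> inf \<bar>x\<bar> (y1 + y2)"
      using W1(2) W2(2) by (simp_all add: le_infI2)
    then have "inf \<bar>x\<bar> y1 \<in> U" "inf \<bar>x\<bar> y2 \<in> U"
      using W1(2) W2(2) nonneg_mem_mono[OF U(1) that] by simp_all
    then show ?thesis
      using U W1 W2 by blast
  qed
  then show "\<exists>W\<in>unbounded \<U>. W \<subseteq> W1 \<inter> W2"
    using W1(2) W2(2) by (intro bexI[OF _ unboundedI[OF U(1), of "y1 + y2"]]) auto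
next
  fix x assume *: "\<And>W. W \<in> unbounded \<U> \<Longrightarrow> x \<in> W"
  have "inf \<bar>x\<bar> \<bar>x\<bar> \<in> U" if "U \<in> \<U>" for U
    using *[OF unboundedI[OF that, of "\<bar>x\<bar>"]] by simp
  then have "\<bar>x\<bar> = 0"
    by (intro separated) simp
  then show "x = 0"
    by simp
qed

lemma uo_convergent_mem_unbounded:
  assumes "uo_convergent A le x 0" "W \<in> unbounded \<U>"
  shows "\<exists>a0\<in>A. \<forall>a\<in>A. le a0 a \<longrightarrow> x a \<in> W"
proof -
  obtain U y where W: "U \<in> \<U>" "0 \<le> y" "W = {x. inf \<bar>x\<bar> y \<in> U}"
    using assms(2) by (rule unboundedE)
  then have "order_convergent A le (\<lambda>a. inf \<bar>x a - 0\<bar> y) 0"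
    using assms(1) unfolding uo_convergent_def by blast
  then show ?thesis
    using order_convergent_mem[OF _ W(1)] W(3) by simp
qed

theorem hausdorff_uo_lebesgue_base_topology_unbounded:
  "hausdorff_uo_lebesgue (base_topology (unbounded \<U>))"
proof -
  interpret un: lebesgue_base "unbounded \<U>"
    by (rule lebesgue_base_unbounded)
  have "limitin (base_topology (unbounded \<U>)) x 0 (net_filter A le)"
    if "directed_set A le" "uo_convergent A le x 0"
    for A :: "('a \<times> 'a set) set" and le and x :: "'a \<times> 'a set \<Rightarrow> 'a"
    unfolding un.limitin_base_topology eventually_net_filter[OF that(1)]
    using uo_convergent_mem_unbounded[OF that(2)] by simp
  then show ?thesis
    unfolding hausdorff_uo_lebesgue_def uo_lebesgue_def
    using un.linear_topology_base_topology un.locally_solid_base_topology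
      un.Hausdorff_base_topology by blast
qed

end


subsection \<open>The solid neighbourhoods of a uo-Lebesgue topology\<close>

definition solid_nhds :: "'a::vector_lattice topology \<Rightarrow> 'a set set" where
  "solid_nhds \<tau> = {V. solid V \<and> (\<exists>W. openin \<tau> W \<and> 0 \<in> W \<and> W \<subseteq> V)}"

text \<open>
  A downward directed set, indexed by itself, is a decreasing net that dominates itself.
\<close>

lemma decreasing_uo_convergent:
  fixes D :: "'a::vector_lattice set"
  assumes "down_directed D" "is_infimum D 0"
  shows "directed_set D (\<lambda>p q. q \<le> p)" "uo_convergent D (\<lambda>p q. q \<le> p) (\<lambda>p. p) 0"
proof -
  show dir: "directed_set D (\<lambda>p q. q \<le> p)"
    using assms(1) unfolding down_directed_def directed_set_def by (auto intro: order_trans)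
  have dec: "decreases_to_0 D (\<lambda>p q. q \<le> p) (\<lambda>p. p)"
    using assms(2) unfolding decreases_to_0_def by simp
  show "uo_convergent D (\<lambda>p q. q \<le> p) (\<lambda>p. p) 0"
    unfolding uo_convergent_def
  proof (intro allI impI order_convergentI[OF dir dec])
    fix y b :: 'a assume y: "0 \<le> y" and b: "b \<in> D"
    have "\<bar>0 - inf \<bar>a - 0\<bar> y\<bar> \<le> b" if "a \<in> D" "a \<le> b" for a
    proof -
      have "0 \<le> a"
        using assms(2) that by (simp add: is_infimum_def)
      then show ?thesis
        using y that by (simp add: le_infI1)
    qed
    then show "\<exists>a0\<in>D. \<forall>a\<in>D. a \<le> a0 \<longrightarrow> \<bar>0 - inf \<bar>a - 0\<bar> y\<bar> \<le> b"
      using b by blast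
  qed
qed

context
  fixes \<tau> :: "'a::vector_lattice topology"
  assumes lin: "linear_topology \<tau>"
begin

lemma topspace_linear [simp]: "topspace \<tau> = UNIV"
  using lin by (simp add: linear_topology_def)

text \<open>
  Continuity of the addition enters through two consequences, which suffice to recover a linear
  topology from its neighbourhoods of zero: translates of open sets are open, and neighbourhoods of
  zero can be halved.
\<close>

lemma openin_translate:
  assumes "openin \<tau> W"
  shows "openin \<tau> {y. c + y \<in> W}"
proof -
  have "continuous_map \<tau> (prod_topology \<tau> \<tau>) (\<lambda>y. (c, y))"
    by (intro continuous_map_pairedI) auto
  then have "continuous_map \<tau> \<tau> ((\<lambda>(x, y). x + y) \<circ> (\<lambda>y. (c, y)))"
    using lin unfolding linear_topology_def by (intro continuous_map_compose) auto
  then have "openin \<tau> {y \<in> topspace \<tau>. ((\<lambda>(x, y). x + y) \<circ> (\<lambda>y. (c, y))) y \<in> W}"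
    using assms by (rule openin_continuous_map_preimage)
  then show ?thesis
    by simp
qed

lemma halve_linear:
  assumes "openin \<tau> W" "0 \<in> W"
  obtains V where "openin \<tau> V" "0 \<in> V" "\<And>x y. x \<in> V \<Longrightarrow> y \<in> V \<Longrightarrow> x + y \<in> W"
proof -
  have "openin (prod_topology \<tau> \<tau>) {p \<in> topspace (prod_topology \<tau> \<tau>). (\<lambda>(x, y). x + y) p \<in> W}"
    using lin assms(1) unfolding linear_topology_def by (blast intro: openin_continuous_map_preimage)
  moreover have "(0, 0) \<in> {p \<in> topspace (prod_topology \<tau> \<tau>). (\<lambda>(x, y). x + y) p \<in> W}"
    using assms(2) by simp
  ultimately obtain V1 V2 where V: "openin \<tau> V1" "openin \<tau> V2" "0 \<in> V1" "0 \<in> V2"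
      "V1 \<times> V2 \<subseteq> {p \<in> topspace (prod_topology \<tau> \<tau>). (\<lambda>(x, y). x + y) p \<in> W}"
    unfolding openin_prod_topology_alt by meson
  show thesis
  proof (rule that[of "V1 \<inter> V2"])
    show "x + y \<in> W" if "x \<in> V1 \<inter> V2" "y \<in> V1 \<inter> V2" for x y
    proof -
      have "(x, y) \<in> V1 \<times> V2"
        using that by blast
      then show ?thesis
        using V(5) by fastforce
    qed
  qed (use V in auto)
qed

end

context
  fixes \<tau> :: "'a::dedekind_complete_vector_lattice topology"
  assumes \<tau>: "hausdorff_uo_lebesgue \<tau>"
begin

lemma lin_top: "linear_topology \<tau>" and loc_solid: "locally_solid \<tau>" and uo_leb: "uo_lebesgue \<tau>"
  and haus: "Hausdorff_space \<tau>"
  using \<tau> unfolding hausdorff_uo_lebesgue_def uo_lebesgue_def by blast+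

lemma solid_nhd_subset:
  assumes "openin \<tau> W" "0 \<in> W"
  obtains V where "V \<in> solid_nhds \<tau>" "V \<subseteq> W"
  using loc_solid assms unfolding locally_solid_def solid_nhds_def by blast

lemma uo_convergent_mem_solid_nhds:
  assumes "directed_set A le" "uo_convergent A le x 0" "V \<in> solid_nhds \<tau>"
  shows "\<exists>a0\<in>A. \<forall>a\<in>A. le a0 a \<longrightarrow> x a \<in> V"
proof -
  obtain W where W: "openin \<tau> W" "0 \<in> W" "W \<subseteq> V"
    using assms(3) unfolding solid_nhds_def by blast
  have "\<forall>\<^sub>F a in net_filter A le. x a \<in> W"
    using uo_lebesgue_any_index[OF uo_leb assms(1,2)] W unfolding limitin_def by blast
  then show ?thesis
    unfolding eventually_net_filter[OF assms(1)] using W(3) by blast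
qed

lemma lebesgue_base_solid_nhds: "lebesgue_base (solid_nhds \<tau>)"
proof
  have "openin \<tau> UNIV"
    using openin_topspace[of \<tau>] topspace_linear[OF lin_top] by simp
  then have "UNIV \<in> solid_nhds \<tau>"
    unfolding solid_nhds_def by (auto simp: solid_def)
  then show "solid_nhds \<tau> \<noteq> {}"
    by blast
next
  fix U assume U: "U \<in> solid_nhds \<tau>"
  then show "solid U"
    unfolding solid_nhds_def by blast
  obtain W where W: "openin \<tau> W" "0 \<in> W" "W \<subseteq> U"
    using U unfolding solid_nhds_def by blast
  obtain V where V: "openin \<tau> V" "0 \<in> V" "\<And>x y. x \<in> V \<Longrightarrow> y \<in> V \<Longrightarrow> x + y \<in> W"
    using halve_linear[OF lin_top W(1,2)] by blast
  obtain V' where V': "V' \<in> solid_nhds \<tau>" "V' \<subseteq> V"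
    using solid_nhd_subset[OF V(1,2)] by blast
  show "\<exists>V\<in>solid_nhds \<tau>. \<forall>x\<in>V. \<forall>y\<in>V. x + y \<in> U"
  proof (intro bexI[OF _ V'(1)] ballI)
    fix x y assume "x \<in> V'" "y \<in> V'"
    then have "x + y \<in> W"
      using V(3) V'(2) by (meson subsetD)
    then show "x + y \<in> U"
      using W(3) by blast
  qed
  fix D assume "down_directed D" "is_infimum D (0::'a)"
  from uo_convergent_mem_solid_nhds[OF decreasing_uo_convergent[OF this] U]
  show "\<exists>d\<in>D. d \<in> U"
    by blast
next
  fix U V assume "U \<in> solid_nhds \<tau>" "V \<in> solid_nhds \<tau>"
  then obtain W1 W2 where W: "openin \<tau> W1" "0 \<in> W1" "W1 \<subseteq> U" "openin \<tau> W2" "0 \<in> W2" "W2 \<subseteq> V"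
    and solid: "solid U" "solid V"
    unfolding solid_nhds_def by blast
  have "solid (U \<inter> V)"
    using solid unfolding solid_def by blast
  moreover have "openin \<tau> (W1 \<inter> W2)" "0 \<in> W1 \<inter> W2" "W1 \<inter> W2 \<subseteq> U \<inter> V"
    using W by auto
  ultimately have "U \<inter> V \<in> solid_nhds \<tau>"
    unfolding solid_nhds_def by blast
  then show "\<exists>W\<in>solid_nhds \<tau>. W \<subseteq> U \<inter> V"
    by blast
next
  fix x assume *: "\<And>U. U \<in> solid_nhds \<tau> \<Longrightarrow> x \<in> U"
  show "x = 0"
  proof (rule ccontr)
    assume "x \<noteq> 0"
    then obtain W W' where "openin \<tau> W" "openin \<tau> W'" "0 \<in> W" "x \<in> W'" "disjnt W W'"
      using haus topspace_linear[OF lin_top] unfolding Hausdorff_space_def by (metis UNIV_I)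
    then have "openin \<tau> W" "0 \<in> W" "x \<notin> W"
      unfolding disjnt_def by auto
    then show False
      using * solid_nhd_subset by blast
  qed
qed

lemma base_topology_solid_nhds: "base_topology (solid_nhds \<tau>) = \<tau>"
proof (rule topology_eq[THEN iffD2], intro allI iffI)
  interpret lebesgue_base "solid_nhds \<tau>"
    by (rule lebesgue_base_solid_nhds)
  fix S
  show "openin \<tau> S" if S: "openin (base_topology (solid_nhds \<tau>)) S"
  proof (subst openin_subopen, intro ballI)
    fix x assume "x \<in> S"
    then obtain U where U: "U \<in> solid_nhds \<tau>" "\<forall>y. y - x \<in> U \<longrightarrow> y \<in> S"
      using S unfolding openin_base_topology by blast
    then obtain W where W: "openin \<tau> W" "0 \<in> W" "W \<subseteq> U"
      unfolding solid_nhds_def by blast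
    have "openin \<tau> {y. - x + y \<in> W}"
      by (rule openin_translate[OF lin_top W(1)])
    then show "\<exists>T. openin \<tau> T \<and> x \<in> T \<and> T \<subseteq> S"
      using W U by (intro exI[of _ "{y. - x + y \<in> W}"]) auto
  qed
  show "openin (base_topology (solid_nhds \<tau>)) S" if S: "openin \<tau> S"
    unfolding openin_base_topology
  proof
    fix x assume "x \<in> S"
    then obtain V where V: "V \<in> solid_nhds \<tau>" "V \<subseteq> {y. x + y \<in> S}"
      using solid_nhd_subset[OF openin_translate[OF lin_top S, of x]] by auto
    have "y \<in> S" if "y - x \<in> V" for y
    proof -
      have "x + (y - x) \<in> S"
        using V(2) that by blast
      then show ?thesis
        by simp
    qed
    then show "\<exists>U\<in>solid_nhds \<tau>. \<forall>y. y - x \<in> U \<longrightarrow> y \<in> S"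
      using V(1) by blast
  qed
qed

end


section \<open>Uniqueness of the Hausdorff uo-Lebesgue topology\<close>


section \<open>Uniqueness of the Hausdorff uo-Lebesgue topology\<close>

definition up_directed :: "'a::order set \<Rightarrow> bool" where
  "up_directed S \<longleftrightarrow> S \<noteq> {} \<and> (\<forall>a\<in>S. \<forall>b\<in>S. \<exists>c\<in>S. a \<le> c \<and> b \<le> c)"

lemma up_directed_range_mono:
  fixes f :: "nat \<Rightarrow> 'a::order"
  assumes "mono f"
  shows "up_directed (range f)"
  unfolding up_directed_def
proof (intro conjI ballI)
  fix a b assume "a \<in> range f" "b \<in> range f"
  then obtain m n where "a = f m" "b = f n"
    by blast
  then show "\<exists>c\<in>range f. a \<le> c \<and> b \<le> c"
    using monoD[OF assms, of m "max m n"] monoD[OF assms, of n "max m n"] by auto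
qed simp

lemma nat_directed: "directed_set UNIV ((\<le>) :: nat \<Rightarrow> nat \<Rightarrow> bool)"
  unfolding directed_set_def by (auto intro: max.cobounded1 max.cobounded2)

lemma supremum_minus_down:
  fixes S :: "'a::vector_lattice set"
  assumes "up_directed S" "is_supremum S s"
  shows "down_directed ((\<lambda>t. s - t) ` S)" "is_infimum ((\<lambda>t. s - t) ` S) 0"
proof -
  show "down_directed ((\<lambda>t. s - t) ` S)"
    unfolding down_directed_def
  proof (intro conjI ballI)
    show "(\<lambda>t. s - t) ` S \<noteq> {}"
      using assms(1) by (simp add: up_directed_def)
    fix a b assume "a \<in> (\<lambda>t. s - t) ` S" "b \<in> (\<lambda>t. s - t) ` S"
    then obtain t u where tu: "t \<in> S" "u \<in> S" "a = s - t" "b = s - u"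
      by blast
    then obtain v where v: "v \<in> S" "t \<le> v" "u \<le> v"
      using assms(1) unfolding up_directed_def by meson
    show "\<exists>c\<in>(\<lambda>t. s - t) ` S. c \<le> a \<and> c \<le> b"
      using v tu by (intro bexI[of _ "s - v"]) (auto intro: diff_left_mono)
  qed
  show "is_infimum ((\<lambda>t. s - t) ` S) 0"
    unfolding is_infimum_def
  proof (intro conjI ballI allI impI)
    show "0 \<le> x" if "x \<in> (\<lambda>t. s - t) ` S" for x
      using that assms(2) by (auto simp: is_supremum_def)
    fix u assume u: "\<forall>x\<in>(\<lambda>t. s - t) ` S. u \<le> x"
    have "t \<le> s - u" if "t \<in> S" for t
    proof -
      have "u \<le> s - t"
        using u that by blast
      then show ?thesis
        by (simp add: le_diff_eq add.commute)
    qed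
    then have "s \<le> s - u"
      using assms(2) unfolding is_supremum_def by blast
    then show "u \<le> 0"
      by (simp add: le_diff_eq)
  qed
qed

text \<open>
  For a sequence of halving solid neighbourhoods of zero, \<open>core\<close> is the ideal of all elements that
  the sequence fails to separate from zero, and \<open>core_part N x\<close> is the component of a positive
  \<open>x\<close> in this ideal.
\<close>

definition core :: "(nat \<Rightarrow> 'a set) \<Rightarrow> 'a set" where
  "core N = (\<Inter>n. N n)"

definition core_part :: "(nat \<Rightarrow> 'a::dedekind_complete_vector_lattice set) \<Rightarrow> 'a \<Rightarrow> 'a" where
  "core_part N x = Sup (core N \<inter> {0..x})"

context lebesgue_base
begin

definition normal :: "(nat \<Rightarrow> 'a set) \<Rightarrow> bool" where
  "normal N \<longleftrightarrow> (\<forall>n. solid (N n) \<and> (\<exists>U\<in>\<U>. U \<subseteq> N n) \<and>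
     (\<forall>x\<in>N (Suc n). \<forall>y\<in>N (Suc n). x + y \<in> N n))"

lemma normal_add: "normal N \<Longrightarrow> x \<in> N (Suc n) \<Longrightarrow> y \<in> N (Suc n) \<Longrightarrow> x + y \<in> N n"
  unfolding normal_def by blast

lemma normal_solid: "normal N \<Longrightarrow> y \<in> N n \<Longrightarrow> \<bar>x\<bar> \<le> \<bar>y\<bar> \<Longrightarrow> x \<in> N n"
  unfolding normal_def solid_def by blast

lemma normal_mono_nonneg: "normal N \<Longrightarrow> y \<in> N n \<Longrightarrow> 0 \<le> x \<Longrightarrow> x \<le> y \<Longrightarrow> x \<in> N n"
  using normal_solid[of N y n x] order_trans[of 0 x y] by simp

lemma normal_base: "normal N \<Longrightarrow> \<exists>U\<in>\<U>. U \<subseteq> N n"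
  unfolding normal_def by blast

lemma normal_zero: "normal N \<Longrightarrow> 0 \<in> N n"
  using normal_base zero_mem by blast

lemma normal_antimono:
  assumes "normal N" "m \<le> n"
  shows "N n \<subseteq> N m"
proof (rule lift_Suc_antimono_le[OF _ assms(2)])
  show "N (Suc n) \<subseteq> N n" for n
  proof
    fix x assume "x \<in> N (Suc n)"
    then show "x \<in> N n"
      using normal_add[OF assms(1) _ normal_zero[OF assms(1)], of x n] by simp
  qed
qed

lemma normal_Int:
  assumes "normal M" "normal N"
  shows "normal (\<lambda>n. M n \<inter> N n)"
  unfolding normal_def
proof (intro allI conjI ballI)
  fix n
  show "solid (M n \<inter> N n)"
    using assms unfolding normal_def solid_def by blast
  obtain U V where "U \<in> \<U>" "U \<subseteq> M n" "V \<in> \<U>" "V \<subseteq> N n"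
    using assms normal_base by meson
  then show "\<exists>W\<in>\<U>. W \<subseteq> M n \<inter> N n"
    using refine[of U V] by blast
  fix x y assume "x \<in> M (Suc n) \<inter> N (Suc n)" "y \<in> M (Suc n) \<inter> N (Suc n)"
  then show "x + y \<in> M n \<inter> N n"
    using assms normal_add by blast
qed

lemma normal_through:
  assumes "U \<in> \<U>"
  obtains N where "normal N" "N 0 = U"
proof -
  have "\<exists>N. \<forall>n. (N n \<in> \<U> \<and> (n = 0 \<longrightarrow> N n = U)) \<and> (\<forall>x\<in>N (Suc n). \<forall>y\<in>N (Suc n). x + y \<in> N n)"
  proof (rule dependent_nat_choice)
    show "\<exists>V. V \<in> \<U> \<and> (0 = (0::nat) \<longrightarrow> V = U)"
      using assms by blast
    show "\<exists>W. (W \<in> \<U> \<and> (Suc n = 0 \<longrightarrow> W = U)) \<and> (\<forall>x\<in>W. \<forall>y\<in>W. x + y \<in> V)"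
      if "V \<in> \<U> \<and> (n = 0 \<longrightarrow> V = U)" for V n
      using halve[of V] that by simp blast
  qed
  then obtain N where N: "\<And>n. N n \<in> \<U>" "N 0 = U"
    "\<And>n. \<forall>x\<in>N (Suc n). \<forall>y\<in>N (Suc n). x + y \<in> N n"
    by metis
  have "normal N"
    unfolding normal_def
  proof (intro allI conjI)
    show "solid (N n)" "\<exists>U\<in>\<U>. U \<subseteq> N n" for n
      using N(1)[of n] solid by blast+
  qed (rule N(3))
  then show thesis
    using N(2) by (rule that)
qed

lemma core_mono_nonneg: "normal N \<Longrightarrow> y \<in> core N \<Longrightarrow> 0 \<le> x \<Longrightarrow> x \<le> y \<Longrightarrow> x \<in> core N"
  unfolding core_def using normal_mono_nonneg by blast

lemma core_add: "normal N \<Longrightarrow> x \<in> core N \<Longrightarrow> y \<in> core N \<Longrightarrow> x + y \<in> core N"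
  unfolding core_def by (simp add: normal_add)

text \<open>
  By the Lebesgue property a directed supremum is approximated from below by members of the set, so
  one halving is the price of passing to the supremum. In particular a core contains the suprema of
  its directed subsets.
\<close>

lemma normal_supremum:
  assumes N: "normal N" and S: "up_directed S" "is_supremum S s" "S \<subseteq> N (Suc n)"
  shows "s \<in> N n"
proof -
  obtain U where "U \<in> \<U>" "U \<subseteq> N (Suc n)"
    using normal_base[OF N] by blast
  then obtain t where t: "t \<in> S" "s - t \<in> N (Suc n)"
    using lebesgue[OF _ supremum_minus_down[OF S(1,2)]] by blast
  then have "(s - t) + t \<in> N n"
    using normal_add[OF N t(2), of t] S(3) by blast
  then show ?thesis
    by simp
qed

context
  fixes N :: "nat \<Rightarrow> 'a set" and x :: 'a
  assumes N: "normal N" and x: "0 \<le> x"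
begin

lemma zero_in_core_part: "0 \<in> core N \<inter> {0..x}"
  using normal_zero[OF N] x by (simp add: core_def)

lemma core_part_supremum: "is_supremum (core N \<inter> {0..x}) (core_part N x)"
  unfolding core_part_def using zero_in_core_part by (intro is_supremum_cSup bdd_aboveI[of _ x]) auto

lemma core_part_nonneg: "0 \<le> core_part N x"
  using core_part_supremum zero_in_core_part unfolding is_supremum_def by blast

lemma core_part_le: "core_part N x \<le> x"
  using core_part_supremum unfolding is_supremum_def by auto

lemma core_part_ge: "y \<in> core N \<Longrightarrow> 0 \<le> y \<Longrightarrow> y \<le> x \<Longrightarrow> y \<le> core_part N x"
  using core_part_supremum unfolding is_supremum_def by auto

lemma core_part_in_core: "core_part N x \<in> core N"
proof -
  have "up_directed (core N \<inter> {0..x})"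
    unfolding up_directed_def
  proof (intro conjI ballI)
    fix a b assume ab: "a \<in> core N \<inter> {0..x}" "b \<in> core N \<inter> {0..x}"
    then have "sup a b \<le> a + b"
      by (simp add: add_increasing add_increasing2)
    then have "sup a b \<in> core N"
      using ab core_mono_nonneg[OF N core_add[OF N, of a b], of "sup a b"]
      by (simp add: le_supI1)
    then show "\<exists>c\<in>core N \<inter> {0..x}. a \<le> c \<and> b \<le> c"
      using ab by (intro bexI[of _ "sup a b"]) (auto simp: le_supI1)
  qed (use zero_in_core_part in blast)
  moreover have "core N \<inter> {0..x} \<subseteq> N (Suc n)" for n
    by (auto simp: core_def)
  ultimately show ?thesis
    using normal_supremum[OF N _ core_part_supremum] by (simp add: core_def)
qed

text \<open>
  The core part is the largest core element between \<open>0\<close> and \<open>x\<close>, and a core element below the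
  remainder could be added to it.
\<close>

lemma core_part_residual:
  assumes "y \<in> core N" "0 \<le> y" "y \<le> x - core_part N x"
  shows "y = 0"
proof -
  have "y + core_part N x \<le> core_part N x"
    using assms core_part_nonneg by (intro core_part_ge core_add[OF N _ core_part_in_core]) (auto simp: le_diff_eq)
  then show ?thesis
    using assms by (simp add: order.antisym)
qed

end

lemma core_part_mono_core:
  assumes "normal M" "normal N" "0 \<le> x" "core M \<subseteq> core N"
  shows "core_part M x \<le> core_part N x"
  using core_part_in_core[OF assms(1,3)] assms(4)
  by (intro core_part_ge[OF assms(2,3)] core_part_nonneg[OF assms(1,3)] core_part_le[OF assms(1,3)]) blast

text \<open>
  As the normal sequence varies, the core parts of \<open>x\<close> form a downward directed set whose infimum
  lies in every member of \<open>\<U>\<close>, so it is zero; another Lebesgue base must therefore meet it.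
\<close>

lemma exists_small_core_part:
  assumes "lebesgue_base \<V>" "V \<in> \<V>" "0 \<le> x"
  shows "\<exists>N. normal N \<and> core_part N x \<in> V"
proof -
  interpret V: lebesgue_base \<V>
    by fact
  let ?D = "{core_part N x |N. normal N}"
  obtain U where "U \<in> \<U>"
    using nonempty by blast
  then have "?D \<noteq> {}"
    using normal_through by blast
  then have "down_directed ?D"
    unfolding down_directed_def
  proof (intro conjI ballI)
    fix a b assume "a \<in> ?D" "b \<in> ?D"
    then obtain M N where MN: "normal M" "normal N" "a = core_part M x" "b = core_part N x"
      by blast
    have "normal (\<lambda>n. M n \<inter> N n)" "core (\<lambda>n. M n \<inter> N n) \<subseteq> core M"
      "core (\<lambda>n. M n \<inter> N n) \<subseteq> core N"
      using MN by (auto simp: core_def normal_Int)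
    then show "\<exists>c\<in>?D. c \<le> a \<and> c \<le> b"
      using MN core_part_mono_core assms(3) by blast
  qed
  moreover have "is_infimum ?D 0"
    unfolding is_infimum_def
  proof (intro conjI ballI allI impI)
    show "0 \<le> d" if "d \<in> ?D" for d
      using that core_part_nonneg assms(3) by blast
    fix u assume u: "\<forall>d\<in>?D. u \<le> d"
    have "pprt u \<in> U" if U: "U \<in> \<U>" for U
    proof -
      obtain N where N: "normal N" "N 0 = U"
        using normal_through[OF U] .
      have "pprt u \<le> core_part N x"
        using u N core_part_nonneg[OF N(1) assms(3)] by (intro pprt_leI) auto
      then have "pprt u \<in> core N"
        by (intro core_mono_nonneg[OF N(1) core_part_in_core[OF N(1) assms(3)]]) auto
      then show ?thesis
        using N(2) by (auto simp: core_def)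
    qed
    then have "pprt u = 0"
      by (rule separated)
    then show "u \<le> 0"
      by (simp add: le_zero_iff_zero_pprt)
  qed
  ultimately show ?thesis
    using V.lebesgue[OF assms(2)] by blast
qed

lemma sum_tail_mem:
  assumes "normal W" "\<And>n. q n \<in> W n"
  shows "(\<Sum>i<k. q (Suc m + i)) \<in> W m"
proof (induction k arbitrary: m)
  case 0
  then show ?case
    using normal_zero[OF assms(1)] by simp
next
  case (Suc k)
  have "(\<Sum>i<Suc k. q (Suc m + i)) = q (Suc m) + (\<Sum>i<k. q (Suc (Suc m) + i))"
    by (simp only: sum.lessThan_Suc_shift) simp
  then show ?case
    using normal_add[OF assms(1) assms(2) Suc] by simp
qed

text \<open>
  Let \<open>z m\<close> be the supremum of the sums \<open>q m + ... + q (m + k - 1)\<close>, truncated at \<open>y\<close>. Then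
  \<open>z (m + 2)\<close> is in \<open>W m\<close>, and the \<open>z m\<close> decrease and dominate \<open>q \<and> y\<close>. A positive lower bound
  of the \<open>z m\<close> belongs to the core, so it is disjoint from all \<open>q n\<close> and from the truncated sums
  with supremum \<open>z 0\<close>; lying below \<open>z 0\<close>, it vanishes.
\<close>

lemma normal_seq_uo_null:
  assumes W: "normal W" and q: "\<And>n. q n \<in> W n" "\<And>n. 0 \<le> q n"
    and residual: "\<And>n u. u \<in> core W \<Longrightarrow> 0 \<le> u \<Longrightarrow> u \<le> q n \<Longrightarrow> u = 0"
  shows "uo_convergent UNIV (\<le>) q 0"
  unfolding uo_convergent_def
proof (intro allI impI)
  fix y :: 'a assume y: "0 \<le> y"
  \<comment> \<open>Finite sums stand in for finite suprema, since normal sequences are made for sums.\<close>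
  define t where "t m k = inf (\<Sum>i<k. q (m + i)) y" for m k :: nat
  define z where "z m = Sup (range (t m))" for m
  have t_y: "t m k \<le> y" for m k
    by (simp add: t_def)
  have z: "is_supremum (range (t m)) (z m)" for m
    unfolding z_def by (intro is_supremum_cSup bdd_aboveI2[OF t_y]) simp
  then have t_z: "t m k \<le> z m" for m k
    unfolding is_supremum_def by blast
  have sum_mono: "(\<Sum>i<k. q (m + i)) \<le> (\<Sum>i<Suc k. q (m + i))" for m k
    using q(2) by simp
  have t_mono: "mono (t m)" for m
    unfolding mono_iff_le_Suc t_def using sum_mono by (intro allI inf_mono) auto
  have t_shift: "t (Suc m) k \<le> t m (Suc k)" for m k
  proof -
    have "(\<Sum>i<k. q (Suc m + i)) \<le> (\<Sum>i<Suc k. q (m + i))"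
      unfolding sum.lessThan_Suc_shift using q(2) by simp
    then show ?thesis
      unfolding t_def by (intro inf_mono) auto
  qed
  have z_antimono: "z n \<le> z m" if "m \<le> n" for m n
  proof (rule lift_Suc_antimono_le[OF _ that])
    show "z (Suc m) \<le> z m" for m
      using z[of "Suc m"] order_trans[OF t_shift t_z] unfolding is_supremum_def by blast
  qed
  have z_W: "z (Suc (Suc m)) \<in> W m" for m
  proof (rule normal_supremum[OF W up_directed_range_mono[OF t_mono] z])
    show "range (t (Suc (Suc m))) \<subseteq> W (Suc m)"
    proof clarify
      fix k
      have "0 \<le> t (Suc (Suc m)) k"
        unfolding t_def using q(2) y by (simp add: sum_nonneg)
      then show "t (Suc (Suc m)) k \<in> W (Suc m)"
        by (rule normal_mono_nonneg[OF W sum_tail_mem[OF W q(1)]]) (unfold t_def, rule inf_le1)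
    qed
  qed
  have z_0: "is_infimum (range z) 0"
    unfolding is_infimum_def
  proof (intro conjI ballI allI impI)
    have z_nonneg: "0 \<le> z m" for m
      using t_z[of m 0] y by (simp add: t_def inf_absorb1)
    then show "0 \<le> a" if "a \<in> range z" for a
      using that by blast
    fix u assume "\<forall>a\<in>range z. u \<le> a"
    then have u_z: "pprt u \<le> z m" for m
      using z_nonneg by (intro pprt_leI) auto
    have u_W: "pprt u \<in> core W"
      unfolding core_def using normal_mono_nonneg[OF W z_W _ u_z] by simp
    have lat_disjoint_q: "lat_disjoint (q n) (pprt u)" for n
      using residual[of "inf (q n) (pprt u)" n] core_mono_nonneg[OF W u_W, of "inf (q n) (pprt u)"] q(2)
      by (simp add: lat_disjoint_nonneg)
    have lat_disjoint_sum: "lat_disjoint (\<Sum>i<k. q (0 + i)) (pprt u)" for k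
      by (induction k) (auto intro: lat_disjoint_add lat_disjoint_q)
    have "t 0 k \<le> z 0 - pprt u" for k
    proof -
      have "inf (t 0 k) (pprt u) \<le> inf (\<Sum>i<k. q (0 + i)) (pprt u)"
        unfolding t_def by (intro inf_mono) auto
      also have "\<dots> = 0"
        using lat_disjoint_sum[of k] q(2) by (subst (asm) lat_disjoint_nonneg) (auto simp: sum_nonneg)
      finally have "t 0 k + pprt u \<le> sup (t 0 k) (pprt u)"
        by (simp add: add_eq_inf_sup[of "t 0 k" "pprt u"] del: inf_le1 inf_le2)
      also have "\<dots> \<le> z 0"
        using t_z u_z by simp
      finally show ?thesis
        by (simp add: le_diff_eq)
    qed
    then have "z 0 \<le> z 0 - pprt u"
      using z[of 0] unfolding is_supremum_def by blast
    then show "u \<le> 0"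
      using pprt_ge[of u] by (simp add: le_diff_eq)
  qed
  show "order_convergent UNIV (\<le>) (\<lambda>n. inf \<bar>q n - 0\<bar> y) 0"
  proof (rule order_convergentI[where B = UNIV and leB = "(\<le>) :: nat \<Rightarrow> nat \<Rightarrow> bool" and y = z])
    show "directed_set UNIV ((\<le>) :: nat \<Rightarrow> nat \<Rightarrow> bool)"
      by (rule nat_directed)
    show "decreases_to_0 UNIV (\<le>) z"
      unfolding decreases_to_0_def using z_0 z_antimono by blast
    show "\<exists>a0\<in>UNIV. \<forall>a\<in>UNIV. a0 \<le> a \<longrightarrow> \<bar>0 - inf \<bar>q a - 0\<bar> y\<bar> \<le> z m" for m
    proof (intro bexI[of _ m] ballI impI)
      fix n assume "m \<le> n"
      have "inf (q n) y \<le> t n (Suc 0)"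
        by (simp add: t_def)
      also have "\<dots> \<le> z m"
        using t_z z_antimono[OF \<open>m \<le> n\<close>] order_trans by blast
      finally show "\<bar>0 - inf \<bar>q n - 0\<bar> y\<bar> \<le> z m"
        using q(2) y by simp
    qed simp
  qed
qed

text \<open>
  Suppose that no member of \<open>\<U>\<close> is contained in \<open>V\<close>. A diagonal construction selects positive
  \<open>x n \<notin> V\<close> in the \<open>n\<close>th set of a normal sequence \<open>D n\<close>, each time intersecting the sequence
  with a normal sequence \<open>G (x n)\<close> whose core part of \<open>x n\<close> is small for \<open>\<V>\<close>. The diagonal
  \<open>W n = D n n\<close> is again normal and its core is contained in that of every \<open>G (x n)\<close>. Removing
  the \<open>W\<close>-core part from each \<open>x n\<close> leaves a sequence that is uo-null by
  \<open>normal_seq_uo_null\<close>, and so meets \<open>V1\<close>; adding the core part back puts \<open>x n\<close> into \<open>V\<close>.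
\<close>

theorem comparison:
  assumes \<V>: "lebesgue_base \<V>"
    and uo: "\<And>V x. V \<in> \<V> \<Longrightarrow> uo_convergent UNIV (\<le>) (x :: nat \<Rightarrow> 'a) 0 \<Longrightarrow> \<exists>n. x n \<in> V"
    and V: "V \<in> \<V>"
  shows "\<exists>U\<in>\<U>. U \<subseteq> V"
proof (rule ccontr)
  interpret V: lebesgue_base \<V>
    by (rule \<V>)
  assume contra: "\<not> (\<exists>U\<in>\<U>. U \<subseteq> V)"
  obtain V1 where V1: "V1 \<in> \<V>" "\<forall>x\<in>V1. \<forall>y\<in>V1. x + y \<in> V"
    using V.halve[OF V] by blast
  have "\<exists>x. 0 \<le> x \<and> x \<in> N n \<and> x \<notin> V" if N: "normal N" for N n
  proof -
    obtain U where U: "U \<in> \<U>" "U \<subseteq> N n"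
      using normal_base[OF N] by blast
    then obtain x where "x \<in> U" "x \<notin> V"
      using contra by blast
    then have "0 \<le> \<bar>x\<bar> \<and> \<bar>x\<bar> \<in> N n \<and> \<bar>x\<bar> \<notin> V"
      using U V.abs_mem[OF V] abs_mem[OF U(1)] by auto
    then show ?thesis
      by blast
  qed
  then obtain f where f: "\<And>N n. normal N \<Longrightarrow> 0 \<le> f N n \<and> f N n \<in> N n \<and> f N n \<notin> V"
    by metis
  obtain G where G: "\<And>x. 0 \<le> x \<Longrightarrow> normal (G x) \<and> core_part (G x) x \<in> V1"
    using exists_small_core_part[OF \<V> V1(1)] by metis
  obtain N0 where N0: "normal N0"
    using nonempty normal_through by blast
  define D where "D = rec_nat N0 (\<lambda>n N k. N k \<inter> G (f N n) k)"
  have D_0: "D 0 = N0" and D_Suc: "D (Suc n) = (\<lambda>k. D n k \<inter> G (f (D n) n) k)" for n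
    by (simp_all add: D_def)
  have D: "normal (D n)" for n
    by (induction n) (use f G in \<open>auto simp: D_0 D_Suc N0 intro!: normal_Int\<close>)
  define x where "x n = f (D n) n" for n
  define W where "W n = D n n" for n
  have x: "0 \<le> x n" "x n \<in> W n" "x n \<notin> V" for n
    using f[OF D[of n], of n] by (auto simp: x_def W_def)
  have D_Suc_subset: "D (Suc n) k \<subseteq> D n k" for n k
    by (auto simp: D_Suc)
  have W: "normal W"
    unfolding normal_def
  proof (intro allI conjI ballI)
    fix n
    show "solid (W n)" "\<exists>U\<in>\<U>. U \<subseteq> W n"
      using D[of n] by (auto simp: normal_def W_def)
    fix a b assume "a \<in> W (Suc n)" "b \<in> W (Suc n)"
    then have "a \<in> D n (Suc n)" "b \<in> D n (Suc n)"
      using D_Suc_subset unfolding W_def by blast+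
    then show "a + b \<in> W n"
      using normal_add[OF D, of a n n b] unfolding W_def by simp
  qed
  have core_W: "core W \<subseteq> core (G (x i))" for i
    unfolding core_def
  proof (intro subsetI INT_I)
    fix z k assume z: "z \<in> (\<Inter>n. W n)"
    \<comment> \<open>Only the sets \<open>W m\<close> with \<open>m > i\<close> were cut down by \<open>G (x i)\<close>.\<close>
    define m where "m = Suc i + k"
    have "D (Suc i + j) k' \<subseteq> G (x i) k'" for j k'
      by (induction j) (auto simp: D_Suc x_def)
    then have "z \<in> G (x i) m"
      using z unfolding m_def W_def by blast
    then show "z \<in> G (x i) k"
      using normal_antimono[of "G (x i)" k m] G[OF x(1)[of i]] unfolding m_def by auto
  qed
  have small: "core_part W (x n) \<in> V1" for n
  proof (rule V.nonneg_mem_mono[OF V1(1)])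
    show "core_part (G (x n)) (x n) \<in> V1"
      using G x by blast
    show "0 \<le> core_part W (x n)"
      by (rule core_part_nonneg[OF W x(1)])
    show "core_part W (x n) \<le> core_part (G (x n)) (x n)"
      using G x(1) W core_W by (intro core_part_mono_core) auto
  qed
  define q where "q n = x n - core_part W (x n)" for n
  have q: "0 \<le> q n" "q n \<le> x n" for n
    using core_part_nonneg[OF W x(1)] core_part_le[OF W x(1)] by (simp_all add: q_def)
  have "uo_convergent UNIV (\<le>) q 0"
  proof (rule normal_seq_uo_null[OF W])
    show "q n \<in> W n" for n
      by (rule normal_mono_nonneg[OF W x(2) q])
    show "u = 0" if "u \<in> core W" "0 \<le> u" "u \<le> q n" for n u
      using core_part_residual[OF W x(1) that(1,2)] that(3) unfolding q_def .
  qed (rule q)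
  then obtain n where "q n \<in> V1"
    using uo[OF V1(1)] by blast
  then have "q n + core_part W (x n) \<in> V"
    by (rule V1(2)[rule_format, OF _ small])
  then show False
    using x(3) by (simp add: q_def)
qed

end

lemma base_topology_mono:
  assumes "lebesgue_base \<U>" "lebesgue_base \<V>" "\<And>V. V \<in> \<V> \<Longrightarrow> \<exists>U\<in>\<U>. U \<subseteq> V"
    and "openin (base_topology \<V>) S"
  shows "openin (base_topology \<U>) S"
  unfolding lebesgue_base.openin_base_topology[OF assms(1)]
proof
  fix x assume "x \<in> S"
  then obtain V where V: "V \<in> \<V>" "\<forall>y. y - x \<in> V \<longrightarrow> y \<in> S"
    using assms(4) unfolding lebesgue_base.openin_base_topology[OF assms(2)] by blast
  obtain U where "U \<in> \<U>" "U \<subseteq> V"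
    using assms(3)[OF V(1)] by blast
  then show "\<exists>U\<in>\<U>. \<forall>y. y - x \<in> U \<longrightarrow> y \<in> S"
    using V(2) by (intro bexI[of _ U]) auto
qed

text \<open>
  With an unbounded base for \<open>\<U>\<close> this says that a Hausdorff uo-Lebesgue topology is unbounded.
\<close>

lemma finer_than_uo_lebesgue:
  fixes \<tau> :: "'a::dedekind_complete_vector_lattice topology"
  assumes "hausdorff_uo_lebesgue \<tau>" "lebesgue_base \<U>" "V \<in> solid_nhds \<tau>"
  shows "\<exists>U\<in>\<U>. U \<subseteq> V"
proof (rule lebesgue_base.comparison[OF assms(2) lebesgue_base_solid_nhds[OF assms(1)] _ assms(3)])
  fix V and x :: "nat \<Rightarrow> 'a"
  assume "V \<in> solid_nhds \<tau>" "uo_convergent UNIV (\<le>) x 0"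
  then show "\<exists>n. x n \<in> V"
    using uo_convergent_mem_solid_nhds[OF assms(1) nat_directed, of x V] by blast
qed

theorem hausdorff_uo_lebesgue_unique:
  fixes \<sigma> \<tau> :: "'a::dedekind_complete_vector_lattice topology"
  assumes "hausdorff_uo_lebesgue \<sigma>" "hausdorff_uo_lebesgue \<tau>"
  shows "\<sigma> = \<tau>"
proof -
  have "openin \<tau> S"
    if \<sigma>: "hausdorff_uo_lebesgue \<sigma>" and \<tau>: "hausdorff_uo_lebesgue \<tau>" and S: "openin \<sigma> S"
    for \<sigma> \<tau> :: "'a topology" and S
  proof -
    have "openin (base_topology (solid_nhds \<tau>)) S"
    proof (rule base_topology_mono[OF lebesgue_base_solid_nhds[OF \<tau>] lebesgue_base_solid_nhds[OF \<sigma>]])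
      show "\<exists>U\<in>solid_nhds \<tau>. U \<subseteq> V" if "V \<in> solid_nhds \<sigma>" for V
        by (rule finer_than_uo_lebesgue[OF \<sigma> lebesgue_base_solid_nhds[OF \<tau>] that])
      show "openin (base_topology (solid_nhds \<sigma>)) S"
        using S by (simp only: base_topology_solid_nhds[OF \<sigma>])
    qed
    then show ?thesis
      by (simp only: base_topology_solid_nhds[OF \<tau>])
  qed
  then show ?thesis
    using assms by (metis topology_eq)
qed

lemma uo_topology_eqI:
  fixes \<tau> :: "'a::dedekind_complete_vector_lattice topology"
  assumes "hausdorff_uo_lebesgue \<tau>"
  shows "uo_topology = \<tau>"
  unfolding uo_topology_def using assms hausdorff_uo_lebesgue_unique by (intro the_equality) blast+


section \<open>The order bounded operators as a Dedekind complete vector lattice\<close>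

lemma linear_lob: "linear (lob_apply T)"
  using lob_apply[of T] by blast

lemma order_bounded_lob: "order_bounded (lob_apply T)"
  using lob_apply[of T] by blast

lemmas lob_apply_simps [simp] =
  zero_lob.rep_eq plus_lob.rep_eq uminus_lob.rep_eq minus_lob.rep_eq scaleR_lob.rep_eq
  times_lob.rep_eq

lemma lob_le_iff: "S \<le> T \<longleftrightarrow> (\<forall>x\<ge>0. lob_apply S x \<le> lob_apply T x)"
  by (rule less_eq_lob.rep_eq)

lemma lob_apply_mono_op: "S \<le> T \<Longrightarrow> 0 \<le> x \<Longrightarrow> lob_apply S x \<le> lob_apply T x"
  by (simp add: lob_le_iff)

lemma lob_apply_nonneg: "0 \<le> T \<Longrightarrow> 0 \<le> x \<Longrightarrow> 0 \<le> lob_apply T x"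
  using lob_apply_mono_op[of 0 T x] by simp

lemma lob_apply_mono: "0 \<le> T \<Longrightarrow> x \<le> y \<Longrightarrow> lob_apply T x \<le> lob_apply T y"
  using lob_apply_nonneg[of T "y - x"] by (simp add: linear_diff[OF linear_lob])

lemma lob_eqI:
  assumes "\<And>x. 0 \<le> x \<Longrightarrow> lob_apply S x = lob_apply T x"
  shows "S = T"
  using assms by (intro order.antisym) (simp_all add: lob_le_iff)

text \<open>
  The order bounds needed for membership in the type of operators come from positivity.
\<close>

lemma positive_extension:
  fixes h :: "'a::vector_lattice \<Rightarrow> 'a"
  assumes add: "\<And>x y. 0 \<le> x \<Longrightarrow> 0 \<le> y \<Longrightarrow> h (x + y) = h x + h y"
    and scale: "\<And>r x. 0 < r \<Longrightarrow> 0 \<le> x \<Longrightarrow> h (r *\<^sub>R x) = r *\<^sub>R h x"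
    and pos: "\<And>x. 0 \<le> x \<Longrightarrow> 0 \<le> h x"
  shows "\<exists>H. \<forall>x\<ge>0. lob_apply H x = h x"
proof -
  define g where "g x = h (pprt x) - h (pprt (- x))" for x
  have h_0: "h 0 = 0"
    using add[of 0 0] by simp
  have g_diff: "g (u - v) = h u - h v" if "0 \<le> u" "0 \<le> v" for u v
  proof -
    have "u + pprt (- (u - v)) = v + pprt (u - v)"
      using pprt_minus_pprt[of "u - v"] by (simp add: algebra_simps)
    then have "h (u + pprt (- (u - v))) = h (v + pprt (u - v))"
      by (rule arg_cong)
    then have "h u + h (pprt (- (u - v))) = h v + h (pprt (u - v))"
      by (simp only: add that zero_le_pprt)
    then show ?thesis
      unfolding g_def by (simp add: algebra_simps)
  qed
  have g_cone: "g x = h x" if "0 \<le> x" for x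
    using g_diff[of x 0] that h_0 by simp
  have "linear g"
  proof (rule linearI)
    fix x y :: 'a
    have "x + y = (pprt x - pprt (- x)) + (pprt y - pprt (- y))"
      by (simp only: pprt_minus_pprt)
    also have "\<dots> = (pprt x + pprt y) - (pprt (- x) + pprt (- y))"
      by (simp add: algebra_simps)
    finally have "g (x + y) = g ((pprt x + pprt y) - (pprt (- x) + pprt (- y)))"
      by (rule arg_cong)
    also have "\<dots> = h (pprt x + pprt y) - h (pprt (- x) + pprt (- y))"
      by (intro g_diff add_nonneg_nonneg zero_le_pprt)
    finally show "g (x + y) = g x + g y"
      by (simp add: add g_def[of x] g_def[of y] algebra_simps)
  next
    have pos: "g (r *\<^sub>R x) = r *\<^sub>R g x" if "0 < r" for r x
    proof -
      have "r *\<^sub>R x = r *\<^sub>R pprt x - r *\<^sub>R pprt (- x)"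
        by (simp only: pprt_minus_pprt flip: scaleR_right_diff_distrib)
      then have "g (r *\<^sub>R x) = g (r *\<^sub>R pprt x - r *\<^sub>R pprt (- x))"
        by (rule arg_cong)
      also have "\<dots> = h (r *\<^sub>R pprt x) - h (r *\<^sub>R pprt (- x))"
        using that by (intro g_diff scaleR_nonneg_nonneg zero_le_pprt) auto
      finally show ?thesis
        using that by (simp add: scale g_def[of x] scaleR_right_diff_distrib)
    qed
    have neg: "g (- x) = - g x" for x
      by (simp add: g_def)
    fix r :: real and x :: 'a
    consider "r = 0" | "0 < r" | "0 < - r" by linarith
    then show "g (r *\<^sub>R x) = r *\<^sub>R g x"
    proof cases
      case 1
      then show ?thesis by (simp add: g_cone h_0)
    next
      case 2
      then show ?thesis by (rule pos)
    next
      case 3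
      then show ?thesis using pos[of "- r" x] neg[of "r *\<^sub>R x"] by simp
    qed
  qed
  moreover have "g x \<le> g y" if "x \<le> y" for x y
  proof -
    have "0 \<le> g (y - x)"
      using that by (simp add: g_cone pos)
    then show ?thesis
      by (simp add: linear_diff[OF \<open>linear g\<close>])
  qed
  then have "order_bounded g"
    by (intro order_boundedI) blast
  ultimately have "lob_apply (Lob g) = g"
    by (simp add: Lob_inverse)
  then show ?thesis
    using g_cone by (intro exI[of _ "Lob g"]) simp
qed

text \<open>
  Directedness makes the pointwise suprema additive on the positive cone: if \<open>R\<close> is above \<open>S\<close> and
  \<open>T\<close>, then \<open>Sx + Ty \<le> R(x + y)\<close>.
\<close>

lemma directed_supremum_lob:
  fixes D :: "'a::dedekind_complete_vector_lattice lob set"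
  assumes D: "up_directed D" and U: "\<And>T. T \<in> D \<Longrightarrow> T \<le> U"
  obtains G where "is_supremum D G"
    "\<And>x. 0 \<le> x \<Longrightarrow> is_supremum ((\<lambda>T. lob_apply T x) ` D) (lob_apply G x)"
proof -
  define s where "s x = Sup ((\<lambda>T. lob_apply T x) ` D)" for x
  obtain T0 where T0: "T0 \<in> D"
    using D unfolding up_directed_def by blast
  have s: "is_supremum ((\<lambda>T. lob_apply T x) ` D) (s x)" if "0 \<le> x" for x
    unfolding s_def
  proof (intro is_supremum_cSup bdd_aboveI2)
    show "(\<lambda>T. lob_apply T x) ` D \<noteq> {}"
      using T0 by blast
    show "lob_apply T x \<le> lob_apply U x" if "T \<in> D" for T
      using U[OF that] \<open>0 \<le> x\<close> by (rule lob_apply_mono_op)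
  qed
  have upper: "lob_apply T x \<le> s x" if "T \<in> D" "0 \<le> x" for T x
    using s[OF that(2)] that(1) unfolding is_supremum_def by blast
  have least: "s x \<le> u" if "0 \<le> x" "\<And>T. T \<in> D \<Longrightarrow> lob_apply T x \<le> u" for x u
    using s[OF that(1)] that(2) unfolding is_supremum_def by blast
  have s_add: "s (x + y) = s x + s y" if "0 \<le> x" "0 \<le> y" for x y
  proof (rule order.antisym)
    show "s (x + y) \<le> s x + s y"
      using that by (intro least) (auto simp: linear_add[OF linear_lob] intro: add_mono upper)
    have "s x \<le> s (x + y) - s y"
    proof (rule least[OF that(1)])
      fix S assume S: "S \<in> D"
      have "s y \<le> s (x + y) - lob_apply S x"
      proof (rule least[OF that(2)])
        fix T assume "T \<in> D"
        then obtain R where R: "R \<in> D" "S \<le> R" "T \<le> R"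
          using D S unfolding up_directed_def by meson
        have "lob_apply T y + lob_apply S x \<le> lob_apply R y + lob_apply R x"
          using R that by (intro add_mono lob_apply_mono_op)
        also have "\<dots> = lob_apply R (x + y)"
          by (simp add: linear_add[OF linear_lob] add.commute)
        also have "\<dots> \<le> s (x + y)"
          using R that by (intro upper) auto
        finally show "lob_apply T y \<le> s (x + y) - lob_apply S x"
          by (simp add: le_diff_eq)
      qed
      then show "lob_apply S x \<le> s (x + y) - s y"
        by (simp add: le_diff_eq add.commute)
    qed
    then show "s x + s y \<le> s (x + y)"
      by (simp add: le_diff_eq)
  qed
  have s_le: "s (r *\<^sub>R x) \<le> r *\<^sub>R s x" if "0 < r" "0 \<le> x" for r x
    using that
    by (intro least) (auto simp: linear_scale[OF linear_lob] intro!: scaleR_left_mono upper scaleR_nonneg_nonneg)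
  have s_scale: "s (r *\<^sub>R x) = r *\<^sub>R s x" if "0 < r" "0 \<le> x" for r x
  proof (rule order.antisym[OF s_le[OF that]])
    have "s (inverse r *\<^sub>R (r *\<^sub>R x)) \<le> inverse r *\<^sub>R s (r *\<^sub>R x)"
      using that by (intro s_le) (auto intro: scaleR_nonneg_nonneg)
    then have "r *\<^sub>R s x \<le> r *\<^sub>R (inverse r *\<^sub>R s (r *\<^sub>R x))"
      using that by (intro scaleR_left_mono) auto
    then show "r *\<^sub>R s x \<le> s (r *\<^sub>R x)"
      using that by simp
  qed
  have "\<exists>H. \<forall>x\<ge>0. lob_apply H x = s x - lob_apply T0 x"
  proof (rule positive_extension[of "\<lambda>x. s x - lob_apply T0 x"])
    show "s (x + y) - lob_apply T0 (x + y) = s x - lob_apply T0 x + (s y - lob_apply T0 y)"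
      if "0 \<le> x" "0 \<le> y" for x y
      using that by (simp add: s_add linear_add[OF linear_lob])
    show "s (r *\<^sub>R x) - lob_apply T0 (r *\<^sub>R x) = r *\<^sub>R (s x - lob_apply T0 x)"
      if "0 < r" "0 \<le> x" for r x
      using that by (simp add: s_scale linear_scale[OF linear_lob] scaleR_right_diff_distrib)
    show "0 \<le> s x - lob_apply T0 x" if "0 \<le> x" for x
      using upper[OF T0 that] by simp
  qed
  then obtain H where H: "\<And>x. 0 \<le> x \<Longrightarrow> lob_apply H x = s x - lob_apply T0 x"
    by blast
  have G: "lob_apply (T0 + H) x = s x" if "0 \<le> x" for x
    using H[OF that] by simp
  show thesis
  proof (rule that[of "T0 + H"])
    show "is_supremum ((\<lambda>T. lob_apply T x) ` D) (lob_apply (T0 + H) x)" if "0 \<le> x" for x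
      using s[OF that] G[OF that] by simp
    show "is_supremum D (T0 + H)"
      unfolding is_supremum_def
    proof (intro conjI ballI allI impI)
      show "T \<le> T0 + H" if "T \<in> D" for T
        unfolding lob_le_iff using G upper[OF that] by simp
      show "T0 + H \<le> R" if "\<forall>T\<in>D. T \<le> R" for R
        unfolding lob_le_iff
      proof (intro allI impI)
        fix x :: 'a assume x: "0 \<le> x"
        show "lob_apply (T0 + H) x \<le> lob_apply R x"
          unfolding G[OF x] using that x by (intro least lob_apply_mono_op) auto
      qed
    qed
  qed
qed

text \<open>
  A set and the directed set of its finite suprema have the same upper bounds.
\<close>

lemma supremum_lob_exists:
  fixes S :: "'a::dedekind_complete_vector_lattice lob set"
  assumes "S \<noteq> {}" "bdd_above S"
  shows "\<exists>G. is_supremum S G"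
proof -
  define D where "D = {Sup_fin F |F. finite F \<and> F \<noteq> {} \<and> F \<subseteq> S}"
  obtain U where U: "\<And>T. T \<in> S \<Longrightarrow> T \<le> U"
    using assms(2) unfolding bdd_above_def by blast
  have S_D: "S \<subseteq> D"
  proof
    fix T assume "T \<in> S"
    then show "T \<in> D"
      unfolding D_def by (intro CollectI exI[of _ "{T}"]) simp
  qed
  have D_upper: "T \<le> R" if "T \<in> D" "\<And>T. T \<in> S \<Longrightarrow> T \<le> R" for T R
    using that unfolding D_def by (auto intro!: Sup_fin.boundedI)
  have up: "up_directed D"
    unfolding up_directed_def
  proof (intro conjI ballI)
    show "D \<noteq> {}"
      using S_D assms(1) by blast
    fix T R assume "T \<in> D" "R \<in> D"
    then obtain F F' where F: "finite F" "F \<noteq> {}" "F \<subseteq> S" "T = Sup_fin F"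
      and F': "finite F'" "F' \<noteq> {}" "F' \<subseteq> S" "R = Sup_fin F'"
      unfolding D_def by blast
    have "sup T R = Sup_fin (F \<union> F')"
      using F F' by (simp add: Sup_fin.union)
    then have "sup T R \<in> D"
      using F F' unfolding D_def by (intro CollectI exI[of _ "F \<union> F'"]) auto
    then show "\<exists>Q\<in>D. T \<le> Q \<and> R \<le> Q"
      by (intro bexI[of _ "sup T R"]) auto
  qed
  obtain G where G: "is_supremum D G"
    by (rule directed_supremum_lob[OF up D_upper[OF _ U]]) (assumption | rule that)+
  have "is_supremum S G"
    using G S_D D_upper unfolding is_supremum_def by blast
  then show ?thesis
    by blast
qed

instantiation lob :: (dedekind_complete_vector_lattice) dedekind_complete_vector_lattice
begin

definition Sup_lob :: "'a lob set \<Rightarrow> 'a lob" where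
  "Sup_lob S = (SOME G. is_supremum S G)"

definition Inf_lob :: "'a lob set \<Rightarrow> 'a lob" where
  "Inf_lob S = - Sup (uminus ` S)"

instance
proof
  have Sup: "is_supremum S (Sup S)" if "S \<noteq> {}" "bdd_above S" for S :: "'a lob set"
    unfolding Sup_lob_def using supremum_lob_exists[OF that] by (rule someI_ex)
  fix T :: "'a lob" and S :: "'a lob set"
  show "T \<in> S \<Longrightarrow> bdd_above S \<Longrightarrow> T \<le> Sup S"
    using Sup[of S] unfolding is_supremum_def by blast
  show least: "Sup S \<le> T" if "S \<noteq> {}" "\<And>R. R \<in> S \<Longrightarrow> R \<le> T"
    using Sup[of S] that unfolding is_supremum_def bdd_above_def by blast
  show "Inf S \<le> T" if T: "T \<in> S" and S: "bdd_below S"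
  proof -
    obtain L where L: "\<And>R. R \<in> S \<Longrightarrow> L \<le> R"
      using S unfolding bdd_below_def by blast
    have "bdd_above (uminus ` S)"
      by (rule bdd_aboveI2[where M = "- L"]) (simp add: L)
    then have "- T \<le> Sup (uminus ` S)"
      using Sup[of "uminus ` S"] T unfolding is_supremum_def by blast
    then show ?thesis
      unfolding Inf_lob_def by (simp only: minus_le_iff)
  qed
  show "T \<le> Inf S" if S: "S \<noteq> {}" and T: "\<And>R. R \<in> S \<Longrightarrow> T \<le> R"
  proof -
    have "bdd_above (uminus ` S)"
      by (rule bdd_aboveI2[where M = "- T"]) (simp add: T)
    then have "Sup (uminus ` S) \<le> - T"
      using Sup[of "uminus ` S"] S T unfolding is_supremum_def by auto
    then show ?thesis
      unfolding Inf_lob_def by (simp only: le_minus_iff)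
  qed
qed

end


subsection \<open>The absolute strong base on the order bounded operators\<close>

lemma lob_abs_apply_le: "\<bar>lob_apply T x\<bar> \<le> lob_apply \<bar>T\<bar> \<bar>x\<bar>"
  for T :: "'a::dedekind_complete_vector_lattice lob"
proof -
  have cone: "\<bar>lob_apply T y\<bar> \<le> lob_apply \<bar>T\<bar> y" if "0 \<le> y" for y
  proof (rule abs_leI)
    show "lob_apply T y \<le> lob_apply \<bar>T\<bar> y"
      by (rule lob_apply_mono_op[OF abs_ge_self that])
    show "- lob_apply T y \<le> lob_apply \<bar>T\<bar> y"
      using lob_apply_mono_op[OF abs_ge_minus_self[of T] that] by simp
  qed
  have "lob_apply T x = lob_apply T (pprt x) - lob_apply T (pprt (- x))"
    by (simp only: pprt_minus_pprt flip: linear_diff[OF linear_lob])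
  then have "\<bar>lob_apply T x\<bar> \<le> \<bar>lob_apply T (pprt x)\<bar> + \<bar>lob_apply T (pprt (- x))\<bar>"
    by (metis abs_triangle_ineq4)
  also have "\<dots> \<le> lob_apply \<bar>T\<bar> (pprt x) + lob_apply \<bar>T\<bar> (pprt (- x))"
    by (intro add_mono cone zero_le_pprt)
  also have "\<dots> = lob_apply \<bar>T\<bar> \<bar>x\<bar>"
    by (simp only: abs_eq_pprt_add[of x] linear_add[OF linear_lob])
  finally show ?thesis .
qed

lemma lob_abs_apply_nonneg: "0 \<le> x \<Longrightarrow> 0 \<le> lob_apply \<bar>T\<bar> x"
  for T :: "'a::dedekind_complete_vector_lattice lob"
  by (rule lob_apply_nonneg) simp_all

definition abs_strong :: "'a::dedekind_complete_vector_lattice set set \<Rightarrow> 'a lob set set" where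
  "abs_strong \<U> = {{T. lob_apply \<bar>T\<bar> x \<in> U} |U x. U \<in> \<U> \<and> 0 \<le> x}"

lemma abs_strongI: "U \<in> \<U> \<Longrightarrow> 0 \<le> x \<Longrightarrow> {T. lob_apply \<bar>T\<bar> x \<in> U} \<in> abs_strong \<U>"
  unfolding abs_strong_def by blast

lemma abs_strongE:
  assumes "W \<in> abs_strong \<U>"
  obtains U x where "U \<in> \<U>" "0 \<le> x" "W = {T. lob_apply \<bar>T\<bar> x \<in> U}"
  using assms unfolding abs_strong_def by blast

text \<open>
  This transfers the Lebesgue property from \<open>'a\<close> to its operators.
\<close>

lemma pointwise_infimum_lob:
  fixes D :: "'a::dedekind_complete_vector_lattice lob set"
  assumes "down_directed D" "is_infimum D 0" "0 \<le> x"
  shows "down_directed ((\<lambda>T. lob_apply T x) ` D)" "is_infimum ((\<lambda>T. lob_apply T x) ` D) 0"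
proof -
  show "down_directed ((\<lambda>T. lob_apply T x) ` D)"
    by (rule down_directed_image[OF assms(1) lob_apply_mono_op[OF _ assms(3)]])
  have up: "up_directed (uminus ` D)"
    using assms(1) unfolding up_directed_def down_directed_def by simp
  have D_nonneg: "0 \<le> T" if "T \<in> D" for T
    using assms(2) that unfolding is_infimum_def by blast
  obtain G where G: "is_supremum (uminus ` D) G"
    "\<And>x. 0 \<le> x \<Longrightarrow> is_supremum ((\<lambda>T. lob_apply T x) ` uminus ` D) (lob_apply G x)"
  proof (rule directed_supremum_lob[OF up])
    show "T \<le> 0" if "T \<in> uminus ` D" for T
      using that D_nonneg by auto
  qed (rule that)
  have "- G \<le> 0"
  proof -
    have "\<forall>T\<in>D. - G \<le> T"
      using G(1) unfolding is_supremum_def by (auto simp: minus_le_iff)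
    then show ?thesis
      using assms(2) unfolding is_infimum_def by blast
  qed
  moreover have "G \<le> 0"
  proof -
    have "\<forall>S\<in>uminus ` D. S \<le> 0"
      using D_nonneg by auto
    then show ?thesis
      using G(1) unfolding is_supremum_def by blast
  qed
  ultimately have "G = 0"
    by (intro order.antisym) simp_all
  then have sup: "is_supremum ((\<lambda>T. lob_apply T x) ` uminus ` D) 0"
    using G(2)[OF assms(3)] by simp
  show "is_infimum ((\<lambda>T. lob_apply T x) ` D) 0"
    unfolding is_infimum_def
  proof (intro conjI ballI allI impI)
    show "0 \<le> y" if "y \<in> (\<lambda>T. lob_apply T x) ` D" for y
      using that D_nonneg lob_apply_nonneg[OF _ assms(3)] by blast
    fix u assume u: "\<forall>y\<in>(\<lambda>T. lob_apply T x) ` D. u \<le> y"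
    have "\<forall>y\<in>(\<lambda>T. lob_apply T x) ` uminus ` D. y \<le> - u"
      using u by auto
    then have "0 \<le> - u"
      using sup unfolding is_supremum_def by blast
    then show "u \<le> 0"
      by simp
  qed
qed

theorem lebesgue_base_abs_strong:
  assumes "lebesgue_base \<U>"
  shows "lebesgue_base (abs_strong \<U>)"
proof -
  interpret lebesgue_base \<U>
    by fact
  show ?thesis
  proof
    show "abs_strong \<U> \<noteq> {}"
      using nonempty abs_strongI[of _ \<U> 0] by blast
  next
    fix W assume "W \<in> abs_strong \<U>"
    then obtain U x where W: "U \<in> \<U>" "0 \<le> x" "W = {T. lob_apply \<bar>T\<bar> x \<in> U}"
      by (rule abs_strongE)
    show "solid W"
      unfolding solid_def
    proof (intro allI impI)
      fix S T assume "T \<in> W \<and> \<bar>S\<bar> \<le> \<bar>T\<bar>"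
      then show "S \<in> W"
        using W nonneg_mem_mono[OF W(1) _ lob_abs_apply_nonneg[OF W(2)] lob_apply_mono_op[OF _ W(2)]]
        by blast
    qed
    obtain V where V: "V \<in> \<U>" "\<forall>x\<in>V. \<forall>y\<in>V. x + y \<in> U"
      using halve[OF W(1)] by blast
    have "S + T \<in> W" if "lob_apply \<bar>S\<bar> x \<in> V" "lob_apply \<bar>T\<bar> x \<in> V" for S T
    proof -
      have "lob_apply \<bar>S\<bar> x + lob_apply \<bar>T\<bar> x \<in> U"
        using V(2) that by (simp only:)
      moreover have "lob_apply \<bar>S + T\<bar> x \<le> lob_apply \<bar>S\<bar> x + lob_apply \<bar>T\<bar> x"
        using lob_apply_mono_op[OF abs_triangle_ineq[of S T] W(2)] by simp
      ultimately show ?thesis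
        using nonneg_mem_mono[OF W(1) _ lob_abs_apply_nonneg[OF W(2)]] W(3) by simp
    qed
    then show "\<exists>V\<in>abs_strong \<U>. \<forall>x\<in>V. \<forall>y\<in>V. x + y \<in> W"
      by (intro bexI[OF _ abs_strongI[OF V(1) W(2)]]) auto
    fix D assume D: "down_directed D" "is_infimum D (0::'a lob)"
    obtain T where T: "T \<in> D" "lob_apply T x \<in> U"
      using lebesgue[OF W(1) pointwise_infimum_lob[OF D W(2)]] by blast
    moreover have "0 \<le> T"
      using T D(2) unfolding is_infimum_def by blast
    ultimately show "\<exists>d\<in>D. d \<in> W"
      using W(3) by auto
  next
    fix W1 W2 assume "W1 \<in> abs_strong \<U>"
    then obtain U1 x1 where W1: "U1 \<in> \<U>" "0 \<le> x1" "W1 = {T. lob_apply \<bar>T\<bar> x1 \<in> U1}"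
      by (rule abs_strongE)
    assume "W2 \<in> abs_strong \<U>"
    then obtain U2 x2 where W2: "U2 \<in> \<U>" "0 \<le> x2" "W2 = {T. lob_apply \<bar>T\<bar> x2 \<in> U2}"
      by (rule abs_strongE)
    obtain U where U: "U \<in> \<U>" "U \<subseteq> U1 \<inter> U2"
      using refine[OF W1(1) W2(1)] by blast
    have "T \<in> W1 \<inter> W2" if T: "lob_apply \<bar>T\<bar> (x1 + x2) \<in> U" for T
    proof -
      have "lob_apply \<bar>T\<bar> x1 \<le> lob_apply \<bar>T\<bar> (x1 + x2)" "lob_apply \<bar>T\<bar> x2 \<le> lob_apply \<bar>T\<bar> (x1 + x2)"
        using W1(2) W2(2) by (intro lob_apply_mono; simp)+
      then have "lob_apply \<bar>T\<bar> x1 \<in> U" "lob_apply \<bar>T\<bar> x2 \<in> U"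
        using nonneg_mem_mono[OF U(1) T] lob_abs_apply_nonneg W1(2) W2(2) by blast+
      then show ?thesis
        using U W1 W2 by blast
    qed
    then show "\<exists>W\<in>abs_strong \<U>. W \<subseteq> W1 \<inter> W2"
      using W1(2) W2(2) by (intro bexI[OF _ abs_strongI[OF U(1), of "x1 + x2"]]) auto
  next
    fix T assume *: "\<And>W. W \<in> abs_strong \<U> \<Longrightarrow> T \<in> W"
    have "\<bar>T\<bar> = 0"
    proof (rule lob_eqI)
      fix x :: 'a assume x: "0 \<le> x"
      have "lob_apply \<bar>T\<bar> x \<in> U" if "U \<in> \<U>" for U
        using *[OF abs_strongI[OF that x]] by simp
      then show "lob_apply \<bar>T\<bar> x = lob_apply 0 x"
        using separated by simp
    qed
    then show "T = 0"
      by simp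
  qed
qed


section \<open>Orthomorphisms\<close>

lemma abs_add_disj:
  fixes a b :: "'a::vector_lattice"
  assumes "lat_disjoint a b"
  shows "\<bar>a + b\<bar> = \<bar>a\<bar> + \<bar>b\<bar>"
proof (rule order.antisym[OF abs_triangle_ineq])
  have "inf \<bar>a + b\<bar> \<bar>a\<bar> = \<bar>a\<bar>"
    using inf_abs_add_disj[of b "\<bar>a\<bar>" a] assms by (simp add: lat_disjoint_def inf_commute)
  moreover have "inf \<bar>a + b\<bar> \<bar>b\<bar> = \<bar>b\<bar>"
    using inf_abs_add_disj[of a "\<bar>b\<bar>" b] assms by (simp add: lat_disjoint_def add.commute)
  ultimately have "sup \<bar>a\<bar> \<bar>b\<bar> \<le> \<bar>a + b\<bar>"
    by (metis inf.cobounded1 le_sup_iff)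
  moreover have "\<bar>a\<bar> + \<bar>b\<bar> = sup \<bar>a\<bar> \<bar>b\<bar>"
    using add_eq_inf_sup[of "\<bar>a\<bar>" "\<bar>b\<bar>"] assms by (simp add: lat_disjoint_def)
  ultimately show "\<bar>a\<bar> + \<bar>b\<bar> \<le> \<bar>a + b\<bar>"
    by simp
qed

lemma inf_add_pprt: "inf x y + pprt (x - y) = x" for x y :: "'a::vector_lattice"
proof -
  have "x - pprt (x - y) = x + inf (y - x) 0"
    by (simp add: pprt_def diff_sup_eq_inf)
  also have "\<dots> = inf x y"
    by (simp add: add_inf_distrib_left inf_commute)
  finally show ?thesis
    by (simp add: algebra_simps)
qed

lemma abs_diff_eq_abs_add_disj:
  fixes a b :: "'a::vector_lattice"
  assumes "lat_disjoint a b"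
  shows "\<bar>a - b\<bar> = \<bar>a + b\<bar>"
  using abs_add_disj[OF assms] abs_add_disj[of a "- b"] assms by simp


subsection \<open>Bands and disjointness\<close>

lemma bandD:
  assumes "band B"
  shows "subspace B" "solid B" "\<And>S s. S \<subseteq> B \<Longrightarrow> is_supremum S s \<Longrightarrow> s \<in> B"
  using assms unfolding band_def by blast+

lemma band_solidD: "band B \<Longrightarrow> y \<in> B \<Longrightarrow> \<bar>x\<bar> \<le> \<bar>y\<bar> \<Longrightarrow> x \<in> B"
  using bandD(2) unfolding solid_def by blast

text \<open>
  Closure under suprema: for \<open>d = s\<^sup>+ \<and> \<bar>y\<bar>\<close> and \<open>x\<close> in the set, \<open>x\<^sup>+\<close> is disjoint from \<open>d\<close>,
  so \<open>x\<^sup>+ + d = x\<^sup>+ \<or> d \<le> s\<^sup>+\<close>. Hence \<open>s - d\<close> is an upper bound too and \<open>d = 0\<close>. The negative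
  part of \<open>s\<close> is dominated by that of any member of the set; if the set is empty, \<open>s\<close> is a least
  element and the space is trivial.
\<close>

lemma band_disjoint_complement: "band {x. lat_disjoint x y}"
  unfolding band_def
proof (intro conjI allI impI)
  show "subspace {x. lat_disjoint x y}"
    unfolding subspace_def by (auto intro: lat_disjoint_add lat_disjoint_scaleR)
  show "solid {x. lat_disjoint x y}"
    unfolding solid_def by (auto intro: lat_disjoint_mono)
  fix S s assume S: "S \<subseteq> {x. lat_disjoint x y} \<and> is_supremum S s"
  define d where "d = inf (pprt s) \<bar>y\<bar>"
  have d: "0 \<le> d" "d \<le> pprt s" "d \<le> \<bar>y\<bar>"
    by (simp_all add: d_def)
  have bound: "x \<le> s - d" if "x \<in> S" for x
  proof -
    have x: "x \<le> s" "lat_disjoint x y"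
      using S that by (auto simp: is_supremum_def)
    have "lat_disjoint (pprt x) d"
      by (rule lat_disjoint_mono[OF x(2)]) (use d in \<open>simp_all add: pprt_le_abs\<close>)
    then have "pprt x + d = sup (pprt x) d"
      using add_eq_inf_sup[of "pprt x" d] d(1) by (simp add: lat_disjoint_def)
    also have "\<dots> \<le> pprt s"
      using d x by simp
    finally have "pprt x + d \<le> pprt s" .
    moreover have "pprt (- s) \<le> pprt (- x)"
      using x by simp
    ultimately have "pprt x + d - pprt (- x) \<le> pprt s - pprt (- s)"
      by (rule diff_mono)
    then have "x + d \<le> s"
      by (metis add_diff_eq diff_add_eq add.commute pprt_minus_pprt)
    then show ?thesis
      by (simp add: le_diff_eq)
  qed
  then have "s \<le> s - d"
    using S unfolding is_supremum_def by blast
  then have "d = 0"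
    using d(1) by (simp add: order.antisym)
  then have pos: "lat_disjoint (pprt s) y"
    by (simp add: lat_disjoint_def d_def)
  have "lat_disjoint (pprt (- s)) y"
  proof (cases "S = {}")
    case True
    then have "s \<le> s - \<bar>y\<bar>"
      using S unfolding is_supremum_def by blast
    then have "y = 0"
      by (simp add: order.antisym)
    then show ?thesis
      by simp
  next
    case False
    then obtain x where x: "x \<in> S"
      by blast
    then have xs: "x \<le> s" "lat_disjoint x y"
      using S by (auto simp: is_supremum_def)
    have "pprt (- s) \<le> pprt (- x)"
      using xs(1) by simp
    also have "\<dots> \<le> \<bar>x\<bar>"
      using pprt_le_abs[of "- x"] by simp
    finally have "\<bar>pprt (- s)\<bar> \<le> \<bar>x\<bar>"
      by simp
    then show ?thesis
      by (rule lat_disjoint_mono[OF xs(2)]) simp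
  qed
  with pos have "lat_disjoint (pprt s + - pprt (- s)) y"
    by (intro lat_disjoint_add) simp_all
  then show "s \<in> {x. lat_disjoint x y}"
    using pprt_minus_pprt[of s] by simp
qed

lemma band_pprt:
  assumes "band B" "x \<in> B"
  shows "pprt x \<in> B" "pprt (- x) \<in> B"
  using band_solidD[OF assms, of "pprt x"] band_solidD[OF assms, of "pprt (- x)"]
    pprt_le_abs[of x] pprt_le_abs[of "- x"] by simp_all

text \<open>
  Dedekind completeness provides the largest \<open>p\<close> in \<open>B\<close> below \<open>\<bar>x\<bar>\<close>, and \<open>\<bar>x\<bar> - p\<close> is
  disjoint from \<open>B\<close>. Being disjoint from itself as well, it is zero.
\<close>

lemma band_double_complement:
  fixes B :: "'a::dedekind_complete_vector_lattice set"
  assumes B: "band B" and x: "\<And>w. (\<And>b. b \<in> B \<Longrightarrow> lat_disjoint b w) \<Longrightarrow> lat_disjoint x w"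
  shows "x \<in> B"
proof -
  let ?S = "B \<inter> {0..\<bar>x\<bar>}"
  define p where "p = Sup ?S"
  have zero: "0 \<in> ?S"
    using subspace_0[OF bandD(1)[OF B]] by simp
  have p: "is_supremum ?S p"
    unfolding p_def using zero by (intro is_supremum_cSup bdd_aboveI[of _ "\<bar>x\<bar>"]) auto
  then have p_B: "p \<in> B"
    using bandD(3)[OF B, of ?S p] by blast
  have p_le: "0 \<le> p" "p \<le> \<bar>x\<bar>"
    using p zero unfolding is_supremum_def by auto
  define r where "r = \<bar>x\<bar> - p"
  have r: "0 \<le> r" "r \<le> \<bar>x\<bar>"
    using p_le by (simp_all add: r_def)
  have "lat_disjoint b r" if "b \<in> B" for b
  proof -
    define i where "i = inf \<bar>b\<bar> r"
    have i: "0 \<le> i" "i \<le> r" "i \<in> B"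
      using r band_solidD[OF B that, of i] by (auto simp: i_def)
    then have "i + p \<in> ?S"
      using p_le p_B subspace_add[OF bandD(1)[OF B]] by (auto simp: r_def le_diff_eq)
    then have "i + p \<le> p"
      using p unfolding is_supremum_def by blast
    then have "i = 0"
      using i by (simp add: order.antisym)
    then show ?thesis
      using r by (simp add: lat_disjoint_def i_def)
  qed
  then have "lat_disjoint x r"
    by (rule x)
  then have "lat_disjoint r r"
    by (rule lat_disjoint_mono) (use r in auto)
  then have "\<bar>x\<bar> = p"
    using lat_disjoint_self unfolding r_def by fastforce
  then show ?thesis
    using band_solidD[OF B p_B, of x] p_le by simp
qed


subsection \<open>Elementary properties of orthomorphisms\<close>

lemma OrthD: "T \<in> Orth \<Longrightarrow> band B \<Longrightarrow> x \<in> B \<Longrightarrow> lob_apply T x \<in> B"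
  unfolding Orth_def by blast

lemma Orth_disj: "T \<in> Orth \<Longrightarrow> lat_disjoint x y \<Longrightarrow> lat_disjoint (lob_apply T x) y"
  using OrthD[OF _ band_disjoint_complement, of T x y] by simp

lemma OrthI:
  fixes T :: "'a::vector_lattice lob"
  assumes "\<And>B x. band B \<Longrightarrow> x \<in> B \<Longrightarrow> 0 \<le> x \<Longrightarrow> lob_apply T x \<in> B"
  shows "T \<in> Orth"
  unfolding Orth_def
proof (intro CollectI allI impI image_subsetI)
  fix B :: "'a set" and x assume B: "band B" and x: "x \<in> B"
  have "lob_apply T (pprt x) - lob_apply T (pprt (- x)) \<in> B"
    using assms[OF B band_pprt(1)[OF B x]] assms[OF B band_pprt(2)[OF B x]]
    by (intro subspace_diff[OF bandD(1)[OF B]]) simp_all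
  then show "lob_apply T x \<in> B"
    by (simp only: pprt_minus_pprt flip: linear_diff[OF linear_lob])
qed

lemma subspace_Orth: "subspace Orth"
  unfolding subspace_def
proof (intro conjI ballI allI)
  show "0 \<in> Orth"
    by (rule OrthI) (simp add: subspace_0 bandD(1))
  show "S + T \<in> Orth" if "S \<in> Orth" "T \<in> Orth" for S T
    by (rule OrthI) (simp add: subspace_add[OF bandD(1)] OrthD[OF that(1)] OrthD[OF that(2)])
  show "c *\<^sub>R T \<in> Orth" if "T \<in> Orth" for c T
    by (rule OrthI) (simp add: subspace_scale[OF bandD(1)] OrthD[OF that])
qed

lemmas Orth_add = subspace_add[OF subspace_Orth]
  and Orth_diff = subspace_diff[OF subspace_Orth]
  and Orth_uminus = subspace_neg[OF subspace_Orth]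
  and Orth_scaleR = subspace_scale[OF subspace_Orth]

lemma Orth_mult: "S \<in> Orth \<Longrightarrow> T \<in> Orth \<Longrightarrow> S * T \<in> Orth"
  by (rule OrthI) (simp add: OrthD)

lemma lob_pos_apply:
  fixes T :: "'a::dedekind_complete_vector_lattice lob"
  assumes "0 \<le> x"
  shows "is_supremum (lob_apply T ` {0..x}) (lob_apply (lob_pos T) x)"
  unfolding lob_pos.rep_eq pos_fun_cone[OF linear_lob order_bounded_lob assms] is_supremum_def
  using cone_pos_upper[OF linear_lob order_bounded_lob, of _ x T]
    cone_pos_least[OF linear_lob order_bounded_lob assms, of T] by auto

lemma pprt_lob: "pprt T = lob_pos T" for T :: "'a::dedekind_complete_vector_lattice lob"
  by (simp add: pprt_def sup_lob_def)

text \<open>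
  By the Riesz--Kantorovich formula \<open>T\<^sup>+ x\<close> is a supremum of elements \<open>T y\<close> with \<open>0 \<le> y \<le> x\<close>,
  all of which stay in every band that contains \<open>x\<close>.
\<close>

lemma Orth_pprt:
  fixes T :: "'a::dedekind_complete_vector_lattice lob"
  assumes "T \<in> Orth"
  shows "pprt T \<in> Orth"
proof (rule OrthI)
  fix B :: "'a set" and x assume B: "band B" "x \<in> B" "0 \<le> x"
  have "lob_apply T y \<in> B" if "y \<in> {0..x}" for y
    using that B by (intro OrthD[OF assms B(1)] band_solidD[OF B(1,2)]) auto
  then show "lob_apply (pprt T) x \<in> B"
    unfolding pprt_lob using bandD(3)[OF B(1) _ lob_pos_apply[OF B(3)]] by blast
qed

lemma Orth_abs: "T \<in> Orth \<Longrightarrow> \<bar>T\<bar> \<in> Orth" for T :: "'a::dedekind_complete_vector_lattice lob"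
  unfolding abs_eq_pprt_add by (intro Orth_add Orth_pprt Orth_uminus)

lemma Orth_solid:
  fixes S T :: "'a::dedekind_complete_vector_lattice lob"
  assumes "T \<in> Orth" "\<bar>S\<bar> \<le> \<bar>T\<bar>"
  shows "S \<in> Orth"
proof (rule OrthI)
  fix B :: "'a set" and x assume B: "band B" "x \<in> B" "0 \<le> x"
  have "\<bar>lob_apply S x\<bar> \<le> lob_apply \<bar>S\<bar> x"
    using lob_abs_apply_le[of S x] B(3) by simp
  also have "\<dots> \<le> lob_apply \<bar>T\<bar> x"
    by (rule lob_apply_mono_op[OF assms(2) B(3)])
  finally show "lob_apply S x \<in> B"
    using band_solidD[OF B(1) OrthD[OF Orth_abs[OF assms(1)] B(1,2)]]
      lob_abs_apply_nonneg[OF B(3), of T] by simp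
qed

lift_definition id_lob :: "'a::vector_lattice lob" is "\<lambda>x. x"
  by (auto intro!: order_boundedI simp: linear_iff)

lemma id_lob_apply [simp]: "lob_apply id_lob x = x"
  by (rule id_lob.rep_eq[THEN fun_cong])

lemma id_lob_Orth: "id_lob \<in> Orth"
  by (rule OrthI) simp

lemma id_lob_nonneg: "0 \<le> id_lob"
  by (simp add: lob_le_iff)

lemma mult_id_lob [simp]: "T * id_lob = T" "id_lob * T = T"
  by (rule lob_eqI, simp)+


subsection \<open>Pointwise description of the lattice operations\<close>

text \<open>
  One half of the Riesz--Kantorovich formula
  \<open>(R \<and> S)x = inf {R y + S (x - y) | 0 \<le> y \<le> x}\<close>.
\<close>

lemma inf_lob_apply_ge:
  fixes R S :: "'a::dedekind_complete_vector_lattice lob"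
  assumes x: "0 \<le> x" and u: "\<And>y. 0 \<le> y \<Longrightarrow> y \<le> x \<Longrightarrow> u \<le> lob_apply R y + lob_apply S (x - y)"
  shows "u \<le> lob_apply (inf R S) x"
proof -
  have "inf R S = S - lob_pos (S - R)"
    by (simp add: inf_lob_def sup_lob_def)
  moreover have "lob_apply (lob_pos (S - R)) x \<le> lob_apply S x - u"
  proof -
    have "lob_apply (S - R) y \<le> lob_apply S x - u" if "y \<in> {0..x}" for y
      using u[of y] that by (simp add: linear_diff[OF linear_lob] algebra_simps)
    then show ?thesis
      using lob_pos_apply[OF x, of "S - R"] unfolding is_supremum_def by blast
  qed
  ultimately show ?thesis
    by (simp add: le_diff_eq add.commute)
qed

lemma inf_lob_apply_le:
  fixes R S :: "'a::dedekind_complete_vector_lattice lob"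
  shows "0 \<le> x \<Longrightarrow> lob_apply (inf R S) x \<le> inf (lob_apply R x) (lob_apply S x)"
  by (simp add: lob_apply_mono_op)

text \<open>
  For \<open>0 \<le> y \<le> x\<close> let \<open>c\<close> and \<open>d\<close> be the positive and negative parts of \<open>2y - x\<close>. They are
  disjoint and at most \<open>x\<close>, and \<open>2y = x + c - d\<close>, so \<open>2(Ry + S(x - y))\<close> is at least
  \<open>e = R(x - d) + S(x - c)\<close>. Moreover \<open>Rx \<le> e + Rd\<close> and \<open>Sx \<le> e + Sc\<close>, where \<open>Rd\<close> and
  \<open>Sc\<close> are disjoint because \<open>c\<close> and \<open>d\<close> are. Hence \<open>Rx \<and> Sx \<le> e\<close>. This replaces a splitting of
  \<open>x\<close> by band projections; it costs the factor 2, which is harmless here.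
\<close>

lemma inf_apply_Orth_le:
  fixes R S :: "'a::dedekind_complete_vector_lattice lob"
  assumes R: "R \<in> Orth" "0 \<le> R" and S: "S \<in> Orth" "0 \<le> S" and x: "0 \<le> x"
  shows "inf (lob_apply R x) (lob_apply S x) \<le> 2 *\<^sub>R lob_apply (inf R S) x"
proof -
  let ?a = "inf (lob_apply R x) (lob_apply S x)"
  have "inverse 2 *\<^sub>R ?a \<le> lob_apply (inf R S) x"
  proof (rule inf_lob_apply_ge[OF x])
    fix y assume y: "0 \<le> y" "y \<le> x"
    define c where "c = pprt (y + y - x)"
    define d where "d = pprt (- (y + y - x))"
    have cd: "0 \<le> c" "0 \<le> d" "c - d = y + y - x"
      by (simp_all add: c_def d_def pprt_minus_pprt del: minus_diff_eq)
    have "y + y \<le> x + x"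
      using y by (intro add_mono)
    then have "c \<le> x"
      unfolding c_def using x by (intro pprt_leI) (simp_all add: diff_le_eq)
    have "d \<le> x"
      unfolding d_def using x y by (intro pprt_leI) (simp_all add: diff_le_eq add_increasing)
    have "lat_disjoint c d"
      unfolding lat_disjoint_def c_def d_def by (simp only: abs_of_nonneg zero_le_pprt inf_pprt_pprt_uminus)
    then have "lat_disjoint (lob_apply R d) (lob_apply S c)"
      by (intro Orth_disj[OF R(1)] lat_disjoint_sym[OF Orth_disj[OF S(1)]])
    then have lat_disjoint: "inf (lob_apply R d) (lob_apply S c) = 0"
      using lob_apply_nonneg[OF R(2) cd(2)] lob_apply_nonneg[OF S(2) cd(1)] by (simp add: lat_disjoint_def)
    define e where "e = lob_apply R (x - d) + lob_apply S (x - c)"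
    have nonneg: "0 \<le> lob_apply R (x - d)" "0 \<le> lob_apply S (x - c)"
      using \<open>c \<le> x\<close> \<open>d \<le> x\<close> R(2) S(2) by (simp_all add: lob_apply_nonneg)
    have "lob_apply R x \<le> e + lob_apply R d" "lob_apply S x \<le> e + lob_apply S c"
      using nonneg unfolding e_def by (simp_all add: linear_diff[OF linear_lob])
    then have "?a \<le> inf (e + lob_apply R d) (e + lob_apply S c)"
      by (rule inf_mono)
    also have "\<dots> = e"
      by (simp only: lat_disjoint add_0_right flip: add_inf_distrib_left)
    also have "e \<le> e + (lob_apply R c + lob_apply S d)"
      using R(2) S(2) cd by (simp add: lob_apply_nonneg)
    also have "\<dots> = lob_apply R (x + (c - d)) + lob_apply S (x - (c - d))"
      unfolding e_def by (simp add: linear_diff[OF linear_lob] linear_add[OF linear_lob] algebra_simps)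
    also have "\<dots> = 2 *\<^sub>R (lob_apply R y + lob_apply S (x - y))"
      unfolding cd(3)
      by (simp add: linear_diff[OF linear_lob] linear_add[OF linear_lob] algebra_simps scaleR_2)
    finally have "inverse 2 *\<^sub>R ?a \<le> inverse 2 *\<^sub>R (2 *\<^sub>R (lob_apply R y + lob_apply S (x - y)))"
      by (intro scaleR_left_mono) auto
    then show "inverse 2 *\<^sub>R ?a \<le> lob_apply R y + lob_apply S (x - y)"
      by simp
  qed
  then have "2 *\<^sub>R (inverse 2 *\<^sub>R ?a) \<le> 2 *\<^sub>R lob_apply (inf R S) x"
    by (intro scaleR_left_mono) auto
  then show ?thesis
    by simp
qed

lemma lat_disjoint_lob_iff:
  fixes A B :: "'a::dedekind_complete_vector_lattice lob"
  assumes "A \<in> Orth" "0 \<le> A" "B \<in> Orth" "0 \<le> B"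
  shows "lat_disjoint A B \<longleftrightarrow> (\<forall>x\<ge>0. lat_disjoint (lob_apply A x) (lob_apply B x))"
proof
  assume "lat_disjoint A B"
  then have "inf A B = 0"
    using assms by (simp add: lat_disjoint_nonneg)
  then show "\<forall>x\<ge>0. lat_disjoint (lob_apply A x) (lob_apply B x)"
    using inf_apply_Orth_le[OF assms] by (simp add: lat_disjoint_nonneg assms lob_apply_nonneg order.antisym)
next
  assume *: "\<forall>x\<ge>0. lat_disjoint (lob_apply A x) (lob_apply B x)"
  have "inf A B \<le> 0"
    unfolding lob_le_iff
    using * inf_lob_apply_le[of _ A B] by (simp add: lat_disjoint_nonneg assms lob_apply_nonneg)
  then show "lat_disjoint A B"
    using assms by (simp add: lat_disjoint_nonneg order.antisym)
qed

text \<open>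
  The positive and negative parts of \<open>T\<close> are disjoint orthomorphisms, so they remain disjoint when
  evaluated at \<open>x\<close>.
\<close>

lemma abs_apply_Orth:
  fixes T :: "'a::dedekind_complete_vector_lattice lob"
  assumes T: "T \<in> Orth" and x: "0 \<le> x"
  shows "lob_apply \<bar>T\<bar> x = \<bar>lob_apply T x\<bar>"
proof -
  let ?p = "lob_apply (pprt T) x" and ?n = "lob_apply (pprt (- T)) x"
  have "lat_disjoint (pprt T) (pprt (- T))"
    by (simp only: lat_disjoint_nonneg zero_le_pprt inf_pprt_pprt_uminus)
  then have "lat_disjoint ?p ?n"
    using x lat_disjoint_lob_iff[OF Orth_pprt[OF T] zero_le_pprt Orth_pprt[OF Orth_uminus[OF T]] zero_le_pprt]
    by blast
  then have "\<bar>?p - ?n\<bar> = \<bar>?p\<bar> + \<bar>?n\<bar>"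
    using abs_diff_eq_abs_add_disj abs_add_disj by metis
  also have "\<dots> = ?p + ?n"
    using x by (simp add: lob_apply_nonneg)
  also have "\<dots> = lob_apply \<bar>T\<bar> x"
    by (simp add: abs_eq_pprt_add)
  finally show ?thesis
    using pprt_minus_pprt[of T] by (metis minus_lob.rep_eq)
qed

text \<open>
  For \<open>A * T\<close> the operators \<open>A\<close> and \<open>B\<close> are evaluated at \<open>x + Tx\<close>: their values there are
  disjoint, and they dominate \<open>ATx\<close> and \<open>Bx\<close>, respectively.
\<close>

lemma lat_disjoint_mult:
  fixes A B T :: "'a::dedekind_complete_vector_lattice lob"
  assumes A: "A \<in> Orth" "0 \<le> A" and B: "B \<in> Orth" "0 \<le> B" and T: "T \<in> Orth" "0 \<le> T"
    and lat_disjoint: "lat_disjoint A B"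
  shows "0 \<le> T * A" "0 \<le> A * T" "lat_disjoint (T * A) B" "lat_disjoint (A * T) B"
proof -
  show TA: "0 \<le> T * A" and AT: "0 \<le> A * T"
    unfolding lob_le_iff by (simp_all add: lob_apply_nonneg A T)
  have pt: "lat_disjoint (lob_apply A x) (lob_apply B x)" if "0 \<le> x" for x
    using lat_disjoint lat_disjoint_lob_iff[OF A B] that by blast
  show "lat_disjoint (T * A) B"
    unfolding lat_disjoint_lob_iff[OF Orth_mult[OF T(1) A(1)] TA B] using pt Orth_disj[OF T(1)] by simp
  show "lat_disjoint (A * T) B"
    unfolding lat_disjoint_lob_iff[OF Orth_mult[OF A(1) T(1)] AT B]
  proof (intro allI impI)
    fix x :: 'a assume x: "0 \<le> x"
    have Tx: "0 \<le> lob_apply T x"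
      using x T by (simp add: lob_apply_nonneg)
    show "lat_disjoint (lob_apply (A * T) x) (lob_apply B x)"
    proof (rule lat_disjoint_mono[OF pt[of "x + lob_apply T x"]])
      show "\<bar>lob_apply (A * T) x\<bar> \<le> \<bar>lob_apply A (x + lob_apply T x)\<bar>"
        using x Tx A(2) by (simp add: linear_add[OF linear_lob] lob_apply_nonneg)
      show "\<bar>lob_apply B x\<bar> \<le> \<bar>lob_apply B (x + lob_apply T x)\<bar>"
        using x Tx B(2) by (simp add: linear_add[OF linear_lob] lob_apply_nonneg)
    qed (use x Tx in simp)
  qed
qed


subsection \<open>Orthomorphisms commute\<close>

context
  fixes T :: "'a::dedekind_complete_vector_lattice lob"
  assumes T: "T \<in> Orth" "0 \<le> T"
begin

text \<open>
  The tent map \<open>S \<mapsto> \<bar>2S - I\<bar>\<close> doubles commutators in absolute value. Indeed the commutator with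
  \<open>2S - I\<close> is twice that with \<open>S\<close>, and the commutators with the two disjoint parts of \<open>2S - I\<close>
  are disjoint, so that it does not matter whether they are subtracted or added.
\<close>

lemma commutator_tent:
  assumes S: "S \<in> Orth" "0 \<le> S" "S \<le> id_lob"
  defines "S' \<equiv> \<bar>S + S - id_lob\<bar>"
  shows "S' \<in> Orth" "0 \<le> S'" "S' \<le> id_lob"
    "2 *\<^sub>R \<bar>T * S - S * T\<bar> = \<bar>T * S' - S' * T\<bar>"
proof -
  define c where "c = pprt (S + S - id_lob)"
  define d where "d = pprt (- (S + S - id_lob))"
  have orth: "S + S - id_lob \<in> Orth"
    by (intro Orth_diff Orth_add S id_lob_Orth)
  then show "S' \<in> Orth"
    unfolding S'_def by (rule Orth_abs)
  show "0 \<le> S'"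
    by (simp add: S'_def)
  show "S' \<le> id_lob"
    unfolding S'_def
  proof (rule abs_leI)
    show "S + S - id_lob \<le> id_lob"
      using S(3) by (simp add: diff_le_eq add_mono)
    show "- (S + S - id_lob) \<le> id_lob"
      using add_nonneg_nonneg[OF S(2) S(2)]
      by (simp only: minus_diff_eq) (simp only: diff_le_eq le_add_same_cancel1)
  qed
  have c: "c \<in> Orth" "0 \<le> c" and d: "d \<in> Orth" "0 \<le> d"
    unfolding c_def d_def by (intro Orth_pprt Orth_uminus orth zero_le_pprt)+
  have cd: "lat_disjoint c d"
    unfolding c_def d_def by (simp only: lat_disjoint_nonneg zero_le_pprt inf_pprt_pprt_uminus)
  have "lat_disjoint (T * c - c * T) d"
    using lat_disjoint_mult[OF c d T cd] lat_disjoint_add[of "T * c" d "- (c * T)"] by simp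
  then have "lat_disjoint d \<bar>T * c - c * T\<bar>"
    by (simp add: lat_disjoint_def inf_commute)
  moreover have "\<bar>T * c - c * T\<bar> \<in> Orth"
    by (intro Orth_abs Orth_diff Orth_mult T c)
  ultimately have "lat_disjoint (T * d - d * T) \<bar>T * c - c * T\<bar>"
    using lat_disjoint_mult[OF d _ _ T, of "\<bar>T * c - c * T\<bar>"] lat_disjoint_add[of "T * d" _ "- (d * T)"] by simp
  then have "lat_disjoint (T * c - c * T) (T * d - d * T)"
    by (simp add: lat_disjoint_def inf_commute)
  then have "\<bar>(T * c - c * T) - (T * d - d * T)\<bar> = \<bar>(T * c - c * T) + (T * d - d * T)\<bar>"
    by (rule abs_diff_eq_abs_add_disj)
  also have "(T * c - c * T) + (T * d - d * T) = T * (c + d) - (c + d) * T"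
    by (simp add: algebra_simps)
  also have "c + d = S'"
    unfolding c_def d_def S'_def by (simp only: abs_eq_pprt_add)
  also have "(T * c - c * T) - (T * d - d * T) = T * (c - d) - (c - d) * T"
    by (simp add: algebra_simps)
  also have "c - d = S + S - id_lob"
    unfolding c_def d_def by (rule pprt_minus_pprt)
  also have "T * (S + S - id_lob) - (S + S - id_lob) * T = 2 *\<^sub>R (T * S - S * T)"
    by (simp add: algebra_simps scaleR_2)
  finally show "2 *\<^sub>R \<bar>T * S - S * T\<bar> = \<bar>T * S' - S' * T\<bar>"
    by (simp add: abs_scaleR_lattice)
qed

text \<open>
  The interval from \<open>0\<close> to \<open>I\<close> is invariant under the tent map, and there commutators with \<open>T\<close>
  are bounded by \<open>2T\<close>. Hence a commutator stays below \<open>2T\<close> after any number of doublings.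
\<close>

lemma commutator_bound:
  assumes "S \<in> Orth" "0 \<le> S" "S \<le> id_lob"
  shows "(2 ^ n) *\<^sub>R \<bar>T * S - S * T\<bar> \<le> T + T"
  using assms
proof (induction n arbitrary: S)
  case 0
  have "T * S \<le> T"
    unfolding lob_le_iff
    using lob_apply_mono[OF T(2)] lob_apply_mono_op[OF 0(3)] by simp
  moreover have "S * T \<le> T"
    unfolding lob_le_iff
    using lob_apply_mono_op[OF 0(3)] lob_apply_nonneg[OF T(2)] by simp
  moreover have "0 \<le> T * S" "0 \<le> S * T"
    unfolding lob_le_iff by (simp_all add: lob_apply_nonneg T 0)
  ultimately have "\<bar>T * S - S * T\<bar> \<le> T + T"
    using abs_triangle_ineq4[of "T * S" "S * T"] by (simp add: order_trans[OF _ add_mono])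
  then show ?case
    by simp
next
  case (Suc n)
  have "(2 ^ Suc n) *\<^sub>R \<bar>T * S - S * T\<bar> = (2 ^ n) *\<^sub>R (2 *\<^sub>R \<bar>T * S - S * T\<bar>)"
    by (simp add: mult.commute)
  then show ?case
    using Suc.IH[OF commutator_tent(1-3)[OF Suc.prems]] commutator_tent(4)[OF Suc.prems] by simp
qed

lemma commute_below_id:
  assumes "S \<in> Orth" "0 \<le> S" "S \<le> id_lob"
  shows "T * S = S * T"
proof -
  have "real (Suc n) *\<^sub>R \<bar>T * S - S * T\<bar> \<le> T + T" for n
  proof -
    have "Suc n \<le> 2 ^ n"
      by (induction n) auto
    then have "real (Suc n) \<le> 2 ^ n"
      by (metis of_nat_le_iff of_nat_numeral of_nat_power)
    then have "real (Suc n) *\<^sub>R \<bar>T * S - S * T\<bar> \<le> (2 ^ n) *\<^sub>R \<bar>T * S - S * T\<bar>"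
      by (intro scaleR_right_mono) auto
    also have "\<dots> \<le> T + T"
      by (rule commutator_bound[OF assms])
    finally show ?thesis .
  qed
  then have "\<bar>T * S - S * T\<bar> \<le> 0"
    by (rule archimedean_le_0)
  then show ?thesis
    by simp
qed

text \<open>
  The truncation \<open>S \<and> rI\<close> commutes with \<open>T\<close>, so the commutator of \<open>S\<close> and \<open>T\<close> is that of \<open>T\<close> with
  \<open>(S - rI)\<^sup>+\<close> and is disjoint from \<open>(rI - S)\<^sup>+ \<ge> rI - S\<close>. Letting \<open>r\<close> grow, its absolute
  value \<open>D\<close> becomes disjoint from \<open>I\<close>. Since \<open>Dx\<close> lies in the band generated by \<open>x\<close>, \<open>D = 0\<close>.
\<close>

lemma commute_nonneg:
  assumes S: "S \<in> Orth" "0 \<le> S"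
  shows "T * S = S * T"
proof -
  define D where "D = \<bar>T * S - S * T\<bar>"
  have D: "D \<in> Orth" "0 \<le> D"
    unfolding D_def by (simp_all add: Orth_abs Orth_diff Orth_mult T S)
  have "inf D id_lob \<le> inverse (real (Suc n)) *\<^sub>R S" for n
  proof -
    define r where "r = real (Suc n)"
    have r: "0 < r"
      by (simp add: r_def)
    define A where "A = pprt (S - r *\<^sub>R id_lob)"
    define B where "B = pprt (- (S - r *\<^sub>R id_lob))"
    define M where "M = inverse r *\<^sub>R inf S (r *\<^sub>R id_lob)"
    have rI: "0 \<le> r *\<^sub>R id_lob"
      using r by (intro scaleR_nonneg_nonneg id_lob_nonneg) simp
    have "0 \<le> M"
      unfolding M_def using r S rI by (intro scaleR_nonneg_nonneg) simp_all
    have "inverse r *\<^sub>R inf S (r *\<^sub>R id_lob) \<le> inverse r *\<^sub>R (r *\<^sub>R id_lob)"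
      using r by (intro scaleR_left_mono) simp_all
    then have "M \<le> id_lob"
      using r by (simp add: M_def)
    have "0 \<le> inf S (r *\<^sub>R id_lob)"
      by (rule le_infI[OF S(2) rI])
    then have "inf S (r *\<^sub>R id_lob) \<in> Orth"
      by (intro Orth_solid[OF S(1)]) (simp only: abs_of_nonneg S(2) inf_le1)
    then have "M \<in> Orth"
      unfolding M_def by (rule Orth_scaleR)
    have "inf S (r *\<^sub>R id_lob) + pprt (S - r *\<^sub>R id_lob) = S"
      by (rule inf_add_pprt)
    then have S_eq: "S = r *\<^sub>R M + A"
      using r by (simp add: M_def A_def)
    have "T * S - S * T = T * A - A * T"
      unfolding S_eq using commute_below_id[OF \<open>M \<in> Orth\<close> \<open>0 \<le> M\<close> \<open>M \<le> id_lob\<close>]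
      by (simp add: algebra_simps)
    have orth: "S - r *\<^sub>R id_lob \<in> Orth"
      by (intro Orth_diff Orth_scaleR S id_lob_Orth)
    have A: "A \<in> Orth" "0 \<le> A" and B: "B \<in> Orth" "0 \<le> B"
      unfolding A_def B_def by (intro Orth_pprt Orth_uminus orth zero_le_pprt)+
    have "lat_disjoint A B"
      unfolding A_def B_def by (simp only: lat_disjoint_nonneg zero_le_pprt inf_pprt_pprt_uminus)
    then have "lat_disjoint (T * A - A * T) B"
      using lat_disjoint_mult[OF A B T] lat_disjoint_add[of "T * A" B "- (A * T)"] by simp
    then have "lat_disjoint D B"
      unfolding D_def \<open>T * S - S * T = T * A - A * T\<close> by (simp add: lat_disjoint_def)
    then have "lat_disjoint (inverse r *\<^sub>R B) D"
      by (rule lat_disjoint_scaleR[OF lat_disjoint_sym])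
    then have 1: "inf D (inverse r *\<^sub>R B) = 0"
      using D B r by (simp add: lat_disjoint_nonneg scaleR_nonneg_nonneg inf_commute)
    have "r *\<^sub>R id_lob \<le> B + S"
      unfolding B_def using pprt_ge[of "- (S - r *\<^sub>R id_lob)"] by (simp add: algebra_simps)
    then have "inverse r *\<^sub>R (r *\<^sub>R id_lob) \<le> inverse r *\<^sub>R (B + S)"
      using r by (intro scaleR_left_mono) simp_all
    then have "id_lob \<le> inverse r *\<^sub>R B + inverse r *\<^sub>R S"
      using r by (simp add: scaleR_right_distrib)
    then have "inf D id_lob \<le> inf (inverse r *\<^sub>R B + inverse r *\<^sub>R S) D"
      by (simp add: le_infI2)
    also have "\<dots> \<le> inf (inverse r *\<^sub>R B) D + inf (inverse r *\<^sub>R S) D"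
      using r B S D by (intro inf_add_le scaleR_nonneg_nonneg) simp_all
    also have "\<dots> \<le> inverse r *\<^sub>R S"
      using 1 by (simp add: inf_commute)
    finally show ?thesis
      unfolding r_def .
  qed
  then have "inf D id_lob \<le> 0"
    by (rule archimedean_inverse_le_0)
  then have "inf D id_lob = 0"
    by (rule order.antisym) (simp add: D id_lob_nonneg)
  then have "lat_disjoint D id_lob"
    by (simp only: lat_disjoint_nonneg D id_lob_nonneg)
  then have "lat_disjoint (lob_apply D x) x" if "0 \<le> x" for x
    using lat_disjoint_lob_iff[OF D id_lob_Orth id_lob_nonneg] that by simp
  then have "lob_apply D x = 0" if "0 \<le> x" for x
    using that Orth_disj[OF D(1)] lat_disjoint_sym lat_disjoint_self by blast
  then have "D = 0"
    by (intro lob_eqI) simp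
  then show ?thesis
    by (simp add: D_def)
qed

end

theorem Orth_commute:
  fixes S T :: "'a::dedekind_complete_vector_lattice lob"
  assumes "S \<in> Orth" "T \<in> Orth"
  shows "S * T = T * S"
proof -
  have "pprt S' * pprt T' = pprt T' * pprt S'" if "S' \<in> Orth" "T' \<in> Orth" for S' T' :: "'a lob"
    using that by (intro commute_nonneg Orth_pprt zero_le_pprt)
  then have "(pprt S - pprt (- S)) * (pprt T - pprt (- T)) = (pprt T - pprt (- T)) * (pprt S - pprt (- S))"
    using assms by (simp add: Orth_uminus left_diff_distrib right_diff_distrib)
  then show ?thesis
    by (simp only: pprt_minus_pprt)
qed


section \<open>Closures of sets of orthomorphisms\<close>

text \<open>
  Birkhoff's inequality, which makes the lattice operations uniformly continuous in every locally
  solid topology.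
\<close>

lemma abs_sup_diff_le:
  fixes a b c d :: "'a::vector_lattice"
  shows "\<bar>sup a b - sup c d\<bar> \<le> \<bar>a - c\<bar> + \<bar>b - d\<bar>"
proof -
  have *: "sup a b - sup c d \<le> \<bar>a - c\<bar> + \<bar>b - d\<bar>" for a b c d :: 'a
  proof -
    have "a \<le> c + (\<bar>a - c\<bar> + \<bar>b - d\<bar>)"
      using add_mono[OF abs_ge_self[of "a - c"] abs_ge_zero[of "b - d"]] by (simp add: diff_le_eq add.commute)
    also have "\<dots> \<le> sup c d + (\<bar>a - c\<bar> + \<bar>b - d\<bar>)"
      by (rule add_right_mono) simp
    finally have a: "a \<le> sup c d + (\<bar>a - c\<bar> + \<bar>b - d\<bar>)" .
    have "b \<le> d + (\<bar>a - c\<bar> + \<bar>b - d\<bar>)"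
      using add_mono[OF abs_ge_zero[of "a - c"] abs_ge_self[of "b - d"]] by (simp add: diff_le_eq add.commute)
    also have "\<dots> \<le> sup c d + (\<bar>a - c\<bar> + \<bar>b - d\<bar>)"
      by (rule add_right_mono) simp
    finally have "sup a b \<le> sup c d + (\<bar>a - c\<bar> + \<bar>b - d\<bar>)"
      using a by simp
    then show ?thesis
      by (simp only: diff_le_eq add.commute)
  qed
  show ?thesis
  proof (rule abs_leI)
    show "- (sup a b - sup c d) \<le> \<bar>a - c\<bar> + \<bar>b - d\<bar>"
      using *[of c d a b] by (simp only: minus_diff_eq abs_minus_commute[of a] abs_minus_commute[of b])
  qed (rule *)
qed

lemma abs_inf_diff_le:
  fixes a b c d :: "'a::vector_lattice"
  shows "\<bar>inf a b - inf c d\<bar> \<le> \<bar>a - c\<bar> + \<bar>b - d\<bar>"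
proof -
  have "inf a b - inf c d = sup (- c) (- d) - sup (- a) (- b)"
    by (simp only: inf_eq_neg_sup minus_diff_minus minus_diff_eq)
  then show ?thesis
    using abs_sup_diff_le[of "- c" "- d" "- a" "- b"]
    by (simp only: minus_diff_minus minus_diff_eq)
qed

lemma (in lebesgue_base) sublattice_closure:
  assumes "sublattice A"
  shows "sublattice (base_topology \<U> closure_of A)"
  unfolding sublattice_def
proof (intro ballI conjI)
  fix x y assume xy: "x \<in> base_topology \<U> closure_of A" "y \<in> base_topology \<U> closure_of A"
  have approx: "\<exists>a\<in>A. \<exists>b\<in>A. \<forall>z. \<bar>z\<bar> \<le> \<bar>a - x\<bar> + \<bar>b - y\<bar> \<longrightarrow> z \<in> U" if U: "U \<in> \<U>" for U
  proof -
    obtain V where V: "V \<in> \<U>" "\<forall>u\<in>V. \<forall>v\<in>V. u + v \<in> U"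
      using halve[OF U] by blast
    obtain a where a: "a \<in> A" "a - x \<in> V"
      using xy(1) V(1) unfolding in_closure_base_topology by blast
    obtain b where b: "b \<in> A" "b - y \<in> V"
      using xy(2) V(1) unfolding in_closure_base_topology by blast
    have "\<bar>a - x\<bar> + \<bar>b - y\<bar> \<in> U"
      using V a b by (simp add: abs_mem)
    then have "z \<in> U" if "\<bar>z\<bar> \<le> \<bar>a - x\<bar> + \<bar>b - y\<bar>" for z
      using solidD[OF U, of "\<bar>a - x\<bar> + \<bar>b - y\<bar>" z] that by simp
    then show ?thesis
      using a(1) b(1) by blast
  qed
  have mem: "sup a b \<in> A" "inf a b \<in> A" if "a \<in> A" "b \<in> A" for a b
    using assms that unfolding sublattice_def by blast+
  show "sup x y \<in> base_topology \<U> closure_of A"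
    unfolding in_closure_base_topology
  proof
    fix U assume "U \<in> \<U>"
    then obtain a b where ab: "a \<in> A" "b \<in> A" "\<forall>z. \<bar>z\<bar> \<le> \<bar>a - x\<bar> + \<bar>b - y\<bar> \<longrightarrow> z \<in> U"
      using approx by meson
    then have "sup a b - sup x y \<in> U"
      using abs_sup_diff_le by blast
    then show "\<exists>a\<in>A. a - sup x y \<in> U"
      using mem(1)[OF ab(1,2)] by blast
  qed
  show "inf x y \<in> base_topology \<U> closure_of A"
    unfolding in_closure_base_topology
  proof
    fix U assume "U \<in> \<U>"
    then obtain a b where ab: "a \<in> A" "b \<in> A" "\<forall>z. \<bar>z\<bar> \<le> \<bar>a - x\<bar> + \<bar>b - y\<bar> \<longrightarrow> z \<in> U"
      using approx by meson
    then have "inf a b - inf x y \<in> U"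
      using abs_inf_diff_le by blast
    then show "\<exists>a\<in>A. a - inf x y \<in> U"
      using mem(2)[OF ab(1,2)] by blast
  qed
qed

definition pointwise_closure ::
  "'a::dedekind_complete_vector_lattice set set \<Rightarrow> 'a lob set \<Rightarrow> 'a lob set" where
  "pointwise_closure \<U> A = {T. \<forall>x\<ge>0. \<forall>U\<in>\<U>. \<exists>N\<in>A. lob_apply (N - T) x \<in> U}"

context lebesgue_base
begin

lemma pointwise_closureD:
  "T \<in> pointwise_closure \<U> A \<Longrightarrow> 0 \<le> x \<Longrightarrow> U \<in> \<U> \<Longrightarrow> \<exists>N\<in>A. lob_apply (N - T) x \<in> U"
  unfolding pointwise_closure_def by blast

text \<open>
  If \<open>x\<close> is in a band \<open>B\<close> and \<open>w\<close> is disjoint from \<open>B\<close>, then \<open>Nx\<close> is disjoint from \<open>w\<close> for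
  every orthomorphism \<open>N\<close>, so \<open>\<bar>Tx\<bar> \<and> \<bar>w\<bar> \<le> \<bar>(N - T)x\<bar>\<close>.
\<close>

lemma pointwise_closure_Orth:
  assumes A: "A \<subseteq> Orth"
  shows "pointwise_closure \<U> A \<subseteq> Orth"
proof
  fix T assume T: "T \<in> pointwise_closure \<U> A"
  show "T \<in> Orth"
  proof (rule OrthI, rule band_double_complement)
    fix B x w assume B: "band B" "x \<in> B" "(0::'a) \<le> x" and w: "\<And>b. b \<in> B \<Longrightarrow> lat_disjoint b w"
    have "inf \<bar>lob_apply T x\<bar> \<bar>w\<bar> \<in> U" if U: "U \<in> \<U>" for U
    proof -
      obtain N where N: "N \<in> A" "lob_apply (N - T) x \<in> U"
        using pointwise_closureD[OF T B(3) U] by blast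
      have "lat_disjoint (lob_apply N x) \<bar>w\<bar>"
        using w[OF OrthD[OF _ B(1,2)], of N] N(1) A by (auto simp: lat_disjoint_def)
      then have "inf \<bar>lob_apply (T - N) x + lob_apply N x\<bar> \<bar>w\<bar> = inf \<bar>lob_apply (T - N) x\<bar> \<bar>w\<bar>"
        by (rule inf_abs_add_disj) simp
      also have "lob_apply (T - N) x + lob_apply N x = lob_apply T x"
        by simp
      finally have "inf \<bar>lob_apply T x\<bar> \<bar>w\<bar> \<le> \<bar>lob_apply (N - T) x\<bar>"
        by (simp add: abs_minus_commute)
      then show ?thesis
        using solidD[OF U N(2)] by simp
    qed
    then have "inf \<bar>lob_apply T x\<bar> \<bar>w\<bar> = 0"
      by (rule separated)
    then show "lat_disjoint (lob_apply T x) w"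
      by (simp add: lat_disjoint_def)
  qed
qed

text \<open>
  For an orthomorphism \<open>T\<close> the value at \<open>x \<ge> 0\<close> controls those at all \<open>z\<close> with \<open>\<bar>z\<bar> \<le> x\<close>.
  Hence the pairs \<open>(x, U)\<close>, directed by increasing \<open>x\<close> and decreasing \<open>U\<close>, index a strongly
  convergent net.
\<close>

lemma strong_adherence_eq_pointwise_closure:
  assumes A: "A \<subseteq> Orth"
  shows "strong_adherence (base_topology \<U>) A = pointwise_closure \<U> A"
proof
  show "strong_adherence (base_topology \<U>) A \<subseteq> pointwise_closure \<U> A"
  proof
    fix T assume "T \<in> strong_adherence (base_topology \<U>) A"
    then obtain I :: "('a lob \<times> 'a lob set) set" and le N where I: "directed_set I le"
      and N: "N ` I \<subseteq> A"
      and lim: "\<And>x. limitin (base_topology \<U>) (\<lambda>a. lob_apply (N a) x) (lob_apply T x) (net_filter I le)"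
      unfolding strong_adherence_def by blast
    show "T \<in> pointwise_closure \<U> A"
      unfolding pointwise_closure_def
    proof (intro CollectI allI impI ballI)
      fix x U assume "U \<in> \<U>"
      then have "\<forall>\<^sub>F a in net_filter I le. lob_apply (N a) x - lob_apply T x \<in> U"
        using lim[of x] unfolding limitin_base_topology by blast
      then obtain a where a: "a \<in> I" "\<forall>b\<in>I. le a b \<longrightarrow> lob_apply (N b) x - lob_apply T x \<in> U"
        unfolding eventually_net_filter[OF I] by blast
      moreover have "le a a"
        using I a(1) unfolding directed_set_def by blast
      ultimately have "lob_apply (N a - T) x \<in> U"
        by simp
      then show "\<exists>N\<in>A. lob_apply (N - T) x \<in> U"
        using N a(1) by blast
    qed
  qed
  show "pointwise_closure \<U> A \<subseteq> strong_adherence (base_topology \<U>) A"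
  proof
    fix T assume T: "T \<in> pointwise_closure \<U> A"
    define I where "I = {(x :: 'a, U). 0 \<le> x \<and> U \<in> \<U>}"
    define le :: "'a \<times> 'a set \<Rightarrow> 'a \<times> 'a set \<Rightarrow> bool" where
      "le p q \<longleftrightarrow> fst p \<le> fst q \<and> snd q \<subseteq> snd p" for p q
    have I: "directed_set I le"
      unfolding directed_set_def
    proof (intro conjI ballI impI)
      show "I \<noteq> {}"
        using nonempty unfolding I_def by auto
      show "le p p" for p
        by (simp add: le_def)
      show "le p r" if "le p q \<and> le q r" for p q r
        using that unfolding le_def by (auto intro: order_trans)
      fix p q assume "p \<in> I" "q \<in> I"
      then obtain x U y V where pq: "p = (x, U)" "q = (y, V)" "0 \<le> x" "0 \<le> y" "U \<in> \<U>" "V \<in> \<U>"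
        unfolding I_def by blast
      then obtain W where "W \<in> \<U>" "W \<subseteq> U \<inter> V"
        using refine by blast
      then show "\<exists>r\<in>I. le p r \<and> le q r"
        using pq by (intro bexI[of _ "(sup x y, W)"]) (auto simp: I_def le_def le_supI1)
    qed
    have "\<forall>p\<in>I. \<exists>N. N \<in> A \<and> lob_apply (N - T) (fst p) \<in> snd p"
      using pointwise_closureD[OF T] unfolding I_def by fastforce
    then obtain N where N: "\<And>p. p \<in> I \<Longrightarrow> N p \<in> A"
      "\<And>p. p \<in> I \<Longrightarrow> lob_apply (N p - T) (fst p) \<in> snd p"
      by metis
    show "T \<in> strong_adherence (base_topology \<U>) A"
    proof (rule strong_adherence_any_index[OF I])
      show "N ` I \<subseteq> A"
        using N(1) by blast
      fix z
      show "limitin (base_topology \<U>) (\<lambda>p. lob_apply (N p) z) (lob_apply T z) (net_filter I le)"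
        unfolding limitin_base_topology eventually_net_filter[OF I]
      proof (intro ballI bexI[of _ "(\<bar>z\<bar>, U)" for U] impI)
        fix U p assume U: "U \<in> \<U>" and p: "p \<in> I" "le (\<bar>z\<bar>, U) p"
        have z: "\<bar>z\<bar> \<le> fst p" "0 \<le> fst p" "snd p \<subseteq> U"
          using p by (auto simp: le_def I_def)
        have orth: "N p - T \<in> Orth"
          using N(1)[OF p(1)] T A pointwise_closure_Orth[OF A] by (intro Orth_diff) blast+
        have "\<bar>lob_apply (N p - T) z\<bar> \<le> lob_apply \<bar>N p - T\<bar> \<bar>z\<bar>"
          by (rule lob_abs_apply_le)
        also have "\<dots> \<le> lob_apply \<bar>N p - T\<bar> (fst p)"
          by (rule lob_apply_mono[OF abs_ge_zero z(1)])
        also have "\<dots> = \<bar>lob_apply (N p - T) (fst p)\<bar>"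
          by (rule abs_apply_Orth[OF orth z(2)])
        finally have "lob_apply (N p - T) z \<in> U"
          using N(2)[OF p(1)] z(3) solidD[OF U] by blast
        then show "lob_apply (N p) z - lob_apply T z \<in> U"
          by simp
      qed (simp add: I_def)
    qed
  qed
qed

lemma in_closure_unbounded_abs_strong:
  "T \<in> base_topology (unbounded (abs_strong \<U>)) closure_of A \<longleftrightarrow>
     (\<forall>S\<ge>0. \<forall>x\<ge>0. \<forall>U\<in>\<U>. \<exists>N\<in>A. lob_apply (inf \<bar>N - T\<bar> S) x \<in> U)"
proof -
  interpret strong: lebesgue_base "abs_strong \<U>"
    by (rule lebesgue_base_abs_strong) (rule lebesgue_base_axioms)
  interpret un: lebesgue_base "unbounded (abs_strong \<U>)"
    by (rule strong.lebesgue_base_unbounded)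
  show ?thesis
    unfolding un.in_closure_base_topology
  proof safe
    fix S x U assume *: "\<forall>W\<in>unbounded (abs_strong \<U>). \<exists>N\<in>A. N - T \<in> W"
      and "(0::'a lob) \<le> S" "(0::'a) \<le> x" "U \<in> \<U>"
    then have "{R. inf \<bar>R\<bar> S \<in> {R. lob_apply \<bar>R\<bar> x \<in> U}} \<in> unbounded (abs_strong \<U>)"
      by (intro unboundedI abs_strongI)
    from bspec[OF * this] obtain N where N: "N \<in> A" "lob_apply \<bar>inf (\<bar>N - T\<bar>) S\<bar> x \<in> U"
      unfolding mem_Collect_eq by (elim bexE)
    have "\<bar>inf (\<bar>N - T\<bar>) S\<bar> = inf \<bar>N - T\<bar> S"
      using \<open>0 \<le> S\<close> by simp
    then show "\<exists>N\<in>A. lob_apply (inf \<bar>N - T\<bar> S) x \<in> U"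
      using N by (intro bexI[of _ N]) simp_all
  next
    fix W assume *: "\<forall>S\<ge>0. \<forall>x\<ge>0. \<forall>U\<in>\<U>. \<exists>N\<in>A. lob_apply (inf \<bar>N - T\<bar> S) x \<in> U"
      and "W \<in> unbounded (abs_strong \<U>)"
    then obtain V S where V: "V \<in> abs_strong \<U>" "0 \<le> S" "W = {R. inf \<bar>R\<bar> S \<in> V}"
      by (elim unboundedE)
    then obtain U x where U: "U \<in> \<U>" "0 \<le> x" "V = {R. lob_apply \<bar>R\<bar> x \<in> U}"
      by (elim abs_strongE)
    obtain N where N: "N \<in> A" "lob_apply (inf \<bar>N - T\<bar> S) x \<in> U"
      using *[rule_format, OF V(2) U(2,1)] by (elim bexE)
    have "\<bar>inf (\<bar>N - T\<bar>) S\<bar> = inf \<bar>N - T\<bar> S"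
      using V(2) by simp
    then show "\<exists>N\<in>A. N - T \<in> W"
      unfolding V(3) U(3) using N by (intro bexI[of _ N]) simp_all
  qed
qed

text \<open>
  As for pointwise limits, but only truncations of \<open>\<bar>N - T\<bar>\<close> are under control. Truncating at
  \<open>\<bar>T\<bar>\<close> suffices: \<open>\<bar>Tx\<bar> \<and> \<bar>w\<bar>\<close> is at most the infimum of \<open>\<bar>N - T\<bar>y + \<bar>T\<bar>(x - y)\<close> over
  \<open>0 \<le> y \<le> x\<close>, since \<open>\<bar>Ty\<bar> \<and> \<bar>w\<bar> \<le> \<bar>N - T\<bar>y\<close> for these \<open>y\<close>.
\<close>

lemma closure_unbounded_abs_strong_Orth:
  assumes A: "A \<subseteq> Orth"
  shows "base_topology (unbounded (abs_strong \<U>)) closure_of A \<subseteq> Orth"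
proof
  fix T assume T: "T \<in> base_topology (unbounded (abs_strong \<U>)) closure_of A"
  show "T \<in> Orth"
  proof (rule OrthI, rule band_double_complement)
    fix B x w assume B: "band B" "x \<in> B" "(0::'a) \<le> x" and w: "\<And>b. b \<in> B \<Longrightarrow> lat_disjoint b w"
    have "inf \<bar>lob_apply T x\<bar> \<bar>w\<bar> \<in> U" if U: "U \<in> \<U>" for U
    proof -
      obtain N where N: "N \<in> A" "lob_apply (inf \<bar>N - T\<bar> \<bar>T\<bar>) x \<in> U"
        using T B(3) U unfolding in_closure_unbounded_abs_strong by (meson abs_ge_zero)
      have "inf \<bar>lob_apply T x\<bar> \<bar>w\<bar> \<le> lob_apply (inf \<bar>N - T\<bar> \<bar>T\<bar>) x"
      proof (rule inf_lob_apply_ge[OF B(3)])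
        fix y assume y: "0 \<le> y" "y \<le> x"
        have "y \<in> B"
          by (rule band_solidD[OF B(1,2)]) (use y in simp)
        then have "lat_disjoint (lob_apply N y) \<bar>w\<bar>"
          using w[OF OrthD[OF _ B(1)], of N y] N(1) A by (auto simp: lat_disjoint_def)
        then have "inf \<bar>lob_apply (T - N) y + lob_apply N y\<bar> \<bar>w\<bar> = inf \<bar>lob_apply (T - N) y\<bar> \<bar>w\<bar>"
          by (rule inf_abs_add_disj) simp
        also have "lob_apply (T - N) y + lob_apply N y = lob_apply T y"
          by simp
        also have "inf \<bar>lob_apply (T - N) y\<bar> \<bar>w\<bar> \<le> \<bar>lob_apply (N - T) y\<bar>"
          by (simp add: abs_minus_commute)
        also have "\<dots> \<le> lob_apply \<bar>N - T\<bar> y"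
          using lob_abs_apply_le[of "N - T" y] y by simp
        finally have 1: "inf \<bar>lob_apply T y\<bar> \<bar>w\<bar> \<le> lob_apply \<bar>N - T\<bar> y" .
        have 2: "inf \<bar>lob_apply T (x - y)\<bar> \<bar>w\<bar> \<le> lob_apply \<bar>T\<bar> (x - y)"
          using lob_abs_apply_le[of T "x - y"] y by (simp add: le_infI1)
        have "inf \<bar>lob_apply T x\<bar> \<bar>w\<bar> = inf \<bar>lob_apply T y + lob_apply T (x - y)\<bar> \<bar>w\<bar>"
          by (simp flip: linear_add[OF linear_lob])
        also have "\<dots> \<le> inf \<bar>lob_apply T y\<bar> \<bar>w\<bar> + inf \<bar>lob_apply T (x - y)\<bar> \<bar>w\<bar>"
          by (rule inf_abs_add_le) simp
        also have "\<dots> \<le> lob_apply \<bar>N - T\<bar> y + lob_apply \<bar>T\<bar> (x - y)"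
          by (rule add_mono[OF 1 2])
        finally show "inf \<bar>lob_apply T x\<bar> \<bar>w\<bar> \<le> lob_apply \<bar>N - T\<bar> y + lob_apply \<bar>T\<bar> (x - y)" .
      qed
      then show ?thesis
        by (intro nonneg_mem_mono[OF U N(2)]) simp_all
    qed
    then have "inf \<bar>lob_apply T x\<bar> \<bar>w\<bar> = 0"
      by (rule separated)
    then show "lat_disjoint (lob_apply T x) w"
      by (simp add: lat_disjoint_def)
  qed
qed

lemma pointwise_closure_subset_closure:
  assumes A: "A \<subseteq> Orth"
  shows "pointwise_closure \<U> A \<subseteq> base_topology (unbounded (abs_strong \<U>)) closure_of A"
proof
  fix T assume T: "T \<in> pointwise_closure \<U> A"
  show "T \<in> base_topology (unbounded (abs_strong \<U>)) closure_of A"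
    unfolding in_closure_unbounded_abs_strong
  proof (intro allI impI ballI)
    fix S :: "'a lob" and x :: 'a and U assume S: "0 \<le> S" and x: "0 \<le> x" and U: "U \<in> \<U>"
    obtain N where N: "N \<in> A" "lob_apply (N - T) x \<in> U"
      using pointwise_closureD[OF T x U] by blast
    have orth: "N - T \<in> Orth"
      using N(1) T A pointwise_closure_Orth[OF A] by (intro Orth_diff) blast+
    have "lob_apply (inf \<bar>N - T\<bar> S) x \<le> lob_apply \<bar>N - T\<bar> x"
      by (rule lob_apply_mono_op[OF inf_le1 x])
    also have "\<dots> = \<bar>lob_apply (N - T) x\<bar>"
      by (rule abs_apply_Orth[OF orth x])
    finally have le: "lob_apply (inf \<bar>N - T\<bar> S) x \<le> \<bar>lob_apply (N - T) x\<bar>" .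
    have "0 \<le> lob_apply (inf \<bar>N - T\<bar> S) x"
      using S by (intro lob_apply_nonneg[OF _ x]) simp
    moreover have "\<bar>lob_apply (N - T) x\<bar> \<in> U"
      using N(2) abs_mem[OF U] by blast
    ultimately have "lob_apply (inf \<bar>N - T\<bar> S) x \<in> U"
      using nonneg_mem_mono[OF U _ _ le] by blast
    then show "\<exists>N\<in>A. lob_apply (inf \<bar>N - T\<bar> S) x \<in> U"
      using N(1) by blast
  qed
qed

text \<open>
  The multiples of \<open>x\<close>, cut off at \<open>y\<close>, exhaust the component of \<open>y\<close> in the band generated by
  \<open>x\<close>: an element of both \<open>y - p\<close> and \<open>x\<close> could be added once more to each cut-off multiple.
\<close>

lemma band_component:
  fixes x y :: 'a
  assumes "0 \<le> x" "0 \<le> y"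
  obtains p where "is_supremum (range (\<lambda>k. inf y (real k *\<^sub>R x))) p" "0 \<le> p" "p \<le> y"
    "lat_disjoint (y - p) x"
proof -
  define t where "t k = inf y (real k *\<^sub>R x)" for k
  define p where "p = Sup (range t)"
  have p: "is_supremum (range t) p"
    unfolding p_def t_def by (intro is_supremum_cSup bdd_aboveI2[where M = y]) auto
  then have t_p: "t k \<le> p" for k
    unfolding is_supremum_def by blast
  have "p \<le> y"
    using p unfolding is_supremum_def t_def by auto
  have "0 \<le> p"
    using t_p[of 0] assms by (simp add: t_def inf_absorb2)
  define d where "d = inf (y - p) x"
  have d: "0 \<le> d" "d \<le> y - p" "d \<le> x"
    using \<open>p \<le> y\<close> assms by (simp_all add: d_def)
  have "t k \<le> p - d" for k
  proof -
    have "t k + d \<le> p + (y - p)"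
      by (rule add_mono[OF t_p d(2)])
    moreover have "t k + d \<le> real k *\<^sub>R x + x"
      by (rule add_mono[OF _ d(3)]) (simp add: t_def)
    ultimately have "t k + d \<le> t (Suc k)"
      by (simp add: t_def algebra_simps)
    also have "\<dots> \<le> p"
      by (rule t_p)
    finally show ?thesis
      by (simp add: le_diff_eq)
  qed
  then have "p \<le> p - d"
    using p unfolding is_supremum_def by blast
  then have "d = 0"
    using d(1) by (simp add: order.antisym)
  then have "lat_disjoint (y - p) x"
    using \<open>p \<le> y\<close> assms(1) by (simp add: lat_disjoint_nonneg d_def)
  then show thesis
    using that p \<open>0 \<le> p\<close> \<open>p \<le> y\<close> unfolding t_def by blast
qed

text \<open>
  Let \<open>R = \<bar>N - T\<bar>\<close>. It suffices to make \<open>Rx \<and> y\<close> small for a single \<open>y \<ge> 0\<close> dictated by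
  \<open>U\<close>. Split \<open>y\<close> into \<open>y \<and> kx\<close>, the rest of its component \<open>p\<close> in the band generated by \<open>x\<close>,
  and \<open>y - p\<close>. The last part is disjoint from \<open>Rx\<close>, the middle part is small for large \<open>k\<close>
  whatever \<open>R\<close> is, and \<open>Rx \<and> kx\<close> is controlled by \<open>(R \<and> kI)x\<close>.
\<close>

lemma closure_subset_pointwise_closure:
  assumes A: "A \<subseteq> Orth" and un: "\<And>U. U \<in> \<U> \<Longrightarrow> \<exists>W\<in>unbounded \<U>. W \<subseteq> U"
  shows "base_topology (unbounded (abs_strong \<U>)) closure_of A \<subseteq> pointwise_closure \<U> A"
proof
  fix T assume T: "T \<in> base_topology (unbounded (abs_strong \<U>)) closure_of A"
  have T_Orth: "T \<in> Orth"
    using T closure_unbounded_abs_strong_Orth[OF A] by blast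
  show "T \<in> pointwise_closure \<U> A"
    unfolding pointwise_closure_def
  proof (intro CollectI allI impI ballI)
    fix x :: 'a and U assume x: "0 \<le> x" and U: "U \<in> \<U>"
    obtain W where W: "W \<in> unbounded \<U>" "W \<subseteq> U"
      using un[OF U] by blast
    obtain U' y where U': "U' \<in> \<U>" "0 \<le> y" "W = {z. inf \<bar>z\<bar> y \<in> U'}"
      using W(1) by (rule unboundedE)
    obtain V where V: "V \<in> \<U>" "\<forall>a\<in>V. \<forall>b\<in>V. a + b \<in> U'"
      using halve[OF U'(1)] by blast
    obtain V' where V': "V' \<in> \<U>" "\<forall>a\<in>V'. \<forall>b\<in>V'. a + b \<in> V"
      using halve[OF V(1)] by blast
    obtain p where p: "is_supremum (range (\<lambda>k. inf y (real k *\<^sub>R x))) p" "0 \<le> p" "p \<le> y"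
      "lat_disjoint (y - p) x"
      using band_component[OF x U'(2)] .
    have "mono (\<lambda>k. inf y (real k *\<^sub>R x))"
      unfolding mono_def using x by (auto intro!: le_infI2 scaleR_right_mono)
    then obtain k where k: "p - inf y (real k *\<^sub>R x) \<in> V"
      using lebesgue[OF V(1) supremum_minus_down[OF up_directed_range_mono p(1)]] by blast
    have kI: "0 \<le> real k *\<^sub>R (id_lob :: 'a lob)"
      by (intro scaleR_nonneg_nonneg id_lob_nonneg) simp
    obtain N where N: "N \<in> A" "lob_apply (inf \<bar>N - T\<bar> (real k *\<^sub>R id_lob)) x \<in> V'"
      using T x V'(1) kI unfolding in_closure_unbounded_abs_strong by meson
    define R where "R = \<bar>N - T\<bar>"
    have orth: "N - T \<in> Orth"
      using N(1) A T_Orth by (intro Orth_diff) blast+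
    have R: "R \<in> Orth" "0 \<le> R"
      unfolding R_def using orth by (simp_all add: Orth_abs)
    have Rx: "0 \<le> lob_apply R x"
      by (rule lob_apply_nonneg[OF R(2) x])
    have kx: "0 \<le> real k *\<^sub>R x"
      using x by (simp add: scaleR_nonneg_nonneg)
    have le1: "inf (lob_apply R x) (real k *\<^sub>R x) \<le> 2 *\<^sub>R lob_apply (inf R (real k *\<^sub>R id_lob)) x"
      using inf_apply_Orth_le[OF R Orth_scaleR[OF id_lob_Orth] kI x] by simp
    have mem1: "2 *\<^sub>R lob_apply (inf R (real k *\<^sub>R id_lob)) x \<in> V"
      using V'(2) N(2) unfolding R_def scaleR_2 by simp
    have small1: "inf (lob_apply R x) (real k *\<^sub>R x) \<in> V"
      by (rule nonneg_mem_mono[OF V(1) mem1 le_infI[OF Rx kx] le1])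
    let ?t = "inf y (real k *\<^sub>R x)"
    have t: "0 \<le> ?t" "?t \<le> p"
      using U'(2) kx p(1) by (auto simp: is_supremum_def)
    have pt: "0 \<le> p - ?t" and yp: "0 \<le> y - p"
      by (simp_all only: diff_ge_0_iff_ge t p(3))
    have "lat_disjoint (lob_apply R x) (y - p)"
      by (rule Orth_disj[OF R(1) lat_disjoint_sym[OF p(4)]])
    then have zero: "inf (y - p) (lob_apply R x) = 0"
      using Rx p(3) by (simp add: lat_disjoint_nonneg inf_commute)
    have "y = t + ((p - t) + (y - p))" for t
      by simp
    then have "inf y (lob_apply R x) = inf (?t + ((p - ?t) + (y - p))) (lob_apply R x)"
      by (rule arg_cong[where f = "\<lambda>z. inf z (lob_apply R x)"])
    also have "\<dots> \<le> inf ?t (lob_apply R x) + inf ((p - ?t) + (y - p)) (lob_apply R x)"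
      by (rule inf_add_le[OF t(1) add_nonneg_nonneg[OF pt yp] Rx])
    also have "\<dots> \<le> inf ?t (lob_apply R x) + (inf (p - ?t) (lob_apply R x) + inf (y - p) (lob_apply R x))"
      by (rule add_left_mono[OF inf_add_le[OF pt yp Rx]])
    also have "\<dots> \<le> inf (lob_apply R x) (real k *\<^sub>R x) + (p - ?t)"
      unfolding zero add_0_right by (rule add_mono[OF _ inf_le1]) (simp add: le_infI1)
    finally have le: "inf y (lob_apply R x) \<le> inf (lob_apply R x) (real k *\<^sub>R x) + (p - ?t)" .
    have "inf y (lob_apply R x) \<in> U'"
      by (rule nonneg_mem_mono[OF U'(1) V(2)[rule_format, OF small1 k] le_infI[OF U'(2) Rx] le])
    then have "lob_apply (N - T) x \<in> W"
      using U'(3) abs_apply_Orth[OF orth x] by (simp add: R_def inf_commute)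
    then show "\<exists>N\<in>A. lob_apply (N - T) x \<in> U"
      using N(1) W(2) by blast
  qed
qed

text \<open>
  The sign of the argument is irrelevant, as \<open>\<bar>(N - T)x\<bar> \<le> \<bar>(N - T)\<bar>x\<bar>\<bar>\<close>.
\<close>

lemma pointwise_closure_arbitrary:
  assumes A: "A \<subseteq> Orth" and T: "T \<in> pointwise_closure \<U> A" and U: "U \<in> \<U>"
  shows "\<exists>N\<in>A. lob_apply (N - T) x \<in> U"
proof -
  obtain N where N: "N \<in> A" "lob_apply (N - T) \<bar>x\<bar> \<in> U"
    using pointwise_closureD[OF T _ U, of "\<bar>x\<bar>"] by auto
  have orth: "N - T \<in> Orth"
    using N(1) T A pointwise_closure_Orth[OF A] by (intro Orth_diff) blast+
  have "\<bar>lob_apply (N - T) x\<bar> \<le> \<bar>lob_apply (N - T) \<bar>x\<bar>\<bar>"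
    using lob_abs_apply_le[of "N - T" x] abs_apply_Orth[OF orth, of "\<bar>x\<bar>"] by simp
  then show ?thesis
    using N solidD[OF U] by blast
qed

lemma subalgebra_pointwise_closure:
  assumes A: "subalgebra A" "A \<subseteq> Orth"
  shows "subalgebra (pointwise_closure \<U> A)"
  unfolding subalgebra_def subspace_def
proof (intro conjI ballI allI)
  have subA: "subspace A" and multA: "\<And>S T. S \<in> A \<Longrightarrow> T \<in> A \<Longrightarrow> S * T \<in> A"
    using A(1) unfolding subalgebra_def by blast+
  show "0 \<in> pointwise_closure \<U> A"
    unfolding pointwise_closure_def
  proof (intro CollectI allI impI ballI)
    show "\<exists>N\<in>A. lob_apply (N - 0) x \<in> U" if "U \<in> \<U>" for x U
      using subspace_0[OF subA] zero_mem[OF that] by (intro bexI[of _ 0]) simp_all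
  qed
  fix S assume S: "S \<in> pointwise_closure \<U> A"
  show "r *\<^sub>R S \<in> pointwise_closure \<U> A" for r
    unfolding pointwise_closure_def
  proof (intro CollectI allI impI ballI)
    fix x :: 'a and U assume x: "0 \<le> x" and U: "U \<in> \<U>"
    obtain V where V: "V \<in> \<U>" "\<And>z s. z \<in> V \<Longrightarrow> \<bar>s\<bar> \<le> \<bar>r\<bar> \<Longrightarrow> s *\<^sub>R z \<in> U"
      using scale[OF U] by blast
    obtain M where M: "M \<in> A" "lob_apply (M - S) x \<in> V"
      using pointwise_closureD[OF S x V(1)] by blast
    have "lob_apply (r *\<^sub>R M - r *\<^sub>R S) x \<in> U"
      using V(2)[OF M(2), of r] by (simp add: scaleR_right_diff_distrib)
    then show "\<exists>N\<in>A. lob_apply (N - r *\<^sub>R S) x \<in> U"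
      using subspace_scale[OF subA M(1)] by blast
  qed
  fix T assume T: "T \<in> pointwise_closure \<U> A"
  show "S + T \<in> pointwise_closure \<U> A"
    unfolding pointwise_closure_def
  proof (intro CollectI allI impI ballI)
    fix x :: 'a and U assume x: "0 \<le> x" and U: "U \<in> \<U>"
    obtain V where V: "V \<in> \<U>" "\<forall>a\<in>V. \<forall>b\<in>V. a + b \<in> U"
      using halve[OF U] by blast
    obtain M where M: "M \<in> A" "lob_apply (M - S) x \<in> V"
      using pointwise_closureD[OF S x V(1)] by blast
    obtain N where N: "N \<in> A" "lob_apply (N - T) x \<in> V"
      using pointwise_closureD[OF T x V(1)] by blast
    have "lob_apply (M - S) x + lob_apply (N - T) x \<in> U"
      by (rule V(2)[rule_format, OF M(2) N(2)])
    then have "lob_apply (M + N - (S + T)) x \<in> U"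
      by (simp add: algebra_simps)
    then show "\<exists>N\<in>A. lob_apply (N - (S + T)) x \<in> U"
      using subspace_add[OF subA M(1) N(1)] by blast
  qed
  show "S * T \<in> pointwise_closure \<U> A"
    unfolding pointwise_closure_def
  proof (intro CollectI allI impI ballI)
    fix x :: 'a and U assume x: "0 \<le> x" and U: "U \<in> \<U>"
    \<comment> \<open>\<open>N\<close> is chosen after \<open>M\<close>, for the element \<open>Mx\<close>, which is possible since \<open>M\<close> and \<open>N - T\<close> commute.\<close>
    obtain V where V: "V \<in> \<U>" "\<forall>a\<in>V. \<forall>b\<in>V. a + b \<in> U"
      using halve[OF U] by blast
    obtain M where M: "M \<in> A" "lob_apply (M - S) (lob_apply T x) \<in> V"
      using pointwise_closure_arbitrary[OF A(2) S V(1)] by blast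
    obtain N where N: "N \<in> A" "lob_apply (N - T) (lob_apply M x) \<in> V"
      using pointwise_closure_arbitrary[OF A(2) T V(1)] by blast
    have "M \<in> Orth" "N - T \<in> Orth"
      using M(1) N(1) T A(2) pointwise_closure_Orth[OF A(2)] by (auto intro!: Orth_diff)
    then have "lob_apply (N - T) (lob_apply M x) = lob_apply M (lob_apply (N - T) x)"
      using Orth_commute[of "N - T" M] by (metis times_lob.rep_eq)
    then have "lob_apply (M - S) (lob_apply T x) + lob_apply M (lob_apply (N - T) x) \<in> U"
      using V(2)[rule_format, OF M(2) N(2)] by simp
    then have "lob_apply (M * N - S * T) x \<in> U"
      by (simp add: linear_diff[OF linear_lob])
    then show "\<exists>N\<in>A. lob_apply (N - S * T) x \<in> U"
      using multA[OF M(1) N(1)] by blast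
  qed
qed

end


theorem corollary5p12:
  fixes A :: "'a::dedekind_complete_vector_lattice lob set"
  assumes "\<exists>\<tau> :: 'a topology. hausdorff_uo_lebesgue \<tau>"
    and "subalgebra A" and "A \<subseteq> Orth"
  shows "uo_topology closure_of A = strong_adherence uo_topology A \<and>
    uo_topology closure_of A \<subseteq> Orth \<and>
    subalgebra (uo_topology closure_of A) \<and>
    (sublattice A \<longrightarrow> sublattice (uo_topology closure_of A))"
proof -
  obtain \<tau> :: "'a topology" where \<tau>: "hausdorff_uo_lebesgue \<tau>"
    using assms(1) by blast
  define \<U> where "\<U> = solid_nhds \<tau>"
  interpret E: lebesgue_base \<U>
    unfolding \<U>_def by (rule lebesgue_base_solid_nhds[OF \<tau>])
  interpret L: lebesgue_base "abs_strong \<U>"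
    by (rule lebesgue_base_abs_strong) (rule E.lebesgue_base_axioms)
  interpret uL: lebesgue_base "unbounded (abs_strong \<U>)"
    by (rule L.lebesgue_base_unbounded)
  have topE: "(uo_topology :: 'a topology) = base_topology \<U>"
    unfolding \<U>_def base_topology_solid_nhds[OF \<tau>] by (rule uo_topology_eqI[OF \<tau>])
  have topL: "(uo_topology :: 'a lob topology) = base_topology (unbounded (abs_strong \<U>))"
    by (rule uo_topology_eqI[OF L.hausdorff_uo_lebesgue_base_topology_unbounded])
  have unb: "\<exists>W\<in>unbounded \<U>. W \<subseteq> U" if "U \<in> \<U>" for U
    using finer_than_uo_lebesgue[OF \<tau> E.lebesgue_base_unbounded] that unfolding \<U>_def .
  have closure: "uo_topology closure_of A = pointwise_closure \<U> A"
    unfolding topL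
    by (rule equalityI[OF E.closure_subset_pointwise_closure[OF assms(3) unb]
        E.pointwise_closure_subset_closure[OF assms(3)]])
  show ?thesis
  proof (intro conjI impI)
    show "uo_topology closure_of A = strong_adherence uo_topology A"
      unfolding closure topE E.strong_adherence_eq_pointwise_closure[OF assms(3)] ..
    show "uo_topology closure_of A \<subseteq> Orth"
      unfolding closure by (rule E.pointwise_closure_Orth[OF assms(3)])
    show "subalgebra (uo_topology closure_of A)"
      unfolding closure by (rule E.subalgebra_pointwise_closure[OF assms(2,3)])
    show "sublattice (uo_topology closure_of A)" if "sublattice A"
      unfolding topL by (rule uL.sublattice_closure[OF that])
  qed
qed

end
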